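(* Let $I\subset\mathbb{R}$ be a bounded interval. For every real $1\leq p<\infty$ and for $p=\infty$, and for every $f\in L^p(I)$, there exists a weakly Cauchy sequence $\{\overline{s}_n\}_{n\in\mathbb{N}}$ (with respect to the $\mathcal{L}^p(I_{\mathcal{R}})$ norm) of measurable functions in $\mathcal{M}(I_{\mathcal{R}})$ such that: (1) $\operatorname{w-lim}_{n\to\infty}\|\overline{s}_n\|_p=\|f\|_p$; (2) for every interval $J\subseteq I$, $\operatorname{w-lim}_{n\to\infty}\|\overline{s}_n\cdot\chi_{J_{\mathcal{R}}}\|_p=\|f\cdot\chi_J\|_p$; and (3) for a.e. $x\in I$ there exists a subsequence $\{\overline{s}_{n_k}\}_{k\in\mathbb{N}}$ such that $\operatorname{w-lim}_{k\to\infty}\overline{s}_{n_k}(x)=f(x)$.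
   Context: A set $F\subset\mathbb{Q}$ is left-finite if $\{x\in F: x\le q\}$ is finite for every $q\in\mathbb{Q}$. The Levi-Civita field $\mathcal{R}$ is the set of functions $x:\mathbb{Q}\to\mathbb{R}$ (values written $x[q]$) whose support $\{q: x[q]\neq 0\}$ is left-finite, with pointwise sum and product $(x\cdot y)[q]=\sum_{q_1+q_2=q}x[q_1]y[q_2]$. For $x\ne 0$, $\lambda(x)=\min\operatorname{supp}(x)$, and $\lambda(0)=\infty$. For $x\neq y$, $x<y$ iff $(x-y)[\lambda(x-y)]<0$. This makes $\mathcal{R}$ an ordered (real closed) field containing $\mathbb{R}$. For a bounded real interval $I$, $I_{\mathcal{R}}$ is the interval of $\mathcal{R}$ with the same endpoints and of the same type (open, closed, half-open). A sequence strongly converges to $l$ if for every $\varepsilon\in\mathcal{R}$, $\varepsilon>0$, eventually $|a_n-l|<\varepsilon$. It weakly converges to $l\in\mathcal{R}$ (written $\operatorname{w-lim}a_n=l$) if for every real $\varepsilon>0$, eventually $\max_{q\in\mathbb{Q},q\le\varepsilon^{-1}}|(a_n-l)[q]|<\varepsilon$. It diverges to $+\infty$ if for every $M\in\mathcal{R}$ eventually $a_n>M$. For $a\le b$ in $\mathcal{R}$, $I(a,b)$ denotes any of the four intervals of $\mathcal{R}$ with endpoints $a,b$ (degenerate intervals allowed), with length $l(I(a,b))=b-a$. A set $A\subseteq\mathcal{R}$ is measurable iff for every $\varepsilon\in\mathcal{R}$, $\varepsilon>0$, there are two sequences of mutually disjoint intervals $\{I_n\}$, $\{J_n\}$ such that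 $\bigcup_n I_n\subseteq A\subseteq\bigcup_n J_n$, $\sum_n l(I_n)$ and $\sum_n l(J_n)$ strongly converge, and $\sum_n l(J_n)-\sum_n l(I_n)\le\varepsilon$. The measure $m(A)\in\mathcal{R}$ is the (existing) supremum of such inner sums, equal to the infimum of such outer sums. A property holds almost everywhere on $A\subset\mathcal{R}$ iff the set of points of $A$ where it holds is measurable with measure $m(A)$; for subsets of $\mathbb{R}$, "a.e." refers to Lebesgue measure. A function $f$ is simple on an interval $I$ of $\mathcal{R}$ if there are $x_0,a_k\in\mathcal{R}$ such that for every $x\in I$ the partial sums $\sum_{k\le K}a_k(x-x_0)^k$ weakly converge to $f(x)$. For $A$ measurable, $f:A\to\mathcal{R}$ is measurable ($f\in\mathcal{M}(A)$) iff for every $\varepsilon\in\mathcal{R}$, $\varepsilon>0$, there is a sequence of mutually disjoint intervals $\{I_n\}$ with $\bigcup_n I_n\subseteq A$, $\sum_n l(I_n)$ strongly convergent, $m(A)-\sum_n l(I_n)<\varepsilon$, and $f$ simple on each $I_n$. If $f$ is simple on $I(a,b)$ with (termwise) antiderivative $F$, $\int_{I(a,b)}f=\lim_{x\to b}F(x)-\lim_{x\to a}F(x)$. For $f\in\mathcal{M}(A)$, $\int_A f$ is the limit of $\sum_n\int_{I_n}f$ (strong sum) over sequences of mutually disjoint intervals $\{I_n\}$ with $\bigcup_n I_n\subseteq A$ and $f$ simple on each $I_n$, as $\sum_n l(I_n)\to m(A)$; it is $\pm\infty$ if the partial sums diverge, and undefined if the limit does not exist. Functions equal a.e. are identified. For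 $1\le p<\infty$, $\mathcal{L}^p(A)$ is the set of (classes of) $f\in\mathcal{M}(A)$ with $f^p\in\mathcal{M}(A)$ such that $\int_A|f|^p$ is defined and $<+\infty$; $\|f\|_p=(\int_A|f|^p)^{1/p}$. For $p=\infty$, $\|f\|_\infty=\inf\{c\in\mathcal{R}:|f(x)|\le c\text{ for a.e. }x\in A\}$ (undefined if this infimum does not exist in $\mathcal{R}$), and $\mathcal{L}^\infty(A)$ is the set of (classes of) $f\in\mathcal{M}(A)$ for which $\|f\|_\infty$ is defined. A sequence $\{f_n\}$ in $\mathcal{L}^p(A)$ is weakly Cauchy iff for every real $\varepsilon>0$ there is $n_\varepsilon$ such that $\max_{q\in\mathbb{Q},q\le\varepsilon^{-1}}\left|\,\|f_n-f_m\|_p[q]\,\right|<\varepsilon$ for all $m,n>n_\varepsilon$. For real functions, $L^p(I)$ and $\|\cdot\|_p$ are the usual Lebesgue ones. *)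

theory Defs
  imports
    "HOL-Analysis.Analysis"
    "HOL-Probability.Essential_Supremum"
    "HOL-Library.Lub_Glb"
begin

section \<open>The Levi-Civita field\<close>

definition left_finite :: "rat set \<Rightarrow> bool" where
  "left_finite F \<longleftrightarrow> (\<forall>q. finite {x \<in> F. x \<le> q})"

lemma left_finite_subset: "left_finite G \<Longrightarrow> F \<subseteq> G \<Longrightarrow> left_finite F"
  unfolding left_finite_def by (blast intro: rev_finite_subset)

lemma left_finite_Un: "left_finite F \<Longrightarrow> left_finite G \<Longrightarrow> left_finite (F \<union> G)"
proof -
  assume F: "left_finite F" and G: "left_finite G"
  have "{x \<in> F \<union> G. x \<le> q} = {x \<in> F. x \<le> q} \<union> {x \<in> G. x \<le> q}" for q
    by auto
  with F G show ?thesis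
    by (simp add: left_finite_def)
qed

lemma left_finite_finite: "finite F \<Longrightarrow> left_finite F"
  by (simp add: left_finite_def)

lemma left_finite_min:
  assumes "left_finite F" "x \<in> F"
  obtains m where "m \<in> F" "\<And>y. y \<in> F \<Longrightarrow> m \<le> y"
proof -
  let ?S = "{y \<in> F. y \<le> x}"
  have fin: "finite ?S" and ne: "?S \<noteq> {}"
    using assms by (auto simp: left_finite_def)
  have "Min ?S \<in> ?S"
    using fin ne by (rule Min_in)
  moreover have "Min ?S \<le> y" if "y \<in> F" for y
  proof (cases "y \<le> x")
    case True
    with that fin show ?thesis by (intro Min_le) auto
  next
    case False
    with \<open>Min ?S \<in> ?S\<close> show ?thesis by auto
  qed
  ultimately show ?thesis
    using that by blast
qed

lemma left_finite_bounded_below: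
  assumes "left_finite F"
  obtains m where "\<And>y. y \<in> F \<Longrightarrow> m \<le> y"
  using left_finite_min[OF assms] by (metis (full_types))

typedef levi_civita = "{x :: rat \<Rightarrow> real. left_finite {q. x q \<noteq> 0}}"
  morphisms coef Abs_levi_civita
  by (rule exI[of _ "\<lambda>_. 0"]) (simp add: left_finite_def)

setup_lifting type_definition_levi_civita

lemma levi_civita_eqI: "(\<And>q. coef x q = coef y q) \<Longrightarrow> x = y"
  by (transfer, rule ext) simp

lemma left_finite_supp: "left_finite {q. coef x q \<noteq> 0}"
  using coef by simp

definition conv :: "(rat \<Rightarrow> real) \<Rightarrow> (rat \<Rightarrow> real) \<Rightarrow> rat \<Rightarrow> real" where
  "conv x y q = (\<Sum>(q1, q2) \<in> {(q1, q2). q1 + q2 = q \<and> x q1 \<noteq> 0 \<and> y q2 \<noteq> 0}. x q1 * y q2)"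

lemma conv_superset:
  assumes "finite B" "\<And>a. x a \<noteq> 0 \<Longrightarrow> y (q - a) \<noteq> 0 \<Longrightarrow> a \<in> B"
  shows "conv x y q = (\<Sum>a\<in>B. x a * y (q - a))"
proof -
  let ?C = "{a. x a \<noteq> 0 \<and> y (q - a) \<noteq> 0}"
  have "conv x y q = (\<Sum>a\<in>?C. x a * y (q - a))"
    unfolding conv_def
    by (rule sum.reindex_bij_witness[of _ "\<lambda>a. (a, q - a)" fst]) auto
  also have "\<dots> = (\<Sum>a\<in>B. x a * y (q - a))"
    by (rule sum.mono_neutral_left) (use assms in auto)
  finally show ?thesis .
qed

lemma conv_commute: "conv x y q = conv y x q"
  unfolding conv_def
  by (rule sum.reindex_bij_witness[of _ prod.swap prod.swap]) (auto simp: add.commute)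

lemma conv_nonzeroE:
  assumes "conv x y q \<noteq> 0"
  obtains a b where "a + b = q" "x a \<noteq> 0" "y b \<noteq> 0"
  using assms that unfolding conv_def by (auto elim!: sum.not_neutral_contains_not_neutral)

lemma finite_lower_part:
  assumes "left_finite {a. x a \<noteq> (0::real)}"
  shows "finite {a. x a \<noteq> 0 \<and> a \<le> q}"
  using assms by (simp add: left_finite_def)

lemma conv_lower_part:
  assumes "left_finite {a. x a \<noteq> 0}" "\<And>b. y b \<noteq> 0 \<Longrightarrow> m \<le> b" "q \<le> r + m"
  shows "conv x y q = (\<Sum>a\<in>{a. x a \<noteq> 0 \<and> a \<le> r}. x a * y (q - a))"
proof (rule conv_superset)
  show "finite {a. x a \<noteq> 0 \<and> a \<le> r}"
    by (rule finite_lower_part[OF assms(1)])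
  fix a assume "x a \<noteq> 0" "y (q - a) \<noteq> 0"
  with assms(2)[of "q - a"] assms(3) show "a \<in> {a. x a \<noteq> 0 \<and> a \<le> r}"
    by auto
qed

lemma left_finite_conv:
  assumes x: "left_finite {a. x a \<noteq> 0}" and y: "left_finite {a. y a \<noteq> 0}"
  shows "left_finite {q. conv x y q \<noteq> 0}"
proof -
  obtain mx where mx: "\<And>a. x a \<noteq> 0 \<Longrightarrow> mx \<le> a"
    using left_finite_bounded_below[OF x] by auto
  obtain my where my: "\<And>a. y a \<noteq> 0 \<Longrightarrow> my \<le> a"
    using left_finite_bounded_below[OF y] by auto
  have "finite {q. conv x y q \<noteq> 0 \<and> q \<le> r}" for r
  proof (rule finite_subset)
    let ?X = "{a. x a \<noteq> 0 \<and> a \<le> r - my}" and ?Y = "{b. y b \<noteq> 0 \<and> b \<le> r - mx}"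
    show "finite ((\<lambda>(a, b). a + b) ` (?X \<times> ?Y))"
      using finite_lower_part[OF x] finite_lower_part[OF y] by blast
    show "{q. conv x y q \<noteq> 0 \<and> q \<le> r} \<subseteq> (\<lambda>(a, b). a + b) ` (?X \<times> ?Y)"
    proof clarify
      fix q assume ne: "conv x y q \<noteq> 0" and q: "q \<le> r"
      obtain a b where ab: "a + b = q" "x a \<noteq> 0" "y b \<noteq> 0"
        using ne by (rule conv_nonzeroE)
      with mx[of a] my[of b] q have "(a, b) \<in> ?X \<times> ?Y" by auto
      with ab(1) show "q \<in> (\<lambda>(a, b). a + b) ` (?X \<times> ?Y)" by force
    qed
  qed
  then show ?thesis by (simp add: left_finite_def)
qed

lemma conv_assoc:
  assumes x: "left_finite {a. x a \<noteq> 0}" and y: "left_finite {a. y a \<noteq> 0}"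
    and z: "left_finite {a. z a \<noteq> 0}"
  shows "conv (conv x y) z q = conv x (conv y z) q"
proof -
  obtain mx where mx: "\<And>a. x a \<noteq> 0 \<Longrightarrow> mx \<le> a"
    using left_finite_bounded_below[OF x] by auto
  obtain my where my: "\<And>a. y a \<noteq> 0 \<Longrightarrow> my \<le> a"
    using left_finite_bounded_below[OF y] by auto
  obtain mz where mz: "\<And>a. z a \<noteq> 0 \<Longrightarrow> mz \<le> a"
    using left_finite_bounded_below[OF z] by auto
  have lower: "m + m' \<le> q"
    if ne: "conv u v q \<noteq> 0" and u: "\<And>a. u a \<noteq> 0 \<Longrightarrow> m \<le> a"
      and v: "\<And>a. v a \<noteq> 0 \<Longrightarrow> m' \<le> a" for u v q m m'
  proof -
    obtain a b where "a + b = q" "u a \<noteq> 0" "v b \<noteq> 0"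
      using ne by (rule conv_nonzeroE)
    with u[of a] v[of b] show ?thesis by auto
  qed
  define X where "X = {a. x a \<noteq> 0 \<and> a \<le> q - my - mz}"
  define Z where "Z = {c. z c \<noteq> 0 \<and> c \<le> q - mx - my}"
  have "conv (conv x y) z q = conv z (conv x y) q"
    by (rule conv_commute)
  also have "\<dots> = (\<Sum>c\<in>Z. z c * conv x y (q - c))"
    unfolding Z_def
    by (rule conv_lower_part[OF z, where m = "mx + my"]) (use lower[OF _ mx my] in auto)
  also have "\<dots> = (\<Sum>c\<in>Z. z c * (\<Sum>a\<in>X. x a * y (q - c - a)))"
  proof (rule sum.cong[OF refl])
    fix c assume "c \<in> Z"
    then have "q - c \<le> (q - my - mz) + my"
      using mz[of c] by (auto simp: Z_def)
    then show "z c * conv x y (q - c) = z c * (\<Sum>a\<in>X. x a * y (q - c - a))"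
      unfolding X_def using conv_lower_part[OF x, of y my "q - c" "q - my - mz"] my by simp
  qed
  also have "\<dots> = (\<Sum>a\<in>X. x a * (\<Sum>c\<in>Z. z c * y (q - a - c)))"
    by (simp add: sum_distrib_left sum.swap[of _ Z X] algebra_simps)
  also have "\<dots> = (\<Sum>a\<in>X. x a * conv y z (q - a))"
  proof (rule sum.cong[OF refl])
    fix a assume "a \<in> X"
    then have "q - a \<le> (q - mx - my) + my"
      using mx[of a] by (auto simp: X_def)
    then show "x a * (\<Sum>c\<in>Z. z c * y (q - a - c)) = x a * conv y z (q - a)"
      unfolding Z_def using conv_lower_part[OF z, of y my "q - a" "q - mx - my"] my conv_commute[of y z] by simp
  qed
  also have "\<dots> = conv x (conv y z) q"
    unfolding X_def
    by (rule conv_lower_part[OF x, where m = "my + mz", symmetric]) (use lower[OF _ my mz] in auto)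
  finally show ?thesis .
qed

instantiation levi_civita :: comm_ring_1
begin

lift_definition zero_levi_civita :: levi_civita is "\<lambda>_. 0"
  by (simp add: left_finite_def)

lift_definition one_levi_civita :: levi_civita is "\<lambda>q. if q = 0 then 1 else 0"
  by (simp add: left_finite_finite)

lift_definition plus_levi_civita :: "levi_civita \<Rightarrow> levi_civita \<Rightarrow> levi_civita"
  is "\<lambda>x y q. x q + y q"
  by (erule (1) left_finite_subset[OF left_finite_Un]) auto

lift_definition uminus_levi_civita :: "levi_civita \<Rightarrow> levi_civita" is "\<lambda>x q. - x q"
  by simp

lift_definition minus_levi_civita :: "levi_civita \<Rightarrow> levi_civita \<Rightarrow> levi_civita"
  is "\<lambda>x y q. x q - y q"
  by (erule (1) left_finite_subset[OF left_finite_Un]) auto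

lift_definition times_levi_civita :: "levi_civita \<Rightarrow> levi_civita \<Rightarrow> levi_civita" is conv
  by (rule left_finite_conv)

instance
proof
  fix a b c :: levi_civita
  show "a * b * c = a * (b * c)"
    by transfer (simp add: fun_eq_iff conv_assoc)
  show "a * b = b * a"
    by transfer (simp add: fun_eq_iff conv_commute)
  show "1 * a = a"
  proof transfer
    fix a :: "rat \<Rightarrow> real"
    have "conv (\<lambda>q. if q = 0 then 1 else 0) a q = a q" for q
      by (subst conv_superset[of "{0}"]) (auto split: if_splits)
    then show "conv (\<lambda>q. if q = 0 then 1 else 0) a = a" by blast
  qed
  show "(a + b) * c = a * c + b * c"
  proof transfer
    fix a b c :: "rat \<Rightarrow> real"
    assume fin: "left_finite {q. a q \<noteq> 0}" "left_finite {q. b q \<noteq> 0}" "left_finite {q. c q \<noteq> 0}"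
    obtain m where m: "\<And>q. c q \<noteq> 0 \<Longrightarrow> m \<le> q"
      using left_finite_bounded_below[OF fin(3)] by auto
    have "conv (\<lambda>q. a q + b q) c q = conv a c q + conv b c q" for q
    proof -
      let ?B = "{u. a u \<noteq> 0 \<and> u \<le> q - m} \<union> {u. b u \<noteq> 0 \<and> u \<le> q - m}"
      have B: "finite ?B"
        using finite_lower_part fin by blast
      have le: "u \<le> q - m" if "c (q - u) \<noteq> 0" for u
        using m[OF that] by simp
      have 1: "conv (\<lambda>q. a q + b q) c q = (\<Sum>u\<in>?B. (a u + b u) * c (q - u))"
        by (rule conv_superset[OF B]) (use le in auto)
      have 2: "conv a c q = (\<Sum>u\<in>?B. a u * c (q - u))" "conv b c q = (\<Sum>u\<in>?B. b u * c (q - u))"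
        by (rule conv_superset[OF B]; use le in auto)+
      show ?thesis
        unfolding 1 2 by (simp add: sum.distrib distrib_right)
    qed
    then show "conv (\<lambda>q. a q + b q) c = (\<lambda>q. conv a c q + conv b c q)" by blast
  qed
  show "(0::levi_civita) \<noteq> 1"
    by transfer (simp add: fun_eq_iff exI[of _ 0])
qed (transfer; simp add: fun_eq_iff)+

end

lemma coef_simps [simp]:
  "coef 0 q = 0" "coef 1 q = (if q = 0 then 1 else 0)" "coef (x + y) q = coef x q + coef y q"
  "coef (x - y) q = coef x q - coef y q" "coef (- x) q = - coef x q"
  by (transfer, simp)+

instantiation levi_civita :: real_algebra_1
begin

lift_definition scaleR_levi_civita :: "real \<Rightarrow> levi_civita \<Rightarrow> levi_civita" is "\<lambda>c x q. c * x q"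
  by (erule left_finite_subset) auto

instance
proof
  fix a :: real and x y :: levi_civita
  show l: "a *\<^sub>R x * y = a *\<^sub>R (x * y)" for x y :: levi_civita
  proof transfer
    fix a :: real and x y :: "rat \<Rightarrow> real"
    assume fin: "left_finite {q. x q \<noteq> 0}" "left_finite {q. y q \<noteq> 0}"
    obtain m where m: "\<And>q. y q \<noteq> 0 \<Longrightarrow> m \<le> q"
      using left_finite_bounded_below[OF fin(2)] by auto
    have "conv (\<lambda>q. a * x q) y q = a * conv x y q" for q
    proof -
      let ?B = "{u. x u \<noteq> 0 \<and> u \<le> q - m}"
      have B: "finite ?B" using finite_lower_part fin by blast
      have le: "u \<le> q - m" if "y (q - u) \<noteq> 0" for u
        using m[OF that] by simp
      have 1: "conv (\<lambda>q. a * x q) y q = (\<Sum>u\<in>?B. (a * x u) * y (q - u))"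
        by (rule conv_superset[OF B]) (use le in auto)
      have 2: "conv x y q = (\<Sum>u\<in>?B. x u * y (q - u))"
        by (rule conv_superset[OF B]) (use le in auto)
      show ?thesis
        unfolding 1 2 by (simp add: sum_distrib_left mult.assoc)
    qed
    then show "conv (\<lambda>q. a * x q) y = (\<lambda>q. a * conv x y q)" by blast
  qed
  show "x * a *\<^sub>R y = a *\<^sub>R (x * y)"
    using l[of y x] by (simp add: mult.commute)
qed (transfer; simp add: fun_eq_iff algebra_simps)+

end

lemma coef_scaleR [simp]: "coef (c *\<^sub>R x) q = c * coef x q"
  by transfer simp

text \<open>The real numbers embed by \<^const>\<open>of_real\<close>; \<open>lc_d r\<close> is the function with value
  1 at \<open>r\<close> and 0 elsewhere.\<close>

lemma coef_of_real [simp]: "coef (of_real r) q = (if q = 0 then r else 0)"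
  by (simp add: of_real_def)

lift_definition lc_d :: "rat \<Rightarrow> levi_civita" is "\<lambda>r q. if q = r then 1 else 0"
  by (simp add: left_finite_finite)

text \<open>For \<open>x = 0\<close> the value of \<open>lc_val\<close> is unspecified (mathematically it is infinity); it is never
  used.\<close>

definition lc_val :: "levi_civita \<Rightarrow> rat" where
  "lc_val x = (LEAST q. coef x q \<noteq> 0)"

lemma lc_val_nonzero:
  assumes "x \<noteq> 0"
  shows "coef x (lc_val x) \<noteq> 0" and "coef x q \<noteq> 0 \<Longrightarrow> lc_val x \<le> q"
proof -
  obtain q0 where "coef x q0 \<noteq> 0"
    using assms levi_civita_eqI[of x 0] by auto
  then obtain m where m: "coef x m \<noteq> 0" "\<And>y. coef x y \<noteq> 0 \<Longrightarrow> m \<le> y"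
    using left_finite_min[OF left_finite_supp[of x], of q0] by auto
  then have "lc_val x = m"
    unfolding lc_val_def by (intro Least_equality) auto
  with m show "coef x (lc_val x) \<noteq> 0" and "coef x q \<noteq> 0 \<Longrightarrow> lc_val x \<le> q" by auto
qed

lemma lc_val_eqI:
  assumes "coef x m \<noteq> 0" "\<And>q. q < m \<Longrightarrow> coef x q = 0"
  shows "lc_val x = m"
  unfolding lc_val_def using assms by (intro Least_equality) (auto intro: leI)

lemma coef_below_val: "x \<noteq> 0 \<Longrightarrow> q < lc_val x \<Longrightarrow> coef x q = 0"
  using lc_val_nonzero(2) leD by blast

lemma lc_val_uminus: "lc_val (- x) = lc_val x"
  by (simp add: lc_val_def)

definition lc_pos :: "levi_civita \<Rightarrow> bool" where
  "lc_pos x \<longleftrightarrow> x \<noteq> 0 \<and> coef x (lc_val x) > 0"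

lemma lc_pos_iff: "lc_pos x \<longleftrightarrow> (\<exists>m. coef x m > 0 \<and> (\<forall>q<m. coef x q = 0))"
proof
  assume "lc_pos x"
  then show "\<exists>m. coef x m > 0 \<and> (\<forall>q<m. coef x q = 0)"
    unfolding lc_pos_def using coef_below_val by blast
next
  assume "\<exists>m. coef x m > 0 \<and> (\<forall>q<m. coef x q = 0)"
  then obtain m where m: "coef x m > 0" "\<forall>q<m. coef x q = 0" by blast
  then have "lc_val x = m" by (intro lc_val_eqI) auto
  with m show "lc_pos x" by (auto simp: lc_pos_def)
qed

lemma lc_pos_add: "lc_pos x \<Longrightarrow> lc_pos y \<Longrightarrow> lc_pos (x + y)"
proof -
  assume "lc_pos x" "lc_pos y"
  then obtain m n where m: "coef x m > 0" "\<forall>q<m. coef x q = 0"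
    and n: "coef y n > 0" "\<forall>q<n. coef y q = 0"
    unfolding lc_pos_iff by blast
  show ?thesis
    unfolding lc_pos_iff
  proof (intro exI conjI allI impI)
    show "coef (x + y) (min m n) > 0"
      using m n by (cases m n rule: linorder_cases) (auto simp: min_def)
    show "coef (x + y) q = 0" if "q < min m n" for q
      using m n that by auto
  qed
qed

lemma coef_mult_lowest:
  assumes "\<forall>q<m. coef x q = 0" "\<forall>q<n. coef y q = 0"
  shows "coef (x * y) (m + n) = coef x m * coef y n" and "q < m + n \<Longrightarrow> coef (x * y) q = 0"
proof -
  have c: "coef (x * y) = conv (coef x) (coef y)" by transfer simp
  have "coef (x * y) (m + n) = (\<Sum>a\<in>{m}. coef x a * coef y (m + n - a))"
    unfolding c
  proof (rule conv_superset)
    fix a assume "coef x a \<noteq> 0" "coef y (m + n - a) \<noteq> 0"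
    with assms have "\<not> a < m" "\<not> m + n - a < n" by blast+
    then show "a \<in> {m}" by simp
  qed simp
  then show "coef (x * y) (m + n) = coef x m * coef y n" by simp
  assume q: "q < m + n"
  have "coef (x * y) q = (\<Sum>a\<in>{}. coef x a * coef y (q - a))"
    unfolding c
  proof (rule conv_superset)
    fix a assume "coef x a \<noteq> 0" "coef y (q - a) \<noteq> 0"
    with assms have "\<not> a < m" "\<not> q - a < n" by blast+
    with q show "a \<in> {}" by simp
  qed simp
  then show "coef (x * y) q = 0" by simp
qed

lemma lc_pos_mult: "lc_pos x \<Longrightarrow> lc_pos y \<Longrightarrow> lc_pos (x * y)"
proof -
  assume "lc_pos x" "lc_pos y"
  then obtain m n where m: "coef x m > 0" "\<forall>q<m. coef x q = 0"
    and n: "coef y n > 0" "\<forall>q<n. coef y q = 0"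
    unfolding lc_pos_iff by blast
  show ?thesis
    unfolding lc_pos_iff
    using coef_mult_lowest[OF m(2) n(2)] m(1) n(1)
    by (intro exI[of _ "m + n"]) auto
qed

lemma lc_pos_cases: "x = 0 \<or> lc_pos x \<or> lc_pos (- x)"
  using lc_val_nonzero(1)[of x] by (auto simp: lc_pos_def lc_val_uminus)

lemma lc_pos_uminus: "lc_pos x \<Longrightarrow> \<not> lc_pos (- x)"
  by (auto simp: lc_pos_def lc_val_uminus)

instantiation levi_civita :: linordered_idom
begin

definition less_levi_civita :: "levi_civita \<Rightarrow> levi_civita \<Rightarrow> bool" where
  "x < y \<longleftrightarrow> x \<noteq> y \<and> coef (x - y) (lc_val (x - y)) < 0"

definition less_eq_levi_civita :: "levi_civita \<Rightarrow> levi_civita \<Rightarrow> bool" where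
  "x \<le> y \<longleftrightarrow> x < y \<or> x = (y :: levi_civita)"

definition abs_levi_civita :: "levi_civita \<Rightarrow> levi_civita" where
  "\<bar>x\<bar> = (if x < 0 then - x else (x :: levi_civita))"

definition sgn_levi_civita :: "levi_civita \<Rightarrow> levi_civita" where
  "sgn x = (if x = 0 then 0 else if 0 < x then 1 else - (1 :: levi_civita))"

lemma less_lc_pos: "x < y \<longleftrightarrow> lc_pos (y - x)"
proof -
  have "lc_val (y - x) = lc_val (x - y)"
    using lc_val_uminus[of "x - y"] by simp
  then show ?thesis
    by (auto simp: less_levi_civita_def lc_pos_def)
qed

instance
proof
  fix x y z :: levi_civita
  show "(x < y) = (x \<le> y \<and> \<not> y \<le> x)"
    using lc_pos_uminus[of "y - x"] by (auto simp: less_eq_levi_civita_def less_lc_pos lc_pos_def)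
  show "x \<le> x" by (simp add: less_eq_levi_civita_def)
  show "x \<le> y \<Longrightarrow> y \<le> z \<Longrightarrow> x \<le> z"
    using lc_pos_add[of "y - x" "z - y"] by (auto simp: less_eq_levi_civita_def less_lc_pos)
  show "x \<le> y \<Longrightarrow> y \<le> x \<Longrightarrow> x = y"
    using lc_pos_uminus[of "y - x"] by (auto simp: less_eq_levi_civita_def less_lc_pos)
  show "x \<le> y \<or> y \<le> x"
    using lc_pos_cases[of "y - x"] by (auto simp: less_eq_levi_civita_def less_lc_pos)
  show "x \<le> y \<Longrightarrow> z + x \<le> z + y"
    by (auto simp: less_eq_levi_civita_def less_lc_pos)
  show "x < y \<Longrightarrow> 0 < z \<Longrightarrow> z * x < z * y"
    using lc_pos_mult[of z "y - x"] by (simp add: less_lc_pos algebra_simps)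
  show "\<bar>x\<bar> = (if x < 0 then - x else x)" by (rule abs_levi_civita_def)
  show "sgn x = (if x = 0 then 0 else if 0 < x then 1 else - 1)" by (rule sgn_levi_civita_def)
qed

end


section \<open>Convergence\<close>

definition strong_lim :: "(nat \<Rightarrow> levi_civita) \<Rightarrow> levi_civita \<Rightarrow> bool" where
  "strong_lim a l \<longleftrightarrow> (\<forall>\<epsilon>>0. \<forall>\<^sub>F n in sequentially. \<bar>a n - l\<bar> < \<epsilon>)"

text \<open>\<open>weakly_small \<epsilon> x\<close> says that the maximum of \<open>\<bar>x[q]\<bar>\<close> over all rational \<open>q \<le> 1/\<epsilon>\<close> is less than
  \<open>\<epsilon>\<close>; the maximum exists because the support of \<open>x\<close> is left-finite.\<close>

definition weakly_small :: "real \<Rightarrow> levi_civita \<Rightarrow> bool" where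
  "weakly_small \<epsilon> x \<longleftrightarrow> (\<forall>q. of_rat q \<le> inverse \<epsilon> \<longrightarrow> \<bar>coef x q\<bar> < \<epsilon>)"

definition weak_lim :: "(nat \<Rightarrow> levi_civita) \<Rightarrow> levi_civita \<Rightarrow> bool" where
  "weak_lim a l \<longleftrightarrow> (\<forall>\<epsilon>>0. \<forall>\<^sub>F n in sequentially. weakly_small \<epsilon> (a n - l))"

definition strong_sums :: "(nat \<Rightarrow> levi_civita) \<Rightarrow> levi_civita \<Rightarrow> bool" where
  "strong_sums a s \<longleftrightarrow> strong_lim (\<lambda>n. \<Sum>k<n. a k) s"

definition weak_sums :: "(nat \<Rightarrow> levi_civita) \<Rightarrow> levi_civita \<Rightarrow> bool" where
  "weak_sums a s \<longleftrightarrow> weak_lim (\<lambda>n. \<Sum>k\<le>n. a k) s"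

text \<open>The limit of \<open>F x\<close> as \<open>x\<close> tends to \<open>b\<close> within \<open>X\<close>, in the order topology.\<close>

definition lc_lim_within ::
    "(levi_civita \<Rightarrow> levi_civita) \<Rightarrow> levi_civita set \<Rightarrow> levi_civita \<Rightarrow> levi_civita \<Rightarrow> bool" where
  "lc_lim_within F X b l \<longleftrightarrow>
     (\<forall>\<epsilon>>0. \<exists>\<delta>>0. \<forall>x\<in>X. x \<noteq> b \<and> \<bar>x - b\<bar> < \<delta> \<longrightarrow> \<bar>F x - l\<bar> < \<epsilon>)"


section \<open>Intervals\<close>

datatype 'a ivl =
    Open_ivl (lo: 'a) (hi: 'a)
  | Left_open_ivl (lo: 'a) (hi: 'a)
  | Right_open_ivl (lo: 'a) (hi: 'a)
  | Closed_ivl (lo: 'a) (hi: 'a)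

primrec ivl_set :: "'a::linorder ivl \<Rightarrow> 'a set" where
  "ivl_set (Open_ivl a b) = {a<..<b}"
| "ivl_set (Left_open_ivl a b) = {a<..b}"
| "ivl_set (Right_open_ivl a b) = {a..<b}"
| "ivl_set (Closed_ivl a b) = {a..b}"

definition ivl_length :: "'a::minus ivl \<Rightarrow> 'a" where
  "ivl_length I = hi I - lo I"

text \<open>The interval of the Levi-Civita field with the same endpoints and of the same type as a
  given real interval.\<close>

definition lc_ivl :: "real ivl \<Rightarrow> levi_civita set" where
  "lc_ivl I = ivl_set (map_ivl of_real I)"


section \<open>Measurable sets\<close>

text \<open>Since degenerate intervals are allowed, and the empty set is one of them, infinite sequences
  also cover finite families.\<close>

definition disjoint_ivls :: "(nat \<Rightarrow> levi_civita ivl) \<Rightarrow> bool" where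
  "disjoint_ivls I \<longleftrightarrow> (\<forall>n. lo (I n) \<le> hi (I n)) \<and> disjoint_family (\<lambda>n. ivl_set (I n))"

definition inner_ivls ::
    "levi_civita set \<Rightarrow> (nat \<Rightarrow> levi_civita ivl) \<Rightarrow> levi_civita \<Rightarrow> bool" where
  "inner_ivls A I s \<longleftrightarrow> disjoint_ivls I \<and> (\<Union>n. ivl_set (I n)) \<subseteq> A \<and>
     strong_sums (\<lambda>n. ivl_length (I n)) s"

definition outer_ivls ::
    "levi_civita set \<Rightarrow> (nat \<Rightarrow> levi_civita ivl) \<Rightarrow> levi_civita \<Rightarrow> bool" where
  "outer_ivls A J t \<longleftrightarrow> disjoint_ivls J \<and> A \<subseteq> (\<Union>n. ivl_set (J n)) \<and>
     strong_sums (\<lambda>n. ivl_length (J n)) t"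

definition lc_measurable :: "levi_civita set \<Rightarrow> bool" where
  "lc_measurable A \<longleftrightarrow>
     (\<forall>\<epsilon>>0. \<exists>I J s t. inner_ivls A I s \<and> outer_ivls A J t \<and> t - s \<le> \<epsilon>)"

text \<open>The supremum need not exist for arbitrary \<open>A\<close>, but it does for measurable \<open>A\<close>.\<close>

definition lc_measure :: "levi_civita set \<Rightarrow> levi_civita" where
  "lc_measure A = (THE m. isLub UNIV {s. \<exists>I. inner_ivls A I s} m)"

definition lc_ae :: "levi_civita set \<Rightarrow> (levi_civita \<Rightarrow> bool) \<Rightarrow> bool" where
  "lc_ae A P \<longleftrightarrow> lc_measurable {x \<in> A. P x} \<and> lc_measure {x \<in> A. P x} = lc_measure A"


section \<open>Measurable functions and the integral\<close>

definition lc_power_series_on ::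
    "levi_civita set \<Rightarrow> levi_civita \<Rightarrow> (nat \<Rightarrow> levi_civita) \<Rightarrow> (levi_civita \<Rightarrow> levi_civita) \<Rightarrow> bool" where
  "lc_power_series_on X x0 a f \<longleftrightarrow> (\<forall>x\<in>X. weak_sums (\<lambda>k. a k * (x - x0) ^ k) (f x))"

definition lc_simple :: "(levi_civita \<Rightarrow> levi_civita) \<Rightarrow> levi_civita ivl \<Rightarrow> bool" where
  "lc_simple f I \<longleftrightarrow> (\<exists>x0 a. lc_power_series_on (ivl_set I) x0 a f)"

text \<open>A function on \<open>A\<close> is represented by a total function whose values outside \<open>A\<close> are
  irrelevant.\<close>

definition lc_measurable_fun :: "levi_civita set \<Rightarrow> (levi_civita \<Rightarrow> levi_civita) \<Rightarrow> bool" where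
  "lc_measurable_fun A f \<longleftrightarrow> lc_measurable A \<and>
     (\<forall>\<epsilon>>0. \<exists>I s. inner_ivls A I s \<and> lc_measure A - s < \<epsilon> \<and> (\<forall>n. lc_simple f (I n)))"

text \<open>The termwise antiderivative of \<open>\<Sum>k. a k (x - x0)^k\<close> is
  \<open>\<Sum>k. a k / (k + 1) (x - x0)^(k + 1)\<close>. Degenerate intervals are treated separately, because the
  limits at their endpoints are vacuous.\<close>

definition has_simple_integral ::
    "(levi_civita \<Rightarrow> levi_civita) \<Rightarrow> levi_civita ivl \<Rightarrow> levi_civita \<Rightarrow> bool" where
  "has_simple_integral f I v \<longleftrightarrow>
     (if lo I = hi I then v = 0
      else \<exists>x0 a F u w. lc_power_series_on (ivl_set I) x0 a f \<and>
        (\<forall>x\<in>ivl_set I. weak_sums (\<lambda>k. (a k /\<^sub>R real (Suc k)) * (x - x0) ^ Suc k) (F x)) \<and>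
        lc_lim_within F (ivl_set I) (lo I) u \<and> lc_lim_within F (ivl_set I) (hi I) w \<and>
        v = w - u)"

text \<open>Only finite integrals are needed.\<close>

definition has_lc_integral ::
    "levi_civita set \<Rightarrow> (levi_civita \<Rightarrow> levi_civita) \<Rightarrow> levi_civita \<Rightarrow> bool" where
  "has_lc_integral A f L \<longleftrightarrow>
     (\<forall>\<epsilon>>0. \<exists>\<delta>>0. \<forall>I s. inner_ivls A I s \<and> (\<forall>n. lc_simple f (I n)) \<and> lc_measure A - s < \<delta> \<longrightarrow>
        (\<exists>v S. (\<forall>n. has_simple_integral f (I n) (v n)) \<and> strong_sums v S \<and> \<bar>S - L\<bar> < \<epsilon>))"


section \<open>Real powers\<close>

text \<open>A positive \<open>x\<close> is uniquely \<open>r d^l (1 + u)\<close> with \<open>r > 0\<close> real, \<open>l\<close> rational and \<open>u = 0\<close> or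
  \<open>\<lambda>(u) > 0\<close>. Its power with real exponent \<open>p\<close> is \<open>r^p d^(p l) \<Sum>k. (p choose k) u^k\<close>, which is an
  element of the field only if \<open>p l\<close> is rational. In particular, it always exists for rational \<open>p\<close>,
  where it agrees with the power given by the roots in the real closed field.\<close>

definition has_lc_powr :: "levi_civita \<Rightarrow> real \<Rightarrow> levi_civita \<Rightarrow> bool" where
  "has_lc_powr x p y \<longleftrightarrow>
     (x = 0 \<and> y = 0) \<or>
     (\<exists>(r::real) l s u z. r > 0 \<and> (\<forall>q\<le>0. coef u q = 0) \<and> x = of_real r * lc_d l * (1 + u) \<and>
        of_rat s = p * of_rat l \<and> strong_sums (\<lambda>k. of_real (p gchoose k) * u ^ k) z \<and>
        y = of_real (r powr p) * lc_d s * z)"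

definition lc_powr :: "levi_civita \<Rightarrow> real \<Rightarrow> levi_civita" where
  "lc_powr x p = (THE y. has_lc_powr x p y)"


section \<open>Lebesgue spaces\<close>

text \<open>Elements are represented by functions. For finite \<open>p\<close>, the power \<open>f^p\<close> is read as \<open>\<bar>f\<bar>^p\<close>,
  since real powers of negative elements do not exist. As \<open>\<bar>f\<bar>^p\<close> is nonnegative, its integral is
  defined and less than \<open>+\<infinity>\<close> iff it is defined with a value in the field.\<close>

definition lc_Lp :: "ereal \<Rightarrow> levi_civita set \<Rightarrow> (levi_civita \<Rightarrow> levi_civita) set" where
  "lc_Lp p A = {f. lc_measurable_fun A f \<and>
     (if p = \<infinity> then \<exists>N. isGlb UNIV {c. lc_ae A (\<lambda>x. \<bar>f x\<bar> \<le> c)} N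
      else lc_ae A (\<lambda>x. \<exists>y. has_lc_powr \<bar>f x\<bar> (real_of_ereal p) y) \<and>
        lc_measurable_fun A (\<lambda>x. lc_powr \<bar>f x\<bar> (real_of_ereal p)) \<and>
        (\<exists>L. has_lc_integral A (\<lambda>x. lc_powr \<bar>f x\<bar> (real_of_ereal p)) L))}"

text \<open>The norm is a partial operation: \<open>has_lc_norm p A f N\<close> says that \<open>f\<close> belongs to the space, that
  its norm is defined, and that it is \<open>N\<close>.\<close>

definition has_lc_norm ::
    "ereal \<Rightarrow> levi_civita set \<Rightarrow> (levi_civita \<Rightarrow> levi_civita) \<Rightarrow> levi_civita \<Rightarrow> bool" where
  "has_lc_norm p A f N \<longleftrightarrow> f \<in> lc_Lp p A \<and>
     (if p = \<infinity> then isGlb UNIV {c. lc_ae A (\<lambda>x. \<bar>f x\<bar> \<le> c)} N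
      else \<exists>L. has_lc_integral A (\<lambda>x. lc_powr \<bar>f x\<bar> (real_of_ereal p)) L \<and>
        has_lc_powr L (1 / real_of_ereal p) N)"

definition weakly_Cauchy ::
    "ereal \<Rightarrow> levi_civita set \<Rightarrow> (nat \<Rightarrow> levi_civita \<Rightarrow> levi_civita) \<Rightarrow> bool" where
  "weakly_Cauchy p A f \<longleftrightarrow> (\<forall>n. f n \<in> lc_Lp p A) \<and>
     (\<forall>\<epsilon>>0. \<exists>n0. \<forall>m>n0. \<forall>n>n0.
        \<exists>N. has_lc_norm p A (\<lambda>x. f n x - f m x) N \<and> weakly_small \<epsilon> N)"

text \<open>\<open>weak_lim_norm p A f l\<close>: all norms of the \<open>f n\<close> are defined and they converge weakly to
  \<open>l\<close>.\<close>

definition weak_lim_norm ::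
    "ereal \<Rightarrow> levi_civita set \<Rightarrow> (nat \<Rightarrow> levi_civita \<Rightarrow> levi_civita) \<Rightarrow> levi_civita \<Rightarrow> bool" where
  "weak_lim_norm p A f l \<longleftrightarrow> (\<exists>N. (\<forall>n. has_lc_norm p A (f n) (N n)) \<and> weak_lim N l)"

definition real_Lp :: "ereal \<Rightarrow> real set \<Rightarrow> (real \<Rightarrow> real) set" where
  "real_Lp p X = {f. f \<in> borel_measurable (lebesgue_on X) \<and>
     (if p = \<infinity> then esssup (lebesgue_on X) (\<lambda>x. ereal \<bar>f x\<bar>) < \<infinity>
      else integrable (lebesgue_on X) (\<lambda>x. \<bar>f x\<bar> powr real_of_ereal p))}"

definition real_Lp_norm :: "ereal \<Rightarrow> real set \<Rightarrow> (real \<Rightarrow> real) \<Rightarrow> real" where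
  "real_Lp_norm p X f =
     (if p = \<infinity> then real_of_ereal (esssup (lebesgue_on X) (\<lambda>x. ereal \<bar>f x\<bar>))
      else (\<integral>x. \<bar>f x\<bar> powr real_of_ereal p \<partial>lebesgue_on X) powr (1 / real_of_ereal p))"

end

theory Submission
  imports Defs
begin

text \<open>For finite \<open>p\<close>, the function \<open>f\<close> is approximated in the \<open>p\<close>-norm by real step functions. Each of
  them lifts to a step function on the field whose norm is the real norm. The integral of such a lift
  is a limit over all families of intervals on which it is simple, so it must be excluded that a weakly
  convergent power series jumps. This holds because weak convergence on an interval \<open>[b, b + \<eta>)\<close> bounds
  the valuations of the coefficients; then each coefficient of the series at \<open>b + t d^s\<close>, with
  \<open>t\<close> real, is a pointwise limit of polynomials in \<open>t\<close> of bounded degree, hence continuous at \<open>t = 0\<close>. (If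
  \<open>b\<close> is the centre of the series, it is instead an everywhere convergent real power series.)

  For \<open>p = \<infinity>\<close>, step functions are not dense, but the weak norm limit ignores infinite values with
  small coefficients. Take lifted step functions that converge to \<open>f\<close> almost everywhere, and change
  them on intervals of length \<open>d\<close>, which contain no real points: near a point where \<open>f\<close> has the local
  essential supremum \<open>r\<close>, the new value is \<open>r\<close> plus a dominating infinite term of size \<open>d^(-2) / n\<close>.
  Further intervals carry values \<open>\<plusminus> d^(-2) / n\<close>, with signs that force the difference of
  any two members of the sequence to have the norm \<open>d^(-2) / n + d^(-2) / m\<close>.\<close>

section \<open>Coefficients, order and strong limits\<close>

text \<open>The order compares coefficients lexicographically, while weak convergence only asks each
  coefficient to become small. So a term can decide every comparison and still vanish in the weak
  limit. For \<open>p = \<infinity>\<close> this hides the uniform distances between the real step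
  functions, over which there is no control. A second infinite term, a multiple of \<rho> + 2 at the
  exponent -1, makes the largest sample \<rho> win among the modified intervals, so the norm shows
  that sample at the exponent 0. The samples describe f immediately to the right of real points, and
  the modified intervals lie there too; whether one of them belongs to J is then decided by its real
  point alone. For finite p all values and norms are real numbers, so their powers exist for
  irrational p as well. Once f is known to be constant on every admissible interval, the limit over
  all families follows from monotonicity: if G is an antiderivative of f and C bounds f, then C x +
  G x and C x - G x both increase, so a family missing less than \<delta> of the length misses less
  than C \<delta> of the integral.\<close>

lemma less_coef_iff:
  "x < y \<longleftrightarrow> (\<exists>m. coef x m < coef y m \<and> (\<forall>q<m. coef x q = coef y q))"
  by (auto simp: less_lc_pos lc_pos_iff)

lemma of_real_less_lc_iff [simp]: "(of_real x :: levi_civita) < of_real y \<longleftrightarrow> x < y"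
  by (auto simp: less_coef_iff split: if_splits)

lemma of_real_le_lc_iff [simp]: "(of_real x :: levi_civita) \<le> of_real y \<longleftrightarrow> x \<le> y"
  by (auto simp: le_less)

lemma abs_of_real_lc [simp]: "\<bar>of_real x :: levi_civita\<bar> = of_real \<bar>x\<bar>"
  using of_real_less_lc_iff[of x 0] by (simp add: abs_levi_civita_def abs_if)

lemma coef_abs: "coef \<bar>x\<bar> q = coef x q \<or> coef \<bar>x\<bar> q = - coef x q"
  by (simp add: abs_levi_civita_def)

lemma coef_lc_d [simp]: "coef (lc_d r) q = (if q = r then 1 else 0)"
  by transfer simp

lemma coef_times: "coef (x * y) q = conv (coef x) (coef y) q"
  by transfer simp

lemma coef_lc_d_mult: "coef (lc_d r * x) q = coef x (q - r)"
  unfolding coef_times by (subst conv_superset[of "{r}"]) (auto split: if_splits)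

lemma coef_mult_lc_d: "coef (x * lc_d r) q = coef x (q - r)"
  using coef_lc_d_mult[of r x q] by (simp only: mult.commute)

lemma coef_of_real_mult [simp]: "coef (of_real c * x) q = c * coef x q"
  by (simp add: scaleR_conv_of_real [symmetric])

lemma coef_mult_of_real [simp]: "coef (x * of_real c) q = c * coef x q"
  using coef_of_real_mult[of c x q] by (simp only: mult.commute)

lemma lc_d_0 [simp]: "lc_d 0 = 1"
  by (rule levi_civita_eqI) simp

lemma lc_d_mult: "lc_d r * lc_d s = lc_d (r + s)"
  by (rule levi_civita_eqI) (auto simp: coef_lc_d_mult)

lemma lc_d_power: "lc_d r ^ k = lc_d (of_nat k * r)"
  by (induction k) (simp_all add: lc_d_mult algebra_simps)

lemma lc_d_pos [simp]: "0 < lc_d r"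
  unfolding less_coef_iff by (rule exI[of _ r]) auto

lemma coef_sum: "coef (\<Sum>i\<in>A. f i) q = (\<Sum>i\<in>A. coef (f i) q)"
  by (induction A rule: infinite_finite_induct) auto

lemma dense_lc: "\<exists>z. x < z \<and> z < y" if "x < y" for x y :: levi_civita
proof (intro exI conjI)
  \<comment> \<open>The midpoint, written with a real scalar because the field is set up only as an
    integral domain.\<close>
  have e: "x + of_real (1/2) * (y - x) = y - of_real (1/2) * (y - x)"
    by (rule levi_civita_eqI) (simp add: field_simps)
  have p: "0 < of_real (1/2) * (y - x)"
    using that of_real_less_lc_iff[of 0 "1/2"] by (intro mult_pos_pos) simp_all
  then show "x < x + of_real (1/2) * (y - x)" by simp
  show "x + of_real (1/2) * (y - x) < y" unfolding e using p by simp
qed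

instance levi_civita :: dense_linorder
  by standard (rule dense_lc)

text \<open>These sets are additive subgroups and form a base of neighbourhoods of 0 in the order
  topology, so strong convergence means that the coefficients up to each exponent are eventually
  constant.\<close>

definition vanish_upto :: "rat \<Rightarrow> levi_civita \<Rightarrow> bool" where
  "vanish_upto Q x \<longleftrightarrow> (\<forall>q\<le>Q. coef x q = 0)"

lemma vanish_upto_less:
  assumes "0 < e"
  obtains Q where "\<And>x. vanish_upto Q x \<Longrightarrow> \<bar>x\<bar> < e"
proof -
  obtain m where m: "coef e m > 0" "\<forall>q<m. coef e q = 0"
    using assms by (auto simp: less_coef_iff)
  have "\<bar>x\<bar> < e" if "vanish_upto m x" for x
  proof -
    have "coef \<bar>x\<bar> q = 0" if "q \<le> m" for q
      using coef_abs[of x q] that \<open>vanish_upto m x\<close> by (auto simp: vanish_upto_def)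
    with m show ?thesis
      unfolding less_coef_iff by (intro exI[of _ m]) auto
  qed
  with that show thesis by blast
qed

text \<open>Otherwise the leading exponent of \<open>\<bar>x\<bar>\<close> would be at most
  \<open>Q\<close>, where \<open>y\<close> has only zeros, and the lexicographic order would give
  \<open>y < \<bar>x\<bar>\<close>.\<close>

lemma abs_le_vanish_upto:
  assumes "\<bar>x\<bar> \<le> y" "vanish_upto Q y"
  shows "vanish_upto Q x"
proof (rule ccontr)
  assume n: "\<not> vanish_upto Q x"
  then have "x \<noteq> 0" by (auto simp: vanish_upto_def)
  define m where "m = lc_val \<bar>x\<bar>"
  have m: "coef \<bar>x\<bar> m \<noteq> 0" "\<And>q. q < m \<Longrightarrow> coef \<bar>x\<bar> q = 0"
    unfolding m_def using lc_val_nonzero(1)[of "\<bar>x\<bar>"] coef_below_val[of "\<bar>x\<bar>"] \<open>x \<noteq> 0\<close> by auto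
  have "lc_pos \<bar>x\<bar>"
    using \<open>x \<noteq> 0\<close> less_lc_pos[of 0 "\<bar>x\<bar>"] by simp
  then have mp: "coef \<bar>x\<bar> m > 0"
    by (simp add: lc_pos_def m_def)
  have mQ: "m \<le> Q"
  proof (rule ccontr)
    assume "\<not> m \<le> Q"
    then have "coef \<bar>x\<bar> q = 0" if "q \<le> Q" for q using that by (intro m) auto
    with n coef_abs[of x] show False by (fastforce simp: vanish_upto_def)
  qed
  have "y < \<bar>x\<bar>"
    unfolding less_coef_iff
    by (rule exI[of _ m]) (use assms(2) mQ mp m in \<open>auto simp: vanish_upto_def\<close>)
  with assms(1) show False by simp
qed

lemma vanish_upto_lc_d: "Q < r \<Longrightarrow> vanish_upto Q (lc_d r)"
  by (auto simp: vanish_upto_def)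

lemma vanish_upto_mono: "vanish_upto Q x \<Longrightarrow> Q' \<le> Q \<Longrightarrow> vanish_upto Q' x"
  by (auto simp: vanish_upto_def)

lemma vanish_upto_add: "vanish_upto Q x \<Longrightarrow> vanish_upto Q y \<Longrightarrow> vanish_upto Q (x + y)"
  by (auto simp: vanish_upto_def)

lemma vanish_upto_eq_0: "(\<And>Q. vanish_upto Q x) \<Longrightarrow> x = 0"
  by (rule levi_civita_eqI) (auto simp: vanish_upto_def)

section \<open>Strong limits and strongly convergent series, coefficient by coefficient\<close>

lemma strong_lim_iff:
  "strong_lim a l \<longleftrightarrow> (\<forall>Q. \<forall>\<^sub>F n in sequentially. vanish_upto Q (a n - l))"
proof
  assume l: "strong_lim a l"
  show "\<forall>Q. \<forall>\<^sub>F n in sequentially. vanish_upto Q (a n - l)"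
  proof
    fix Q
    have "\<forall>\<^sub>F n in sequentially. \<bar>a n - l\<bar> < lc_d (Q + 1)"
      using l by (simp add: strong_lim_def)
    then show "\<forall>\<^sub>F n in sequentially. vanish_upto Q (a n - l)"
    proof (rule eventually_mono)
      fix n assume "\<bar>a n - l\<bar> < lc_d (Q + 1)"
      then show "vanish_upto Q (a n - l)"
        by (rule abs_le_vanish_upto[OF less_imp_le vanish_upto_lc_d]) simp
    qed
  qed
next
  assume r: "\<forall>Q. \<forall>\<^sub>F n in sequentially. vanish_upto Q (a n - l)"
  show "strong_lim a l"
    unfolding strong_lim_def
  proof (intro allI impI)
    fix e :: levi_civita assume "0 < e"
    then obtain Q where "\<And>x. vanish_upto Q x \<Longrightarrow> \<bar>x\<bar> < e"
      by (rule vanish_upto_less) blast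
    moreover have "\<forall>\<^sub>F n in sequentially. vanish_upto Q (a n - l)"
      using r by blast
    ultimately show "\<forall>\<^sub>F n in sequentially. \<bar>a n - l\<bar> < e"
      by (simp add: eventually_mono)
  qed
qed

lemma strong_lim_unique:
  assumes "strong_lim a l" "strong_lim a l'"
  shows "l = l'"
proof -
  have "vanish_upto Q (l - l')" for Q
  proof -
    have "\<forall>\<^sub>F n in sequentially. vanish_upto Q (a n - l) \<and> vanish_upto Q (a n - l')"
      using assms by (simp add: strong_lim_iff eventually_conj)
    then obtain n where "vanish_upto Q (a n - l) \<and> vanish_upto Q (a n - l')"
      using eventually_happens trivial_limit_sequentially by blast
    then show ?thesis by (auto simp: vanish_upto_def)
  qed
  then show ?thesis using vanish_upto_eq_0[of "l - l'"] by simp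
qed

lemma strong_lim_eventually_const:
  assumes "\<And>n. n \<ge> N \<Longrightarrow> a n = l"
  shows "strong_lim a l"
  unfolding strong_lim_def using assms by (auto intro: eventually_sequentiallyI[of N])

lemma strong_lim_add:
  assumes "strong_lim a l" "strong_lim b m"
  shows "strong_lim (\<lambda>n. a n + b n) (l + m)"
  unfolding strong_lim_iff
proof
  fix Q
  have "\<forall>\<^sub>F n in sequentially. vanish_upto Q (a n - l) \<and> vanish_upto Q (b n - m)"
    using assms by (simp add: strong_lim_iff eventually_conj)
  then show "\<forall>\<^sub>F n in sequentially. vanish_upto Q (a n + b n - (l + m))"
    by (rule eventually_mono) (auto simp: vanish_upto_def)
qed

lemma strong_lim_of_real_mult:
  assumes "strong_lim a l"
  shows "strong_lim (\<lambda>n. of_real c * a n) (of_real c * l)"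
  unfolding strong_lim_iff
proof
  fix Q
  have "\<forall>\<^sub>F n in sequentially. vanish_upto Q (a n - l)"
    using assms by (simp add: strong_lim_iff)
  then show "\<forall>\<^sub>F n in sequentially. vanish_upto Q (of_real c * a n - of_real c * l)"
    by (rule eventually_mono) (simp add: vanish_upto_def)
qed

lemma strong_lim_le:
  assumes "strong_lim a l" "\<And>n. a n \<le> u"
  shows "l \<le> u"
proof (rule ccontr)
  assume "\<not> l \<le> u"
  then have "0 < l - u" by simp
  with assms(1) have "\<forall>\<^sub>F n in sequentially. \<bar>a n - l\<bar> < l - u"
    by (simp add: strong_lim_def)
  then obtain n where "\<bar>a n - l\<bar> < l - u"
    using eventually_happens trivial_limit_sequentially by blast
  with assms(2)[of n] show False by (simp add: abs_less_iff)
qed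

lemma strong_sums_unique: "strong_sums a s \<Longrightarrow> strong_sums a t \<Longrightarrow> s = t"
  unfolding strong_sums_def by (rule strong_lim_unique)

lemma strong_sums_add:
  "strong_sums a s \<Longrightarrow> strong_sums b t \<Longrightarrow> strong_sums (\<lambda>n. a n + b n) (s + t)"
  unfolding strong_sums_def sum.distrib by (rule strong_lim_add)

lemma strong_sums_of_real_mult:
  "strong_sums a s \<Longrightarrow> strong_sums (\<lambda>n. of_real c * a n) (of_real c * s)"
  unfolding strong_sums_def sum_distrib_left[symmetric] by (rule strong_lim_of_real_mult)

lemma strong_sums_le:
  "strong_sums a s \<Longrightarrow> (\<And>n. (\<Sum>k<n. a k) \<le> u) \<Longrightarrow> s \<le> u"
  unfolding strong_sums_def by (rule strong_lim_le)

lemma strong_sums_terms: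
  assumes "strong_sums a s"
  shows "\<forall>\<^sub>F n in sequentially. vanish_upto Q (a n)"
proof -
  have e: "\<forall>\<^sub>F n in sequentially. vanish_upto Q ((\<Sum>k<n. a k) - s)"
    using assms by (simp add: strong_sums_def strong_lim_iff)
  then have "\<forall>\<^sub>F n in sequentially. vanish_upto Q ((\<Sum>k<Suc n. a k) - s)"
    by (subst eventually_sequentially_Suc)
  with e show ?thesis
    by eventually_elim (auto simp: vanish_upto_def)
qed

text \<open>Completeness in ultrametric form: terms tending to 0 suffice, because each coefficient
  of the partial sums becomes constant. The conclusion keeps the index \<open>n\<close> explicit,
  since the diagonal construction needs the error after exactly \<open>n\<close> terms.\<close>

lemma null_terms_limit:
  assumes "\<And>Q. \<forall>\<^sub>F n in sequentially. vanish_upto Q (v n)"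
  obtains s where "\<And>Q n. (\<And>k. k \<ge> n \<Longrightarrow> vanish_upto Q (v k)) \<Longrightarrow> vanish_upto Q (s - (\<Sum>k<n. v k))"
proof -
  obtain N where N: "\<And>Q n. n \<ge> N Q \<Longrightarrow> vanish_upto Q (v n)"
    using assms unfolding eventually_sequentially by metis
  \<comment> \<open>From \<open>N q\<close> on, no term has a nonzero coefficient at or below
    \<open>q\<close>, so this is the final value of the coefficient.\<close>
  define c where "c q = (\<Sum>k<N q. coef (v k) q)" for q
  have c: "c q = (\<Sum>k<n. coef (v k) q)" if "\<And>k. k \<ge> n \<Longrightarrow> vanish_upto Q (v k)" "q \<le> Q" for q n Q
  proof -
    have "(\<Sum>k<N q. coef (v k) q) = (\<Sum>k\<in>{..<N q} \<union> {..<n}. coef (v k) q)"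
      by (rule sum.mono_neutral_left) (use N[of q] in \<open>auto simp: vanish_upto_def not_less[symmetric]\<close>)
    also have "\<dots> = (\<Sum>k<n. coef (v k) q)"
      by (rule sum.mono_neutral_right) (use that in \<open>auto simp: vanish_upto_def\<close>)
    finally show ?thesis by (simp add: c_def)
  qed
  have "left_finite {q. c q \<noteq> 0}"
    unfolding left_finite_def
  proof
    fix q
    have "{x \<in> {q. c q \<noteq> 0}. x \<le> q} \<subseteq> (\<Union>k<N q. {x. coef (v k) x \<noteq> 0 \<and> x \<le> q})"
    proof
      fix x assume "x \<in> {x \<in> {q. c q \<noteq> 0}. x \<le> q}"
      then have x: "c x \<noteq> 0" "x \<le> q" by auto
      with c[of "N q" q x] N have "(\<Sum>k<N q. coef (v k) x) \<noteq> 0" by auto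
      then obtain k where "k < N q" "coef (v k) x \<noteq> 0"
        by (meson lessThan_iff sum.neutral)
      with x show "x \<in> (\<Union>k<N q. {x. coef (v k) x \<noteq> 0 \<and> x \<le> q})" by auto
    qed
    moreover have "finite (\<Union>k<N q. {x. coef (v k) x \<noteq> 0 \<and> x \<le> q})"
      using left_finite_supp by (auto simp: left_finite_def)
    ultimately show "finite {x \<in> {q. c q \<noteq> 0}. x \<le> q}" by (rule finite_subset)
  qed
  then have "coef (Abs_levi_civita c) = c"
    by (simp add: Abs_levi_civita_inverse)
  then show thesis
    using c by (intro that[of "Abs_levi_civita c"]) (auto simp: vanish_upto_def coef_sum)
qed

lemma strong_sums_null_terms:
  assumes "\<And>Q. \<forall>\<^sub>F n in sequentially. vanish_upto Q (v n)"
  obtains s where "strong_sums v s"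
proof -
  obtain s where s: "\<And>Q n. (\<And>k. k \<ge> n \<Longrightarrow> vanish_upto Q (v k)) \<Longrightarrow> vanish_upto Q (s - (\<Sum>k<n. v k))"
    using null_terms_limit[of v] assms by blast
  have "strong_sums v s"
    unfolding strong_sums_def strong_lim_iff
  proof
    fix Q
    obtain N where N: "\<And>n. n \<ge> N \<Longrightarrow> vanish_upto Q (v n)"
      using assms[of Q] by (auto simp: eventually_sequentially)
    have "vanish_upto Q ((\<Sum>k<n. v k) - s)" if "n \<ge> N" for n
      using s[of n Q] N that by (force simp: vanish_upto_def)
    then show "\<forall>\<^sub>F n in sequentially. vanish_upto Q ((\<Sum>k<n. v k) - s)"
      by (auto simp: eventually_sequentially)
  qed
  then show thesis by (rule that)
qed

section \<open>Weak limits\<close>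

lemma weak_lim_coef:
  assumes "weak_lim a l"
  shows "(\<lambda>n. coef (a n) q) \<longlonglongrightarrow> coef l q"
proof (rule LIMSEQ_I)
  fix r :: real assume r: "0 < r"
  \<comment> \<open>The second bound puts \<open>q\<close> inside the window
    \<open>q \<le> inverse e\<close> of weak smallness.\<close>
  define e where "e = min r (inverse (\<bar>of_rat q\<bar> + 1))"
  have "0 < \<bar>of_rat q\<bar> + (1::real)" by linarith
  then have e: "0 < e" "e \<le> r" using r by (simp_all add: e_def)
  have "of_rat q \<le> \<bar>of_rat q\<bar> + (1::real)" by linarith
  also have "\<dots> = inverse (inverse (\<bar>of_rat q\<bar> + 1))" by simp
  also have "\<dots> \<le> inverse e"
    using e by (intro le_imp_inverse_le) (simp_all add: e_def)
  finally have q: "of_rat q \<le> inverse e" .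
  have "\<forall>\<^sub>F n in sequentially. weakly_small e (a n - l)"
    using assms e by (simp add: weak_lim_def)
  then have "\<forall>\<^sub>F n in sequentially. norm (coef (a n) q - coef l q) < r"
    by (rule eventually_mono) (use q e in \<open>force simp: weakly_small_def\<close>)
  then show "\<exists>no. \<forall>n\<ge>no. norm (coef (a n) q - coef l q) < r"
    by (simp add: eventually_sequentially)
qed

lemma weakly_small_of_real: "\<bar>x\<bar> < \<epsilon> \<Longrightarrow> weakly_small \<epsilon> (of_real x)"
  by (auto simp: weakly_small_def)

lemma weak_lim_of_real:
  assumes "a \<longlonglongrightarrow> l"
  shows "weak_lim (\<lambda>n. of_real (a n)) (of_real l)"
  unfolding weak_lim_def
proof (intro allI impI)
  fix e :: real assume "0 < e"
  with assms have "\<forall>\<^sub>F n in sequentially. \<bar>a n - l\<bar> < e"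
    by (simp add: tendsto_iff dist_real_def)
  then show "\<forall>\<^sub>F n in sequentially. weakly_small e (of_real (a n) - of_real l)"
    by (rule eventually_mono) (simp add: weakly_small_of_real flip: of_real_diff)
qed

lemma weak_sums_coef: "weak_sums a s \<Longrightarrow> (\<lambda>k. coef (a k) q) sums coef s q"
  unfolding weak_sums_def sums_def_le
  by (drule weak_lim_coef[where q = q]) (simp add: coef_sum)

section \<open>Power series on intervals have no jumps\<close>

text \<open>Richardson extrapolation: for A = 2^(J+1), the combination (A P(t) - P(2t)) / (A - 1)
  removes the coefficient of degree J + 1 and keeps both the constant term and the limit c. The
  degree drops until only the constant term is left.\<close>

lemma bounded_degree_limit_at_0:
  fixes G :: "nat \<Rightarrow> nat \<Rightarrow> real"
  assumes "\<And>t. 0 < t \<Longrightarrow> (\<lambda>n. \<Sum>j\<le>J. G n j * t ^ j) \<longlonglongrightarrow> c"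
  shows "(\<lambda>n. G n 0) \<longlonglongrightarrow> c"
  using assms
proof (induction J arbitrary: G)
  case 0
  from 0[of 1] show ?case by simp
next
  case (Suc J)
  define A :: real where "A = 2 ^ Suc J"
  have "1 < A" unfolding A_def by (rule one_less_power) simp_all
  then have A: "A - 1 \<noteq> 0" by simp
  define G' where "G' n j = (A * G n j - 2 ^ j * G n j) / (A - 1)" for n j
  have "(\<lambda>n. \<Sum>j\<le>J. G' n j * t ^ j) \<longlonglongrightarrow> c" if t: "0 < t" for t
  proof -
    have "(\<Sum>j\<le>J. G' n j * t ^ j) =
      (A * (\<Sum>j\<le>Suc J. G n j * t ^ j) - (\<Sum>j\<le>Suc J. G n j * (2 * t) ^ j)) / (A - 1)" for n
    proof -
      have "(\<Sum>j\<le>J. G' n j * t ^ j) = (\<Sum>j\<le>Suc J. G' n j * t ^ j)"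
        by (simp add: G'_def A_def)
      also have "\<dots> = (\<Sum>j\<le>Suc J. (A * (G n j * t ^ j) - G n j * (2 * t) ^ j) / (A - 1))"
        by (intro sum.cong refl) (simp add: G'_def power_mult_distrib field_simps)
      finally show ?thesis
        by (simp only: sum_divide_distrib[symmetric] sum_subtractf sum_distrib_left[symmetric])
    qed
    moreover have "(\<lambda>n. (A * (\<Sum>j\<le>Suc J. G n j * t ^ j) - (\<Sum>j\<le>Suc J. G n j * (2 * t) ^ j)) / (A - 1))
        \<longlonglongrightarrow> (A * c - c) / (A - 1)"
      using t by (intro tendsto_intros Suc.prems A) auto
    moreover have "(A * c - c) / (A - 1) = c"
      using A by (simp add: field_simps)
    ultimately show ?thesis by simp
  qed
  then have "(\<lambda>n. G' n 0) \<longlonglongrightarrow> c" by (rule Suc.IH)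
  moreover have "G' n 0 = G n 0" for n
    using A by (simp add: G'_def field_simps)
  ultimately show ?case by simp
qed

text \<open>At \<open>z = t d^s\<close> the k-th term contributes a real multiple of t^k to the
  coefficient at \<open>q\<close>. The resulting real power series is constant for t > 0 and
  continuous at 0, so its constant term has the same value.\<close>

lemma no_jump_at_center:
  assumes \<eta>: "0 < \<eta>"
    and ser: "\<And>z. 0 \<le> z \<Longrightarrow> z < \<eta> \<Longrightarrow> weak_sums (\<lambda>k. a k * z ^ k) (g z)"
    and c: "\<And>z. 0 < z \<Longrightarrow> z < \<eta> \<Longrightarrow> g z = c"
  shows "g 0 = c"
proof (rule levi_civita_eqI)
  fix q
  obtain Q where Q: "\<And>x. vanish_upto Q x \<Longrightarrow> \<bar>x\<bar> < \<eta>"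
    using vanish_upto_less[OF \<eta>] by blast
  \<comment> \<open>Since \<open>s\<close> exceeds \<open>Q\<close>, the element
    \<open>t d^s\<close> stays below \<open>\<eta>\<close> for every real t, however large.\<close>
  define s where "s = Q + 1"
  define \<alpha> where "\<alpha> k = coef (a k) (q - of_nat k * s)" for k
  have sums: "(\<lambda>k. \<alpha> k * t ^ k) sums coef c q" if t: "0 < t" for t :: real
  proof -
    let ?z = "of_real t * lc_d s"
    have "0 < ?z" using t of_real_less_lc_iff[of 0 t] by simp
    moreover have "?z < \<eta>"
      using Q[of ?z] by (auto simp: vanish_upto_def s_def)
    ultimately have "weak_sums (\<lambda>k. a k * ?z ^ k) c"
      using ser[of ?z] c by simp
    then have "(\<lambda>k. coef (a k * ?z ^ k) q) sums coef c q"
      by (rule weak_sums_coef)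
    moreover have "coef (a k * ?z ^ k) q = \<alpha> k * t ^ k" for k
    proof -
      have "a k * ?z ^ k = of_real (t ^ k) * (a k * lc_d (of_nat k * s))"
        by (simp only: power_mult_distrib lc_d_power of_real_power mult_ac)
      then show ?thesis
        by (simp only: coef_of_real_mult coef_mult_lc_d \<alpha>_def mult.commute)
    qed
    ultimately show ?thesis by simp
  qed
  define f where "f x = (\<Sum>k. \<alpha> k * x ^ k)" for x
  have "(\<lambda>k. \<alpha> k * x ^ k) sums f x" if "norm x < 1" for x
    unfolding f_def
    by (rule summable_sums, rule powser_inside[of _ 1]) (use sums[of 1] that in \<open>auto simp: sums_iff\<close>)
  then have "(f \<longlongrightarrow> \<alpha> 0) (at 0)"
    by (intro powser_limit_0[of 1]) auto
  then have "(f \<longlongrightarrow> \<alpha> 0) (at_right 0)"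
    by (rule tendsto_mono[rotated]) (simp add: at_le)
  moreover have "(f \<longlongrightarrow> coef c q) (at_right 0)"
  proof (rule tendsto_eventually)
    show "\<forall>\<^sub>F x in at_right 0. f x = coef c q"
      using sums by (auto simp: f_def sums_iff eventually_at_filter)
  qed
  ultimately have "\<alpha> 0 = coef c q"
    by (rule tendsto_unique[rotated]) simp
  moreover have "coef (g 0) q = \<alpha> 0"
  proof -
    have "(\<lambda>k. coef (a k * 0 ^ k) q) sums coef (g 0) q"
      using ser[of 0] \<eta> by (intro weak_sums_coef) simp
    moreover have "(\<lambda>k. coef (a k * 0 ^ k) q) sums coef (a 0 * 0 ^ 0) q"
      by (rule sums_finite[of "{0}", simplified]) (simp add: power_0_left)
    ultimately have "coef (g 0) q = coef (a 0 * 0 ^ 0) q"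
      by (rule sums_unique2)
    then show ?thesis by (simp add: \<alpha>_def)
  qed
  ultimately show "coef (g 0) q = coef c q" by simp
qed

section \<open>Leading coefficients of products, powers and differences of powers\<close>

definition vanish_below :: "rat \<Rightarrow> levi_civita \<Rightarrow> bool" where
  "vanish_below m x \<longleftrightarrow> (\<forall>q<m. coef x q = 0)"

lemma vanish_below_mult:
  "vanish_below m x \<Longrightarrow> vanish_below n y \<Longrightarrow> vanish_below (m + n) (x * y)"
  unfolding vanish_below_def using coef_mult_lowest(2) by blast

lemma coef_mult_lowest': 
  "vanish_below m x \<Longrightarrow> vanish_below n y \<Longrightarrow> coef (x * y) (m + n) = coef x m * coef y n"
  unfolding vanish_below_def using coef_mult_lowest(1) by blast

lemma power_lowest:
  assumes "vanish_below m x"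
  shows "vanish_below (of_nat k * m) (x ^ k)" "coef (x ^ k) (of_nat k * m) = coef x m ^ k"
proof -
  have "vanish_below (of_nat k * m) (x ^ k) \<and> coef (x ^ k) (of_nat k * m) = coef x m ^ k"
  proof (induction k)
    case 0
    then show ?case by (simp add: vanish_below_def)
  next
    case (Suc k)
    have e: "of_nat (Suc k) * m = m + of_nat k * m" by (simp add: algebra_simps)
    show ?case
      unfolding e using vanish_below_mult[OF assms, of "of_nat k * m" "x ^ k"]
        coef_mult_lowest'[OF assms, of "of_nat k * m" "x ^ k"] Suc by simp
  qed
  then show "vanish_below (of_nat k * m) (x ^ k)" "coef (x ^ k) (of_nat k * m) = coef x m ^ k"
    by auto
qed

text \<open>The cofactor of \<open>w' - w\<close> is a sum of k + 1 products that all have the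
  leading coefficient L^k at the same exponent, so the leading terms add up without
  cancellation.\<close>

lemma power_difference_lowest:
  assumes w: "vanish_below l w" "coef w l = L" and w': "vanish_below l w'" "coef w' l = L"
  obtains S where "w' ^ Suc k - w ^ Suc k = (w' - w) * S" "vanish_below (of_nat k * l) S"
    "coef S (of_nat k * l) = real (Suc k) * L ^ k"
proof
  let ?S = "\<Sum>i<Suc k. w ^ (Suc k - Suc i) * w' ^ i"
  show "w' ^ Suc k - w ^ Suc k = (w' - w) * ?S"
    by (rule power_diff_sumr2)
  have t: "vanish_below (of_nat k * l) (w ^ (Suc k - Suc i) * w' ^ i) \<and>
      coef (w ^ (Suc k - Suc i) * w' ^ i) (of_nat k * l) = L ^ k" if "i < Suc k" for i
  proof -
    have "of_nat k * l = of_nat (k - i) * l + of_nat i * l"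
      using that by (simp flip: distrib_right of_nat_add)
    moreover have "L ^ (k - i) * L ^ i = L ^ k"
      using that by (simp flip: power_add)
    ultimately show ?thesis
      using vanish_below_mult[OF power_lowest(1)[OF w(1), of "k - i"] power_lowest(1)[OF w'(1), of i]]
        coef_mult_lowest'[OF power_lowest(1)[OF w(1), of "k - i"] power_lowest(1)[OF w'(1), of i]]
      by (simp only: power_lowest(2)[OF w(1)] power_lowest(2)[OF w'(1)] w(2) w'(2) diff_Suc_Suc)
  qed
  show "vanish_below (of_nat k * l) ?S"
    unfolding vanish_below_def coef_sum using t by (auto simp: vanish_below_def intro!: sum.neutral)
  have "coef ?S (of_nat k * l) = (\<Sum>i<Suc k. L ^ k)"
    unfolding coef_sum using t by (intro sum.cong) auto
  then show "coef ?S (of_nat k * l) = real (Suc k) * L ^ k" by simp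
qed

text \<open>One step of the diagonal construction below: a large coefficient is forced at the exponent 0,
  which all later modifications of \<open>z\<close> leave alone.\<close>

lemma force_large_coefficient:
  assumes y: "vanish_below l y" "coef y l \<noteq> 0" and z: "vanish_upto l z"
    and unb: "coef a r \<noteq> 0" "r + of_nat k * l < - e" and e: "l \<le> e"
  obtains t e' where "0 < t" "e < e'"
    "1 \<le> \<bar>coef (a * (y + (z + of_real t * lc_d e')) ^ Suc k) 0\<bar>"
    "\<And>\<zeta>. vanish_upto e' \<zeta> \<Longrightarrow>
      coef (a * (y + (z + of_real t * lc_d e' + \<zeta>)) ^ Suc k) 0 =
      coef (a * (y + (z + of_real t * lc_d e')) ^ Suc k) 0"
proof -
  define v where "v = lc_val a"
  have "a \<noteq> 0" using unb by auto
  then have a: "vanish_below v a" "coef a v \<noteq> 0" "v \<le> r"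
    unfolding v_def using lc_val_nonzero[of a] coef_below_val[of a] unb by (auto simp: vanish_below_def)
  define L where "L = coef y l"
  \<comment> \<open>The three factors of the difference have the lowest exponents \<open>e'\<close>,
    \<open>v\<close> and k l; this choice makes them add up to 0.\<close>
  define e' where "e' = - (v + of_nat k * l)"
  have e': "e < e'" using a(3) unb by (simp add: e'_def)
  define \<rho> where "\<rho> = coef (a * (y + z) ^ Suc k) 0"
  define K where "K = coef a v * (real (Suc k) * L ^ k)"
  have K: "K \<noteq> 0" using a y by (simp add: K_def L_def del: of_nat_Suc)
  \<comment> \<open>The change \<open>t * K\<close> gets the absolute value
    \<open>\<bar>\<rho>\<bar> + 1\<close>, so the old coefficient \<open>\<rho>\<close> cannot bring
    the new one below 1.\<close>
  define t where "t = (\<bar>\<rho>\<bar> + 1) / \<bar>K\<bar>"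
  have t: "0 < t" using K by (simp add: t_def)
  have w: "vanish_below l (y + x)" "coef (y + x) l = L" if "vanish_upto l x" for x
    using y that by (auto simp: vanish_below_def vanish_upto_def L_def)
  \<comment> \<open>An exact identity: 0 is the lowest exponent of the product, so only leading
    coefficients meet there. It also shows that a change vanishing up to \<open>e'\<close> leaves
    this coefficient alone.\<close>
  have main: "coef (a * (y + x') ^ Suc k) 0 - coef (a * (y + x) ^ Suc k) 0 = coef (x' - x) e' * K"
    if x: "vanish_upto l x" and x': "vanish_upto l x'" and d: "vanish_below e' (x' - x)" for x x'
  proof -
    obtain S where S: "(y + x') ^ Suc k - (y + x) ^ Suc k = ((y + x') - (y + x)) * S"
        "vanish_below (of_nat k * l) S" "coef S (of_nat k * l) = real (Suc k) * L ^ k"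
      using power_difference_lowest[OF w[OF x] w[OF x']] .
    have "a * (y + x') ^ Suc k - a * (y + x) ^ Suc k = (x' - x) * (a * S)"
      using S(1) by (simp only: right_diff_distrib[symmetric]) (simp add: mult_ac)
    then have "coef (a * (y + x') ^ Suc k) 0 - coef (a * (y + x) ^ Suc k) 0 = coef ((x' - x) * (a * S)) 0"
      by (simp only: coef_simps(4)[symmetric])
    also have "\<dots> = coef ((x' - x) * (a * S)) (e' + (v + of_nat k * l))"
      by (simp add: e'_def)
    also have "\<dots> = coef (x' - x) e' * K"
      by (simp only: coef_mult_lowest'[OF d vanish_below_mult[OF a(1) S(2)]]
          coef_mult_lowest'[OF a(1) S(2)] S(3) K_def)
    finally show ?thesis .
  qed
  define z' where "z' = z + of_real t * lc_d e'"
  have z': "vanish_upto l z'"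
    using z e e' by (auto simp: z'_def vanish_upto_def)
  have "coef (a * (y + z') ^ Suc k) 0 = \<rho> + t * K"
    using main[OF z z'] by (simp add: \<rho>_def z'_def vanish_below_def)
  moreover have "\<bar>t * K\<bar> = \<bar>\<rho>\<bar> + 1"
    using K by (simp add: t_def abs_mult)
  ultimately have "1 \<le> \<bar>coef (a * (y + z') ^ Suc k) 0\<bar>" by linarith
  moreover have "coef (a * (y + (z' + \<zeta>)) ^ Suc k) 0 = coef (a * (y + z') ^ Suc k) 0"
    if "vanish_upto e' \<zeta>" for \<zeta>
  proof -
    have "vanish_upto l (z' + \<zeta>)"
      using z' that e e' by (intro vanish_upto_add) (auto intro: vanish_upto_mono)
    from main[OF z' this] that show ?thesis
      by (auto simp: vanish_below_def vanish_upto_def)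
  qed
  ultimately show thesis
    using t e' that unfolding z'_def by blast
qed

text \<open>If the valuations of the \<open>a k * y ^ (k - 1)\<close> were not bounded below, then a suitable
  \<open>z = \<Sum>i. t\<^sub>i d^(e\<^sub>i)\<close> would make infinitely many terms of the series at \<open>y + z\<close> have a coefficient
  of absolute value at least 1 at the exponent 0.\<close>

lemma weak_series_valuation_bound:
  assumes \<eta>: "0 < \<eta>" and y: "vanish_below l y" "coef y l \<noteq> 0"
    and ser: "\<And>z. 0 < z \<Longrightarrow> z < \<eta> \<Longrightarrow> weak_sums (\<lambda>k. a k * (y + z) ^ k) (g z)"
  obtains m where "\<And>k r. coef (a (Suc k)) r \<noteq> 0 \<Longrightarrow> m \<le> r + of_nat k * l"
proof (rule ccontr)
  assume "\<not> thesis"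
  with that have unb: "\<exists>k r. coef (a (Suc k)) r \<noteq> 0 \<and> r + of_nat k * l < m" for m
    by (meson not_le)
  \<comment> \<open>For each fixed k the exponents are bounded below, so unboundedness must come
    from arbitrarily late terms of the series.\<close>
  have unb': "\<exists>k>K. \<exists>r. coef (a (Suc k)) r \<noteq> 0 \<and> r + of_nat k * l < m" for m K
  proof -
    have "\<forall>k. \<exists>b. \<forall>r. coef (a (Suc k)) r \<noteq> 0 \<longrightarrow> b \<le> r + of_nat k * l"
    proof
      fix k
      obtain b where "\<And>r. r \<in> {r. coef (a (Suc k)) r \<noteq> 0} \<Longrightarrow> b \<le> r"
        using left_finite_bounded_below[OF left_finite_supp[of "a (Suc k)"]] by blast
      then show "\<exists>b. \<forall>r. coef (a (Suc k)) r \<noteq> 0 \<longrightarrow> b \<le> r + of_nat k * l"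
        by (intro exI[of _ "b + of_nat k * l"]) auto
    qed
    then obtain b where b: "\<And>k r. coef (a (Suc k)) r \<noteq> 0 \<Longrightarrow> b k \<le> r + of_nat k * l"
      by metis
    obtain k r where kr: "coef (a (Suc k)) r \<noteq> 0" "r + of_nat k * l < Min (insert m (b ` {..K}))"
      using unb by blast
    then have "k > K"
      using b[OF kr(1)] by (force simp: not_less[symmetric])
    with kr show ?thesis by auto
  qed
  obtain Q where Q: "\<And>x. vanish_upto Q x \<Longrightarrow> \<bar>x\<bar> < \<eta>"
    using vanish_upto_less[OF \<eta>] by blast
  \<comment> \<open>Corrections above \<open>l\<close> preserve the leading term of
    \<open>y\<close>; corrections above \<open>Q\<close> keep the perturbation below
    \<open>\<eta>\<close>.\<close>
  define e0 where "e0 = max l Q"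
  define good where "good z e k \<longleftrightarrow> 1 \<le> \<bar>coef (a (Suc k) * (y + z) ^ Suc k) 0\<bar> \<and>
      (\<forall>\<zeta>. vanish_upto e \<zeta> \<longrightarrow>
        coef (a (Suc k) * (y + (z + \<zeta>)) ^ Suc k) 0 = coef (a (Suc k) * (y + z) ^ Suc k) 0)"
    for z e k
  define P where "P n x = (case x of (z, e, k) \<Rightarrow> vanish_upto e0 z \<and> e0 \<le> e \<and> (n = 0 \<longrightarrow> z = 0))"
    for n :: nat and x :: "levi_civita \<times> rat \<times> nat"
  \<comment> \<open>Exponents grow by more than 1 in each step, so the increments tend to 0 and
    their sum exists; the indices grow strictly, so infinitely many terms of the series are
    affected.\<close>
  define R where "R n x x' = (case x of (z, e, k) \<Rightarrow> case x' of (z', e', k') \<Rightarrow>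
      e + 1 < e' \<and> k < k' \<and> (\<exists>t>0. z' = z + of_real t * lc_d e') \<and> good z' e' k')"
    for n :: nat and x x' :: "levi_civita \<times> rat \<times> nat"
  have "\<exists>f. \<forall>n. P n (f n) \<and> R n (f n) (f (Suc n))"
  proof (rule dependent_nat_choice)
    show "\<exists>x. P 0 x"
      by (rule exI[of _ "(0, e0, 0)"]) (simp add: P_def vanish_upto_def)
  next
    fix x n assume Px: "P n x"
    obtain z e k where x: "x = (z, e, k)" by (cases x)
    have z: "vanish_upto e0 z" "e0 \<le> e" using Px by (auto simp: P_def x)
    obtain k' r where kr: "k' > k" "coef (a (Suc k')) r \<noteq> 0" "r + of_nat k' * l < - (e + 1)"
      using unb'[of k "- (e + 1)"] by blast
    have "vanish_upto l z" "l \<le> e + 1"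
      using z by (auto simp: e0_def intro: vanish_upto_mono)
    then obtain t e' where t: "0 < t" "e + 1 < e'" "good (z + of_real t * lc_d e') e' k'"
      using force_large_coefficient[OF y _ kr(2,3)] unfolding good_def by metis
    have "vanish_upto e0 (z + of_real t * lc_d e')"
      using z t by (auto simp: vanish_upto_def)
    then show "\<exists>x'. P (Suc n) x' \<and> R n x x'"
      using t kr(1) z by (intro exI[of _ "(z + of_real t * lc_d e', e', k')"]) (auto simp: P_def R_def x)
  qed
  then obtain f where f: "\<And>n. P n (f n)" "\<And>n. R n (f n) (f (Suc n))"
    by blast
  define Z E K where "Z n = fst (f n)" and "E n = fst (snd (f n))" and "K n = snd (snd (f n))" for n
  have Z0: "Z 0 = 0" and E0: "e0 \<le> E n" for n
    using f(1)[of 0] f(1)[of n] by (auto simp: P_def Z_def E_def split: prod.splits)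
  have step: "E n + 1 < E (Suc n)" "K n < K (Suc n)" "good (Z (Suc n)) (E (Suc n)) (K (Suc n))"
    "\<exists>t>0. Z (Suc n) = Z n + of_real t * lc_d (E (Suc n))" for n
    using f(2)[of n] by (auto simp: R_def Z_def E_def K_def split: prod.splits)
  have mE: "mono E" using step(1) by (intro incseq_SucI) (metis add_increasing2 less_imp_le order_trans zero_le_one le_add_same_cancel1)
  have En: "e0 + of_nat n \<le> E n" for n
  proof (induction n)
    case (Suc n)
    then show ?case using step(1)[of n] by simp
  qed (use E0 in auto)
  define v where "v n = Z (Suc n) - Z n" for n
  have v: "vanish_upto (E n) (v n)" for n
    using step(1,4)[of n] by (auto simp: v_def vanish_upto_def)
  have "\<forall>\<^sub>F n in sequentially. vanish_upto q (v n)" for q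
  proof -
    obtain N where "q - e0 \<le> of_nat N" using real_arch_simple by blast
    then have "vanish_upto q (v n)" if "n \<ge> N" for n
      using En[of n] of_nat_mono[OF that, where 'a = rat]
      by (intro vanish_upto_mono[OF v]) linarith
    then show ?thesis by (auto simp: eventually_sequentially)
  qed
  then obtain s where s: "\<And>q n. (\<And>k. k \<ge> n \<Longrightarrow> vanish_upto q (v k)) \<Longrightarrow> vanish_upto q (s - (\<Sum>k<n. v k))"
    by (rule null_terms_limit) blast
  have sumv: "(\<Sum>k<n. v k) = Z n" for n
    unfolding v_def by (simp add: sum_lessThan_telescope Z0)
  have sZ: "vanish_upto (E n) (s - Z n)" for n
    using s[of n "E n"] v monoD[OF mE] unfolding sumv by (meson vanish_upto_mono)
  have "vanish_upto Q s"
    using sZ[of 0] E0[of 0] by (auto simp: Z0 e0_def intro: vanish_upto_mono)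
  then have "s < \<eta>" using Q[of s] by auto
  moreover have "0 < s"
  proof -
    obtain t where t: "0 < t" "Z 1 = of_real t * lc_d (E 1)"
      using step(4)[of 0] by (auto simp: Z0)
    have "coef s q = (if q = E 1 then t else 0)" if "q \<le> E 1" for q
      using sZ[of 1] that t by (auto simp: vanish_upto_def)
    with t show ?thesis
      unfolding less_coef_iff by (intro exI[of _ "E 1"]) auto
  qed
  ultimately have "(\<lambda>k. coef (a k * (y + s) ^ k) 0) sums coef (g s) 0"
    by (intro weak_sums_coef ser)
  then have "(\<lambda>k. coef (a k * (y + s) ^ k) 0) \<longlonglongrightarrow> 0"
    by (intro summable_LIMSEQ_zero) (rule sums_summable)
  then obtain N where N: "\<And>k. k \<ge> N \<Longrightarrow> \<bar>coef (a k * (y + s) ^ k) 0\<bar> < 1"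
    using LIMSEQ_D[of _ 0 1] by fastforce
  have "strict_mono K" using step(2) by (intro strict_mono_Suc_iff[THEN iffD2]) auto
  then have "Suc (K (Suc N)) \<ge> N"
    using strict_mono_imp_increasing[of K "Suc N"] by simp
  from N[OF this] have "\<bar>coef (a (Suc (K (Suc N))) * (y + s) ^ Suc (K (Suc N))) 0\<bar> < 1" .
  \<comment> \<open>The limit differs from \<open>Z (Suc N)\<close> only above
    \<open>E (Suc N)\<close>, so the large coefficient forced at that stage survives, against the
    terms tending to 0.\<close>
  moreover have "y + s = y + (Z (Suc N) + (s - Z (Suc N)))" by simp
  ultimately show False
    using step(3)[of N] sZ[of "Suc N"] unfolding good_def by (metis not_le)
qed

text \<open>Expand \<open>(y + t d^s) ^ k\<close> binomially. By the valuation bound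
  \<open>m\<close>, the factor of t^j has no exponents below m + l + j (s - l). For fixed
  \<open>q\<close> this bounds j independently of k, so the partial sums are polynomials in t of
  bounded degree.\<close>

lemma no_jump_off_center:
  assumes \<eta>: "0 < \<eta>" and y: "y \<noteq> 0"
    and ser: "\<And>z. 0 \<le> z \<Longrightarrow> z < \<eta> \<Longrightarrow> weak_sums (\<lambda>k. a k * (y + z) ^ k) (g z)"
    and c: "\<And>z. 0 < z \<Longrightarrow> z < \<eta> \<Longrightarrow> g z = c"
  shows "g 0 = c"
proof (rule levi_civita_eqI)
  fix q
  define l where "l = lc_val y"
  have l: "vanish_below l y" "coef y l \<noteq> 0"
    using lc_val_nonzero(1)[OF y] coef_below_val[OF y] by (auto simp: l_def vanish_below_def)
  obtain m where m: "\<And>k r. coef (a (Suc k)) r \<noteq> 0 \<Longrightarrow> m \<le> r + of_nat k * l"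
    using weak_series_valuation_bound[OF \<eta> l, of a g] ser by force
  obtain Q where Q: "\<And>x. vanish_upto Q x \<Longrightarrow> \<bar>x\<bar> < \<eta>"
    using vanish_upto_less[OF \<eta>] by blast
  \<comment> \<open>With s - l at least 1, each further power of t raises the lowest exponent by at
    least 1; \<open>s\<close> above \<open>Q\<close> keeps \<open>t d^s\<close> below
    \<open>\<eta>\<close>.\<close>
  define s where "s = max l Q + 1"
  have s: "1 \<le> s - l" "Q < s" by (auto simp: s_def)
  \<comment> \<open>A contribution of t^j at \<open>q\<close> requires m + l + j (s - l) \<le> q,
    hence j \<le> q - m - l.\<close>
  obtain J :: nat where J: "q - m - l \<le> of_nat J" using real_arch_simple by blast
  define \<gamma> where "\<gamma> k j = (if j \<le> k then real (k choose j) * coef (a k * y ^ (k - j)) (q - of_nat j * s) else 0)" for k j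
  have \<gamma>0: "\<gamma> k j = 0" if "j > J" for k j
  proof (cases "j \<le> k")
    case True
    then obtain k' where k: "k = Suc k'" using \<open>j > J\<close> by (cases k) auto
    have "vanish_below (m - of_nat k' * l) (a k)"
      using m[of k'] by (force simp: vanish_below_def k)
    then have "vanish_below (m - of_nat k' * l + of_nat (k - j) * l) (a k * y ^ (k - j))"
      using power_lowest(1)[OF l(1)] by (rule vanish_below_mult)
    moreover have "m - of_nat k' * l + of_nat (k - j) * l = m + l - of_nat j * l"
      using True by (simp add: k of_nat_diff algebra_simps)
    moreover have "of_nat j * s \<ge> of_nat j * (l + 1)"
      using s by (intro mult_left_mono) auto
    moreover have "of_nat j > (of_nat J :: rat)" using that by simp
    ultimately show ?thesis
      using J by (auto simp: \<gamma>_def vanish_below_def algebra_simps)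
  qed (simp add: \<gamma>_def)
  have coef_term: "coef (a k * (y + of_real t * lc_d s) ^ k) q = (\<Sum>j\<le>J. \<gamma> k j * t ^ j)" for k t
  proof -
    have "a k * (y + of_real t * lc_d s) ^ k =
        a k * (\<Sum>j\<le>k. of_nat (k choose j) * (of_real t * lc_d s) ^ j * y ^ (k - j))"
      by (subst add.commute) (simp only: binomial_ring)
    also have "\<dots> = (\<Sum>j\<le>k. of_real (real (k choose j) * t ^ j) * (a k * y ^ (k - j) * lc_d (of_nat j * s)))"
      unfolding sum_distrib_left
      by (intro sum.cong refl) (simp add: power_mult_distrib lc_d_power mult_ac)
    finally have "coef (a k * (y + of_real t * lc_d s) ^ k) q =
        (\<Sum>j\<le>k. real (k choose j) * t ^ j * coef (a k * y ^ (k - j)) (q - of_nat j * s))"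
      by (simp only: coef_sum coef_of_real_mult coef_mult_lc_d)
    also have "\<dots> = (\<Sum>j\<le>k. \<gamma> k j * t ^ j)"
      by (intro sum.cong refl) (simp add: \<gamma>_def)
    also have "\<dots> = (\<Sum>j\<le>max k J. \<gamma> k j * t ^ j)"
      by (intro sum.mono_neutral_left) (auto simp: \<gamma>_def)
    also have "\<dots> = (\<Sum>j\<le>J. \<gamma> k j * t ^ j)"
      by (intro sum.mono_neutral_right) (auto simp: \<gamma>0)
    finally show ?thesis .
  qed
  define G where "G n j = (\<Sum>k\<le>n. \<gamma> k j)" for n j
  have G: "(\<Sum>k\<le>n. \<Sum>j\<le>J. \<gamma> k j * t ^ j) = (\<Sum>j\<le>J. G n j * t ^ j)" for n t
    unfolding G_def sum_distrib_right by (rule sum.swap)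
  have "(\<lambda>n. G n 0) \<longlonglongrightarrow> coef c q"
  proof (rule bounded_degree_limit_at_0)
    fix t :: real assume t: "0 < t"
    let ?z = "of_real t * lc_d s"
    have "0 < ?z" using t of_real_less_lc_iff[of 0 t] by simp
    moreover have "?z < \<eta>"
      using Q[of ?z] s by (auto simp: vanish_upto_def)
    ultimately have "(\<lambda>k. coef (a k * (y + ?z) ^ k) q) sums coef c q"
      using ser[of ?z] c by (intro weak_sums_coef) simp
    then show "(\<lambda>n. \<Sum>j\<le>J. G n j * t ^ j) \<longlonglongrightarrow> coef c q"
      by (simp add: sums_def_le coef_term G)
  qed
  moreover have "(\<lambda>n. G n 0) \<longlonglongrightarrow> coef (g 0) q"
  proof -
    have "(\<lambda>k. coef (a k * (y + 0) ^ k) q) sums coef (g 0) q"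
      using ser[of 0] \<eta> by (intro weak_sums_coef) simp
    then show ?thesis
      by (simp add: sums_def_le G_def \<gamma>_def)
  qed
  ultimately show "coef (g 0) q = coef c q"
    by (rule LIMSEQ_unique[symmetric])
qed

text \<open>The sign \<open>\<sigma>\<close> selects the side of \<open>b\<close>. Reflection turns
  a left neighbourhood into a right one, with the sign absorbed into the coefficients as
  \<open>\<sigma> ^ k\<close>.\<close>

lemma power_series_no_jump:
  assumes ser: "lc_power_series_on X x0 a f" and \<eta>: "0 < \<eta>" and \<sigma>: "\<sigma> = 1 \<or> \<sigma> = - 1"
    and X: "\<And>z. 0 \<le> z \<Longrightarrow> z < \<eta> \<Longrightarrow> b + \<sigma> * z \<in> X"
    and c: "\<And>z. 0 < z \<Longrightarrow> z < \<eta> \<Longrightarrow> f (b + \<sigma> * z) = c"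
  shows "f b = c"
proof -
  define y where "y = \<sigma> * (b - x0)"
  define a' where "a' k = a k * \<sigma> ^ k" for k
  define g where "g z = f (b + \<sigma> * z)" for z
  have ss: "\<sigma> * \<sigma> = 1" using \<sigma> by auto
  have w: "weak_sums (\<lambda>k. a' k * (y + z) ^ k) (g z)" if "0 \<le> z" "z < \<eta>" for z
  proof -
    have "b + \<sigma> * z - x0 = \<sigma> * (y + z)"
      using ss by (simp add: y_def distrib_left mult.assoc[symmetric])
    then have "a k * (b + \<sigma> * z - x0) ^ k = a' k * (y + z) ^ k" for k
      by (simp add: a'_def power_mult_distrib mult.assoc)
    moreover have "weak_sums (\<lambda>k. a k * (b + \<sigma> * z - x0) ^ k) (f (b + \<sigma> * z))"
      using ser X[OF that] by (auto simp: lc_power_series_on_def)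
    ultimately show ?thesis by (simp only: g_def)
  qed
  have "g 0 = c"
  proof (cases "y = 0")
    case True
    show ?thesis
      by (rule no_jump_at_center[OF \<eta>, of a']) (use w True c in \<open>auto simp: g_def\<close>)
  next
    case False
    show ?thesis
      by (rule no_jump_off_center[OF \<eta> False, of a']) (use w c in \<open>auto simp: g_def\<close>)
  qed
  then show ?thesis by (simp add: g_def)
qed

section \<open>Step functions\<close>

text \<open>Step functions are described by finite sets of breakpoints; their values at the breakpoints are
  arbitrary.\<close>

definition lc_step :: "'a::linorder set \<Rightarrow> ('a \<Rightarrow> 'b) \<Rightarrow> bool" where
  "lc_step B f \<longleftrightarrow> finite B \<and> (\<forall>x y. x < y \<longrightarrow> {x..y} \<inter> B = {} \<longrightarrow> f x = f y)"

lemma ivl_set_convex: "x \<in> ivl_set I \<Longrightarrow> y \<in> ivl_set I \<Longrightarrow> x \<le> z \<Longrightarrow> z \<le> y \<Longrightarrow> z \<in> ivl_set I"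
  by (cases I) auto

text \<open>Walk from \<open>x\<close> towards \<open>y\<close>: at the first breakpoint neither the
  left nor the right side allows a jump, and the induction continues beyond it with one breakpoint
  fewer.\<close>

lemma step_simple_const_aux:
  assumes st: "lc_step B f" and si: "lc_simple f I"
    and "x \<in> ivl_set I" "y \<in> ivl_set I" "x < y"
  shows "f x = f y"
  using assms(3-)
proof (induction "card (B \<inter> {x..y})" arbitrary: x rule: less_induct)
  case less
  obtain x0 a where ser: "lc_power_series_on (ivl_set I) x0 a f"
    using si by (auto simp: lc_simple_def)
  have fin: "finite B" and const: "\<And>u v. u < v \<Longrightarrow> {u..v} \<inter> B = {} \<Longrightarrow> f u = f v"
    using st by (auto simp: lc_step_def)
  note conv = ivl_set_convex[OF less.prems(1,2)]
  show ?case
  proof (cases "B \<inter> {x..y} = {}")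
    case True
    with const[OF less.prems(3)] show ?thesis by blast
  next
    case False
    define b where "b = Min (B \<inter> {x..y})"
    have b: "b \<in> B" "x \<le> b" "b \<le> y" "\<And>b'. b' \<in> B \<Longrightarrow> x \<le> b' \<Longrightarrow> b' < b \<Longrightarrow> False"
    proof -
      have "b \<in> B \<inter> {x..y}" unfolding b_def using fin False by (intro Min_in) auto
      then show "b \<in> B" "x \<le> b" "b \<le> y" by auto
      fix b' assume "b' \<in> B" "x \<le> b'" "b' < b"
      moreover have "b \<le> b'" if "b' \<le> y" unfolding b_def using fin that \<open>b' \<in> B\<close> \<open>x \<le> b'\<close> by (intro Min_le) auto
      ultimately show False using \<open>b \<le> y\<close> by force
    qed
    have fb: "f x = f b"
    proof (cases "x = b")
      case False
      with b have xb: "x < b" by simp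
      have "f b = f x"
      proof (rule power_series_no_jump[OF ser, of "b - x" "- 1"])
        fix z assume z: "0 < z" "z < b - x"
        have "x < b + - 1 * z" "b + - 1 * z < b" using z by (auto simp: less_diff_eq add.commute)
        then show "f (b + - 1 * z) = f x"
          using b by (intro const[symmetric]) force+
      next
        fix z assume z: "0 \<le> z" "z < b - x"
        have "x \<le> b + - 1 * z" "b + - 1 * z \<le> b" using z by (auto simp: less_diff_eq add.commute)
        then show "b + - 1 * z \<in> ivl_set I" using b by (intro conv) auto
      qed (use xb in auto)
      then show ?thesis by simp
    qed simp
    show ?thesis
    proof (cases "b = y")
      case False
      with b have "b < y" by simp
      define b' where "b' = Min (insert y {c \<in> B. b < c})"
      have b': "b < b'" "b' \<le> y" "\<And>c. c \<in> B \<Longrightarrow> b < c \<Longrightarrow> c < b' \<Longrightarrow> False"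
        unfolding b'_def using fin \<open>b < y\<close> by auto
      \<comment> \<open>Past \<open>b\<close> but before the next breakpoint, so \<open>b\<close>
        drops out of the count and \<open>f\<close> is constant between \<open>b\<close> and
        \<open>w\<close>.\<close>
      obtain w where w: "b < w" "w < b'" using dense b'(1) by blast
      have "f b = f w"
      proof (rule power_series_no_jump[OF ser, of "w - b" 1])
        fix z assume z: "0 < z" "z < w - b"
        have "b < b + 1 * z" "b + 1 * z < w" using z by (auto simp: less_diff_eq add.commute)
        then show "f (b + 1 * z) = f w"
          using b' w by (intro const) force+
      next
        fix z assume z: "0 \<le> z" "z < w - b"
        have "b \<le> b + 1 * z" "b + 1 * z \<le> w" using z by (auto simp: less_diff_eq add.commute)
        then show "b + 1 * z \<in> ivl_set I" using b b' w by (intro conv) auto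
      qed (use w in auto)
      also have "f w = f y"
      proof (rule less.hyps)
        show "card (B \<inter> {w..y}) < card (B \<inter> {x..y})"
          using fin b w by (intro psubset_card_mono) force+
        show "w \<in> ivl_set I" using b b' w by (intro conv) auto
        show "w < y" using w b' by auto
      qed (use less.prems in auto)
      finally show ?thesis using fb by simp
    qed (use fb in simp)
  qed
qed

lemma step_simple_const:
  assumes "lc_step B f" "lc_simple f I"
  obtains c where "\<And>x. x \<in> ivl_set I \<Longrightarrow> f x = c"
proof (cases "ivl_set I = {}")
  case False
  then obtain y where "y \<in> ivl_set I" by auto
  with step_simple_const_aux[OF assms] have "f x = f y" if "x \<in> ivl_set I" for x
    using that by (metis neqE)
  then show thesis by (rule that)
qed (use that in auto)

lemma of_real_pos_lc_iff [simp]: "(0 :: levi_civita) < of_real x \<longleftrightarrow> 0 < x"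
  using of_real_less_lc_iff[of 0 x] by simp

lemma of_real_nonneg_lc_iff [simp]: "(0 :: levi_civita) \<le> of_real x \<longleftrightarrow> 0 \<le> x"
  using of_real_le_lc_iff[of 0 x] by simp

section \<open>Operations on step functions and their finite ranges\<close>

lemma lc_step_combine:
  "lc_step B f \<Longrightarrow> lc_step B' g \<Longrightarrow> lc_step (B \<union> B') (\<lambda>x. h (f x) (g x))"
  unfolding lc_step_def by (metis Int_Un_distrib Un_empty finite_UnI)

lemma lc_step_comp: "lc_step B f \<Longrightarrow> lc_step B (\<lambda>x. h (f x))"
  unfolding lc_step_def by metis

lemma lc_step_ivl: "lc_step {lo I, hi I} (\<lambda>x. x \<in> ivl_set I)"
  unfolding lc_step_def by (cases I) auto

lemma lc_step_const: "lc_step {} (\<lambda>_. c)"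
  by (simp add: lc_step_def)

lemma lc_step_gap:
  assumes "lc_step B f" "{x<..<y} \<inter> B = {}"
  obtains c where "\<And>z. x < z \<Longrightarrow> z < y \<Longrightarrow> f z = c"
proof -
  have "f z = f w" if "x < z" "z < w" "w < y" for z w
  proof -
    have "{z..w} \<subseteq> {x<..<y}" using that by auto
    then have "{z..w} \<inter> B = {}" using assms(2) by blast
    with assms(1) that show ?thesis by (simp add: lc_step_def)
  qed
  then have "f z = f w" if "x < z" "z < y" "x < w" "w < y" for z w
    using that by (metis neqE)
  then show thesis using that by (cases "\<exists>z. x < z \<and> z < y") blast+
qed

lemma finite_range_lc_step:
  assumes "lc_step B f"
  shows "finite (range f)"
proof -
  \<comment> \<open>Recording both strict and weak comparisons separates a breakpoint from its
    neighbours; distinct points with equal keys have no breakpoint between or at them.\<close>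
  define key where "key x = ({b \<in> B. b < x}, {b \<in> B. b \<le> x})" for x
  have fin: "finite B" using assms by (simp add: lc_step_def)
  have less: "f x = f y" if "key x = key y" "x < y" for x y
  proof -
    have "b \<notin> {x..y}" if "b \<in> B" for b
    proof
      assume "b \<in> {x..y}"
      then have "b \<in> {b \<in> B. b \<le> y}" using that by auto
      then have "b \<in> {b \<in> B. b \<le> x}" using \<open>key x = key y\<close> by (auto simp: key_def)
      with \<open>b \<in> {x..y}\<close> have "b = x" by auto
      then have "b \<in> {b \<in> B. b < y}" using that \<open>x < y\<close> by auto
      then have "b \<in> {b \<in> B. b < x}" using \<open>key x = key y\<close> by (auto simp: key_def)
      with \<open>b = x\<close> show False by simp
    qed
    then have "{x..y} \<inter> B = {}" by blast
    with assms \<open>x < y\<close> show ?thesis by (simp add: lc_step_def)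
  qed
  then have eq: "f x = f y" if "key x = key y" for x y
    using that by (metis neqE)
  have "f x = f (SOME y. key y = key x)" for x
    by (rule eq[OF someI[of "\<lambda>y. key y = key x" x, symmetric]]) simp
  then have "range f = (\<lambda>k. f (SOME y. key y = k)) ` range key"
    by (auto simp: image_iff)
  moreover have "range key \<subseteq> Pow B \<times> Pow B" by (auto simp: key_def)
  then have "finite (range key)" using fin finite_subset by blast
  ultimately show ?thesis by simp
qed

text \<open>The induction rule for all claims that are additive in the interval. A gap is free of
  breakpoints only in its interior; its ends may be breakpoints.\<close>

lemma split_at_breakpoints [consumes 2, case_names gap join]:
  fixes a b :: "'a::linorder"
  assumes "finite B" "a \<le> b"
    and "\<And>a b. a \<le> b \<Longrightarrow> {a<..<b} \<inter> B = {} \<Longrightarrow> Q a b"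
    and "\<And>a m b. a \<le> m \<Longrightarrow> m \<le> b \<Longrightarrow> Q a m \<Longrightarrow> Q m b \<Longrightarrow> Q a b"
  shows "Q a b"
  using assms(2)
proof (induction "card ({a<..<b} \<inter> B)" arbitrary: a b rule: less_induct)
  case less
  show ?case
  proof (cases "{a<..<b} \<inter> B = {}")
    case False
    then obtain m where m: "a < m" "m < b" "m \<in> B" by auto
    show ?thesis
    proof (rule assms(4)[of a m b])
      show "Q a m"
        using m assms(1) by (intro less.hyps psubset_card_mono) force+
      show "Q m b"
        using m assms(1) by (intro less.hyps psubset_card_mono) force+
    qed (use m in auto)
  qed (use assms(3) less in blast)
qed

section \<open>Antiderivatives of step functions\<close>

text \<open>Only increments over intervals with constant interior values are prescribed. This fixes
  the integral without choosing a partition and makes the values at breakpoints irrelevant.\<close>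

definition step_antideriv ::
    "(levi_civita \<Rightarrow> levi_civita) \<Rightarrow> levi_civita \<Rightarrow> levi_civita \<Rightarrow> (levi_civita \<Rightarrow> levi_civita) \<Rightarrow> bool" where
  "step_antideriv f a b G \<longleftrightarrow>
     (\<forall>x y c. a \<le> x \<longrightarrow> x \<le> y \<longrightarrow> y \<le> b \<longrightarrow> (\<forall>z. x < z \<longrightarrow> z < y \<longrightarrow> f z = c) \<longrightarrow> G y - G x = c * (y - x))"

lemma step_antiderivD:
  "step_antideriv f a b G \<Longrightarrow> a \<le> x \<Longrightarrow> x \<le> y \<Longrightarrow> y \<le> b \<Longrightarrow> (\<And>z. x < z \<Longrightarrow> z < y \<Longrightarrow> f z = c) \<Longrightarrow>
    G y - G x = c * (y - x)"
  by (auto simp: step_antideriv_def)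

lemma step_antideriv_const:
  assumes "\<And>z. a < z \<Longrightarrow> z < b \<Longrightarrow> f z = c"
  shows "step_antideriv f a b (\<lambda>x. c * x)"
  unfolding step_antideriv_def
proof (intro allI impI)
  fix x y c' assume xy: "a \<le> x" "x \<le> y" "y \<le> b" and c': "\<forall>z. x < z \<longrightarrow> z < y \<longrightarrow> f z = c'"
  show "c * y - c * x = c' * (y - x)"
  proof (cases "x = y")
    case False
    with xy obtain z where z: "x < z" "z < y" using dense[of x y] by auto
    then have "c = c'" using assms[of z] c' xy by auto
    then show ?thesis by (simp add: right_diff_distrib)
  qed simp
qed

lemma step_antideriv_exists:
  assumes "lc_step B f" "a \<le> b"
  shows "\<exists>G. step_antideriv f a b G"
proof -
  have "finite B" using assms by (simp add: lc_step_def)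
  then show ?thesis
    using assms(2)
  proof (induction rule: split_at_breakpoints)
    case (gap a b)
    obtain c where "\<And>z. a < z \<Longrightarrow> z < b \<Longrightarrow> f z = c" using lc_step_gap[OF assms(1) gap(2)] by blast
    then have "step_antideriv f a b (\<lambda>x. c * x)" by (rule step_antideriv_const)
    then show ?case by blast
  next
    case (join a m b)
    then obtain G1 G2 where G1: "step_antideriv f a m G1" and G2: "step_antideriv f m b G2" by blast
    define G where "G x = (if x \<le> m then G1 x else G2 x - G2 m + G1 m)" for x
    have G': "G x = G2 x - G2 m + G1 m" if "m \<le> x" for x using that by (auto simp: G_def)
    have "step_antideriv f a b G"
      unfolding step_antideriv_def
    proof (intro allI impI)
      fix x y c assume xy: "a \<le> x" "x \<le> y" "y \<le> b" and c: "\<forall>z. x < z \<longrightarrow> z < y \<longrightarrow> f z = c"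
      consider "y \<le> m" | "m \<le> x" | "x < m" "m < y" by linarith
      then show "G y - G x = c * (y - x)"
      proof cases
        case 1
        then show ?thesis using step_antiderivD[OF G1, of x y c] xy c by (simp add: G_def)
      next
        case 2
        then show ?thesis using step_antiderivD[OF G2, of x y c] xy c by (simp add: G')
      next
        case 3
        have "G1 m - G1 x = c * (m - x)"
          by (rule step_antiderivD[OF G1]) (use 3 xy c in auto)
        moreover have "G2 y - G2 m = c * (y - m)"
          by (rule step_antiderivD[OF G2]) (use 3 xy c in auto)
        moreover have "G y - G x = (G1 m - G1 x) + (G2 y - G2 m)"
          using 3 by (simp add: G_def)
        ultimately show ?thesis by (simp add: algebra_simps)
      qed
    qed
    then show ?case by blast
  qed
qed

lemma step_antideriv_mono:
  assumes st: "lc_step B f" and G: "step_antideriv f a b G"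
    and nn: "\<And>z. a < z \<Longrightarrow> z < b \<Longrightarrow> 0 \<le> f z" and xy: "a \<le> x" "x \<le> y" "y \<le> b"
  shows "G x \<le> G y"
proof -
  have "finite B" using st by (simp add: lc_step_def)
  then have "a \<le> x \<longrightarrow> y \<le> b \<longrightarrow> G x \<le> G y"
    using xy(2)
  proof (induction rule: split_at_breakpoints)
    case (gap x y)
    show ?case
    proof (cases "x = y")
      case False
      with gap have "x < y" by simp
      show ?thesis
      proof (intro impI)
        assume ab: "a \<le> x" "y \<le> b"
        obtain c where c: "\<And>z. x < z \<Longrightarrow> z < y \<Longrightarrow> f z = c" using lc_step_gap[OF st gap(2)] by blast
        obtain z where z: "x < z" "z < y" using dense \<open>x < y\<close> by blast
        have "0 \<le> c" using c[OF z] nn[of z] z ab by auto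
        moreover have "G y - G x = c * (y - x)"
          by (rule step_antiderivD[OF G]) (use ab gap c in auto)
        ultimately have "0 \<le> G y - G x" using gap(1) by simp
        then show "G x \<le> G y" by simp
      qed
    qed simp
  next
    case (join x m y)
    then show ?case by (meson order_trans)
  qed
  then show ?thesis using xy by simp
qed

text \<open>On a nondegenerate gap the constant value must be 0, since by density another value
  would produce infinitely many exceptions.\<close>

lemma step_antideriv_null:
  assumes st: "lc_step B f" and G: "step_antideriv f a b G"
    and fin: "finite {z. a < z \<and> z < b \<and> f z \<noteq> 0}" and ab: "a \<le> b"
  shows "G a = G b"
proof -
  have "finite B" using st by (simp add: lc_step_def)
  then have "a \<le> x \<longrightarrow> y \<le> b \<longrightarrow> G x = G y" if "x \<le> y" for x y
    using that
  proof (induction rule: split_at_breakpoints)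
    case (gap x y)
    show ?case
    proof (cases "x = y")
      case False
      with gap have "x < y" by simp
      show ?thesis
      proof (intro impI)
        assume ab: "a \<le> x" "y \<le> b"
        obtain c where c: "\<And>z. x < z \<Longrightarrow> z < y \<Longrightarrow> f z = c" using lc_step_gap[OF st gap(2)] by blast
        have "c = 0"
        proof (rule ccontr)
          assume "c \<noteq> 0"
          then have "{x<..<y} \<subseteq> {z. a < z \<and> z < b \<and> f z \<noteq> 0}" using c ab by auto
          with fin have "finite {x<..<y}" by (rule finite_subset[rotated])
          with infinite_Ioo[OF \<open>x < y\<close>] show False by simp
        qed
        moreover have "G y - G x = c * (y - x)"
          by (rule step_antiderivD[OF G]) (use ab gap c in auto)
        ultimately show "G x = G y" by simp
      qed
    qed simp
  next
    case (join x m y)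
    then show ?case by (metis order_trans)
  qed
  with ab show ?thesis by simp
qed

section \<open>Families of disjoint intervals\<close>

lemma ivl_set_subset_closed: "ivl_set I \<subseteq> {lo I..hi I}"
  by (cases I) auto

lemma open_subset_ivl_set: "{lo I<..<hi I} \<subseteq> ivl_set I"
  by (cases I) auto

lemma ivl_subset_bounds:
  fixes I :: "'a::dense_linorder ivl"
  assumes "ivl_set I \<subseteq> {a..b}" "lo I < hi I"
  shows "a \<le> lo I" "hi I \<le> b"
proof -
  have "{lo I<..<hi I} \<subseteq> {a..b}" using assms open_subset_ivl_set by blast
  with assms(2) show "a \<le> lo I" "hi I \<le> b"
    by (auto simp: greaterThanLessThan_subseteq_atLeastAtMost_iff)
qed

lemma disjoint_ivls_ordered:
  fixes I J :: "'a::dense_linorder ivl"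
  assumes "ivl_set I \<inter> ivl_set J = {}" "lo I < hi I" "lo J < hi J"
  shows "hi I \<le> lo J \<or> hi J \<le> lo I"
proof (rule ccontr)
  assume "\<not> ?thesis"
  with assms have "max (lo I) (lo J) < min (hi I) (hi J)" by auto
  then obtain z where "max (lo I) (lo J) < z" "z < min (hi I) (hi J)" using dense by blast
  then have "z \<in> ivl_set I \<inter> ivl_set J" using open_subset_ivl_set by fastforce
  with assms show False by blast
qed

text \<open>Remove the interval with the greatest left end; all others end before it starts, so the
  induction hypothesis applies with that left end in place of \<open>b\<close>.\<close>

lemma sum_ordered_ivls_le:
  fixes H :: "'a::dense_linorder \<Rightarrow> 'b::linordered_idom"
  assumes "finite F" "a \<le> b" "\<And>x y. a \<le> x \<Longrightarrow> x \<le> y \<Longrightarrow> y \<le> b \<Longrightarrow> H x \<le> H y"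
    and "\<And>n. n \<in> F \<Longrightarrow> a \<le> l n \<and> l n < h n \<and> h n \<le> b"
    and "\<And>n m. n \<in> F \<Longrightarrow> m \<in> F \<Longrightarrow> n \<noteq> m \<Longrightarrow> h n \<le> l m \<or> h m \<le> l n"
  shows "(\<Sum>n\<in>F. H (h n) - H (l n)) \<le> H b - H a"
  using assms
proof (induction "card F" arbitrary: F b)
  case 0
  then show ?case by simp
next
  case (Suc N)
  then have "F \<noteq> {}" by auto
  then have "Max (l ` F) \<in> l ` F" using Suc.prems by (intro Max_in) auto
  then obtain n where n: "n \<in> F" "l n = Max (l ` F)" by auto
  have mx: "l m \<le> l n" if "m \<in> F" for m
    unfolding n(2) using Suc.prems that by (intro Max_ge) auto
  have n': "a \<le> l n" "l n < h n" "h n \<le> b" using Suc.prems n by blast+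
  have "(\<Sum>m\<in>F - {n}. H (h m) - H (l m)) \<le> H (l n) - H a"
  proof (rule Suc.hyps(1))
    show "N = card (F - {n})" using Suc.hyps n Suc.prems by simp
    show "a \<le> l m \<and> l m < h m \<and> h m \<le> l n" if "m \<in> F - {n}" for m
      using Suc.prems(4)[of m] Suc.prems(5)[of m n] mx[of m] that n(1) n' by fastforce
    show "h m \<le> l k \<or> h k \<le> l m" if "m \<in> F - {n}" "k \<in> F - {n}" "m \<noteq> k" for m k
      using that Suc.prems by blast
    show "H x \<le> H y" if "a \<le> x" "x \<le> y" "y \<le> l n" for x y
      using that n' by (intro Suc.prems(3)) auto
  qed (use Suc.prems n' in auto)
  moreover have "(\<Sum>n\<in>F. H (h n) - H (l n)) = (H (h n) - H (l n)) + (\<Sum>m\<in>F - {n}. H (h m) - H (l m))"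
    using Suc.prems n by (intro sum.remove) auto
  moreover have "H (h n) \<le> H b" using Suc.prems(3)[of "h n" b] n' by auto
  ultimately show ?case by (simp add: algebra_simps)
qed

lemma sum_disjoint_ivls_le:
  fixes H :: "levi_civita \<Rightarrow> levi_civita"
  assumes I: "disjoint_ivls I" "\<And>n. ivl_set (I n) \<subseteq> {a..b}" and ab: "a \<le> b"
    and H: "\<And>x y. a \<le> x \<Longrightarrow> x \<le> y \<Longrightarrow> y \<le> b \<Longrightarrow> H x \<le> H y"
  shows "(\<Sum>n<N. H (hi (I n)) - H (lo (I n))) \<le> H b - H a"
proof -
  \<comment> \<open>Degenerate intervals contribute 0 and are dropped first: an empty one may sit
    outside \<open>{a..b}\<close>, where \<open>H\<close> is not known to be monotone.\<close>
  let ?F = "{n. n < N \<and> lo (I n) < hi (I n)}"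
  have le: "lo (I n) \<le> hi (I n)" and disj: "n \<noteq> m \<Longrightarrow> ivl_set (I n) \<inter> ivl_set (I m) = {}" for n m
    using I(1) by (auto simp: disjoint_ivls_def disjoint_family_on_def)
  have "(\<Sum>n<N. H (hi (I n)) - H (lo (I n))) = (\<Sum>n\<in>?F. H (hi (I n)) - H (lo (I n)))"
    using le by (intro sum.mono_neutral_right) (auto simp: less_le)
  also have "\<dots> \<le> H b - H a"
  proof (rule sum_ordered_ivls_le[where l = "\<lambda>n. lo (I n)" and h = "\<lambda>n. hi (I n)"])
    show "a \<le> lo (I n) \<and> lo (I n) < hi (I n) \<and> hi (I n) \<le> b" if "n \<in> ?F" for n
      using that ivl_subset_bounds[OF I(2)] by auto
    show "hi (I n) \<le> lo (I m) \<or> hi (I m) \<le> lo (I n)" if "n \<in> ?F" "m \<in> ?F" "n \<noteq> m" for n m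
      using disjoint_ivls_ordered[OF disj] that by auto
  qed (use ab H in auto)
  finally show ?thesis .
qed

text \<open>The pieces cover the half-open range from \<open>a\<close> to \<open>b\<close>, so that
  partitions of adjacent intervals are disjoint and can be appended. The last point is added in
  \<open>step_set_families\<close>.\<close>

lemma step_partition:
  assumes st: "lc_step B (\<lambda>x. (f x, P x))"
    and G: "step_antideriv (\<lambda>x. if P x then 1 else 0) a b G" and ab: "a \<le> b"
  shows "\<exists>xs. (\<forall>J\<in>set xs. lo J \<le> hi J \<and> (\<exists>c. \<forall>z\<in>ivl_set J. f z = c)) \<and>
    sorted_wrt (\<lambda>I J. ivl_set I \<inter> ivl_set J = {}) xs \<and>
    (\<Union>J\<in>set xs. ivl_set J) = {z. a \<le> z \<and> z < b \<and> P z} \<and>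
    sum_list (map ivl_length xs) = G b - G a"
    (is "?Q a b")
proof -
  have "finite B" using st by (simp add: lc_step_def)
  then have "a \<le> x \<longrightarrow> y \<le> b \<longrightarrow> ?Q x y" if "x \<le> y" for x y
    using that
  proof (induction rule: split_at_breakpoints)
    case (gap x y)
    show ?case
    proof (intro impI)
      assume ab: "a \<le> x" "y \<le> b"
      show "?Q x y"
      proof (cases "x = y")
        case True
        then show ?thesis by (intro exI[of _ "[]"]) auto
      next
        case False
        with gap have "x < y" by simp
        obtain c where "\<And>z. x < z \<Longrightarrow> z < y \<Longrightarrow> (f z, P z) = c"
          using lc_step_gap[OF st gap(2)] by blast
        then have c: "f z = fst c" "P z = snd c" if "x < z" "z < y" for z
          using that by force+
        \<comment> \<open>The left end needs its own piece, since the value there is unrelated to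
          the value on the gap.\<close>
        define xs where "xs = (if P x then [Closed_ivl x x] else []) @ (if snd c then [Open_ivl x y] else [])"
        have "G y - G x = (if snd c then 1 else 0) * (y - x)"
          by (rule step_antiderivD[OF G]) (use ab gap c in auto)
        then have "sum_list (map ivl_length xs) = G y - G x"
          by (auto simp: xs_def ivl_length_def)
        moreover have "(\<Union>J\<in>set xs. ivl_set J) = {z. x \<le> z \<and> z < y \<and> P z}"
          using c \<open>x < y\<close> by (auto simp: xs_def le_less)
        moreover have "\<forall>J\<in>set xs. lo J \<le> hi J \<and> (\<exists>c. \<forall>z\<in>ivl_set J. f z = c)"
          using c \<open>x < y\<close> by (fastforce simp: xs_def)
        moreover have "sorted_wrt (\<lambda>I J. ivl_set I \<inter> ivl_set J = {}) xs"
          by (auto simp: xs_def)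
        ultimately show ?thesis by blast
      qed
    qed
  next
    case (join x m y)
    show ?case
    proof (intro impI)
      assume "a \<le> x" "y \<le> b"
      with join obtain xs ys where
        xs: "\<forall>J\<in>set xs. lo J \<le> hi J \<and> (\<exists>c. \<forall>z\<in>ivl_set J. f z = c)"
          "sorted_wrt (\<lambda>I J. ivl_set I \<inter> ivl_set J = {}) xs"
          "(\<Union>J\<in>set xs. ivl_set J) = {z. x \<le> z \<and> z < m \<and> P z}"
          "sum_list (map ivl_length xs) = G m - G x" and
        ys: "\<forall>J\<in>set ys. lo J \<le> hi J \<and> (\<exists>c. \<forall>z\<in>ivl_set J. f z = c)"
          "sorted_wrt (\<lambda>I J. ivl_set I \<inter> ivl_set J = {}) ys"
          "(\<Union>J\<in>set ys. ivl_set J) = {z. m \<le> z \<and> z < y \<and> P z}"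
          "sum_list (map ivl_length ys) = G y - G m"
        by (meson order_trans)
      have "ivl_set I \<inter> ivl_set J = {}" if "I \<in> set xs" "J \<in> set ys" for I J
      proof -
        have "ivl_set I \<subseteq> {z. x \<le> z \<and> z < m \<and> P z}" "ivl_set J \<subseteq> {z. m \<le> z \<and> z < y \<and> P z}"
          using that xs(3) ys(3) by blast+
        then show ?thesis by force
      qed
      then have "sorted_wrt (\<lambda>I J. ivl_set I \<inter> ivl_set J = {}) (xs @ ys)"
        using xs(2) ys(2) by (simp add: sorted_wrt_append)
      moreover have "(\<Union>J\<in>set (xs @ ys). ivl_set J) = {z. x \<le> z \<and> z < y \<and> P z}"
        using xs(3) ys(3) join(1,2) by (auto simp: UN_Un)
      ultimately show "?Q x y"
        using xs(1,4) ys(1,4) by (intro exI[of _ "xs @ ys"]) auto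
    qed
  qed
  with ab show ?thesis by simp
qed

text \<open>A bounded step set is a finite disjoint union of intervals, so a single family serves as
  inner and as outer one. Constancy of \<open>f\<close> on its members makes \<open>f\<close> simple
  there.\<close>

lemma step_set_families:
  assumes st: "lc_step B (\<lambda>x. (f x, P x))"
    and G: "step_antideriv (\<lambda>x. if P x then 1 else 0) a b G" and ab: "a \<le> b"
    and P: "{x. P x} \<subseteq> {a..b}"
  obtains I where "inner_ivls {x. P x} I (G b - G a)" "outer_ivls {x. P x} I (G b - G a)"
    "\<And>n. \<exists>c. \<forall>z\<in>ivl_set (I n). f z = c"
proof -
  obtain xs where
    xs: "\<forall>J\<in>set xs. lo J \<le> hi J \<and> (\<exists>c. \<forall>z\<in>ivl_set J. f z = c)"
      "sorted_wrt (\<lambda>I J. ivl_set I \<inter> ivl_set J = {}) xs"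
      "(\<Union>J\<in>set xs. ivl_set J) = {z. a \<le> z \<and> z < b \<and> P z}"
      "sum_list (map ivl_length xs) = G b - G a"
    using step_partition[OF st G ab] by blast
  define ys where "ys = xs @ (if P b then [Closed_ivl b b] else [])"
  have "(\<Union>J\<in>set ys. ivl_set J) = (\<Union>J\<in>set xs. ivl_set J) \<union> (if P b then {b} else {})"
    by (auto simp: ys_def)
  then have Un: "(\<Union>J\<in>set ys. ivl_set J) = {x. P x}"
    unfolding xs(3) using P ab by (auto simp: le_less)
  have "b \<notin> ivl_set J" if "J \<in> set xs" for J
    using that xs(3) by blast
  then have srt: "sorted_wrt (\<lambda>I J. ivl_set I \<inter> ivl_set J = {}) ys"
    using xs(2) by (auto simp: ys_def sorted_wrt_append)
  have ys: "\<forall>J\<in>set ys. lo J \<le> hi J \<and> (\<exists>c. \<forall>z\<in>ivl_set J. f z = c)"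
    "sum_list (map ivl_length ys) = G b - G a"
    using xs(1,4) by (auto simp: ys_def ivl_length_def)
  define I where "I n = (if n < length ys then ys ! n else Open_ivl 0 0)" for n
  have "disjoint_ivls I"
    unfolding disjoint_ivls_def disjoint_family_on_def
  proof (intro conjI allI ballI impI)
    show "lo (I n) \<le> hi (I n)" for n using ys(1) by (auto simp: I_def)
    fix m n :: nat assume "m \<noteq> n"
    have "ivl_set (I i) \<inter> ivl_set (I j) = {}" if "i < j" for i j
      using that srt by (auto simp: I_def sorted_wrt_iff_nth_less)
    then show "ivl_set (I m) \<inter> ivl_set (I n) = {}"
      using \<open>m \<noteq> n\<close> by (metis neqE inf_commute)
  qed
  moreover have "(\<Union>n. ivl_set (I n)) = {x. P x}"
  proof -
    have "(\<Union>n. ivl_set (I n)) = (\<Union>n<length ys. ivl_set (ys ! n))"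
      by (auto simp: I_def split: if_splits)
    also have "\<dots> = (\<Union>J\<in>set ys. ivl_set J)"
      by (auto simp: set_conv_nth)
    finally show ?thesis using Un by simp
  qed
  moreover have "strong_sums (\<lambda>n. ivl_length (I n)) (G b - G a)"
    unfolding strong_sums_def
  proof (rule strong_lim_eventually_const)
    fix n assume "n \<ge> length ys"
    then have "(\<Sum>k<n. ivl_length (I k)) = (\<Sum>k<length ys. ivl_length (ys ! k))"
      by (intro sum.mono_neutral_cong_right) (auto simp: I_def ivl_length_def)
    also have "\<dots> = G b - G a"
      unfolding ys(2)[symmetric] by (simp add: sum_list_sum_nth atLeast0LessThan)
    finally show "(\<Sum>k<n. ivl_length (I k)) = G b - G a" .
  qed
  moreover have "\<exists>c. \<forall>z\<in>ivl_set (I n). f z = c" for n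
    using ys(1) by (auto simp: I_def)
  ultimately show thesis
    by (intro that[of I]) (auto simp: inner_ivls_def outer_ivls_def)
qed

section \<open>Measure of step sets and measurability of step functions\<close>

text \<open>The length of an interval inside the set equals the increment of \<open>G\<close>, and
  \<open>G\<close> is monotone because an indicator is nonnegative.\<close>

lemma inner_sum_le_step_measure:
  assumes st: "lc_step B P" and G: "step_antideriv (\<lambda>x. if P x then 1 else 0) a b G" and ab: "a \<le> b"
    and P: "{x. P x} \<subseteq> {a..b}" and I: "inner_ivls {x. P x} I s"
  shows "s \<le> G b - G a"
proof -
  have sums: "strong_sums (\<lambda>n. ivl_length (I n)) s" and dj: "disjoint_ivls I"
    and sub: "\<And>n. ivl_set (I n) \<subseteq> {x. P x}"
    using I by (auto simp: inner_ivls_def)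
  have le: "lo (I n) \<le> hi (I n)" for n using dj by (auto simp: disjoint_ivls_def)
  have len: "ivl_length (I n) = G (hi (I n)) - G (lo (I n))" for n
  proof (cases "lo (I n) = hi (I n)")
    case False
    with le[of n] have n: "lo (I n) < hi (I n)" by simp
    have "ivl_set (I n) \<subseteq> {a..b}" using sub P by blast
    note bd = ivl_subset_bounds[OF this n]
    have "G (hi (I n)) - G (lo (I n)) = 1 * (hi (I n) - lo (I n))"
      by (rule step_antiderivD[OF G]) (use bd n sub[of n] open_subset_ivl_set[of "I n"] in auto)
    then show ?thesis by (simp add: ivl_length_def)
  qed (simp add: ivl_length_def)
  show ?thesis
  proof (rule strong_sums_le[OF sums])
    fix n
    have "(\<Sum>k<n. G (hi (I k)) - G (lo (I k))) \<le> G b - G a"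
    proof (rule sum_disjoint_ivls_le[OF dj _ ab])
      show "ivl_set (I k) \<subseteq> {a..b}" for k using sub P by blast
      show "G x \<le> G y" if "a \<le> x" "x \<le> y" "y \<le> b" for x y
        by (rule step_antideriv_mono[OF lc_step_comp[OF st] G _ that]) auto
    qed
    then show "(\<Sum>k<n. ivl_length (I k)) \<le> G b - G a" by (simp add: len)
  qed
qed

lemma step_set_measure:
  assumes st: "lc_step B P" and G: "step_antideriv (\<lambda>x. if P x then 1 else 0) a b G" and ab: "a \<le> b"
    and P: "{x. P x} \<subseteq> {a..b}"
  shows "lc_measurable {x. P x}" "lc_measure {x. P x} = G b - G a"
proof -
  obtain I where I: "inner_ivls {x. P x} I (G b - G a)" "outer_ivls {x. P x} I (G b - G a)"
    by (rule step_set_families[OF lc_step_comp[OF st, of "\<lambda>p. ((), p)"] G ab P])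
  show "lc_measurable {x. P x}"
    unfolding lc_measurable_def
  proof (intro allI impI)
    fix e :: levi_civita assume "0 < e"
    then show "\<exists>I J s t. inner_ivls {x. P x} I s \<and> outer_ivls {x. P x} J t \<and> t - s \<le> e"
      using I by (intro exI[of _ I] exI[of _ "G b - G a"]) auto
  qed
  have "isLub UNIV {s. \<exists>I. inner_ivls {x. P x} I s} (G b - G a)"
    unfolding isLub_def leastP_def isUb_def setle_def setge_def
    using inner_sum_le_step_measure[OF st G ab P] I(1) by blast
  then show "lc_measure {x. P x} = G b - G a"
    unfolding lc_measure_def by (intro the_equality) (auto intro: isLub_unique)
qed

lemma ivl_antideriv:
  "step_antideriv (\<lambda>x. if x \<in> ivl_set K then 1 else 0) (lo K) (hi K) (\<lambda>x. x)"
proof -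
  have "(if z \<in> ivl_set K then 1 else 0) = 1" if "lo K < z" "z < hi K" for z
    using that open_subset_ivl_set[of K] by auto
  from step_antideriv_const[of "lo K" "hi K" "\<lambda>x. if x \<in> ivl_set K then 1 else 0" 1, OF this]
  show ?thesis by simp
qed

lemma ivl_measure:
  assumes "lo K \<le> hi K"
  shows "lc_measurable (ivl_set K)" "lc_measure (ivl_set K) = hi K - lo K"
  using step_set_measure[OF lc_step_ivl ivl_antideriv assms] ivl_set_subset_closed[of K] by auto

lemma weak_sums_single:
  assumes "\<And>k. k \<noteq> m \<Longrightarrow> v k = 0"
  shows "weak_sums v (v m)"
proof -
  have "(\<Sum>k\<le>n. v k) = v m" if "n \<ge> m" for n
    using assms that by (subst sum.mono_neutral_right[of _ "{m}"]) auto
  then show ?thesis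
    unfolding weak_sums_def weak_lim_def by (auto simp: eventually_sequentially weakly_small_def intro!: exI[of _ m])
qed

lemma power_series_const:
  assumes "\<And>z. z \<in> X \<Longrightarrow> f z = c"
  shows "lc_power_series_on X 0 (\<lambda>k. if k = 0 then c else 0) f"
  unfolding lc_power_series_on_def
proof
  fix x assume "x \<in> X"
  then show "weak_sums (\<lambda>k. (if k = 0 then c else 0) * (x - 0) ^ k) (f x)"
    using weak_sums_single[of 0 "\<lambda>k. (if k = 0 then c else 0) * x ^ k"] assms by simp
qed

lemma lc_simple_const: "(\<And>z. z \<in> ivl_set J \<Longrightarrow> f z = c) \<Longrightarrow> lc_simple f J"
  unfolding lc_simple_def using power_series_const by blast

lemma step_measurable_fun:
  assumes "lo K \<le> hi K" "lc_step B f"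
  shows "lc_measurable_fun (ivl_set K) f"
proof -
  have st: "lc_step (B \<union> {lo K, hi K}) (\<lambda>x. (f x, x \<in> ivl_set K))"
    by (rule lc_step_combine[OF assms(2) lc_step_ivl])
  obtain I where I: "inner_ivls {x. x \<in> ivl_set K} I (hi K - lo K)"
    "\<And>n. \<exists>c. \<forall>z\<in>ivl_set (I n). f z = c"
    by (rule step_set_families[OF st ivl_antideriv assms(1)]) (use ivl_set_subset_closed[of K] in auto)
  have "lc_simple f (I n)" for n
    using I(2)[of n] lc_simple_const by blast
  then show ?thesis
    unfolding lc_measurable_fun_def using ivl_measure[OF assms(1)] I(1)
    by (auto intro!: exI[of _ I] exI[of _ "hi K - lo K"])
qed

lemma step_ae:
  assumes K: "lo K \<le> hi K" and st: "lc_step B P"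
  shows step_ae_finite_exceptions: "finite {x \<in> ivl_set K. \<not> P x} \<Longrightarrow> lc_ae (ivl_set K) P"
    and step_not_ae: "u < v \<Longrightarrow> {u<..<v} \<subseteq> ivl_set K \<Longrightarrow> (\<And>x. u < x \<Longrightarrow> x < v \<Longrightarrow> \<not> P x) \<Longrightarrow>
      \<not> lc_ae (ivl_set K) P"
proof -
  define S where "S x \<longleftrightarrow> x \<in> ivl_set K \<and> P x" for x
  have stS: "lc_step ({lo K, hi K} \<union> B) S"
    unfolding S_def by (rule lc_step_combine[OF lc_step_ivl st])
  obtain G where G: "step_antideriv (\<lambda>x. if S x then 1 else 0) (lo K) (hi K) G"
    using step_antideriv_exists[OF lc_step_comp[OF stS, of "\<lambda>p. if p then 1 else 0"] K] by blast
  have "{x. S x} \<subseteq> {lo K..hi K}" using ivl_set_subset_closed[of K] by (auto simp: S_def)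
  note m = step_set_measure[OF stS G K this]
  have eq: "{x \<in> ivl_set K. P x} = {x. S x}" by (simp add: S_def)
  have ae: "lc_ae (ivl_set K) P \<longleftrightarrow> hi K - G (hi K) = lo K - G (lo K)"
    unfolding lc_ae_def eq using m ivl_measure[OF K] by (auto simp: algebra_simps)
  define k :: "levi_civita \<Rightarrow> levi_civita" where "k x = (if S x then 0 else 1)" for x
  have stk: "lc_step ({lo K, hi K} \<union> B) k" unfolding k_def by (rule lc_step_comp[OF stS])
  \<comment> \<open>An antiderivative of the indicator of the exceptional set: the property holds
    almost everywhere iff it takes equal values at both ends.\<close>
  have H: "step_antideriv k (lo K) (hi K) (\<lambda>x. x - G x)"
    unfolding step_antideriv_def
  proof (intro allI impI)
    fix x y c assume xy: "lo K \<le> x" "x \<le> y" "y \<le> hi K" and c: "\<forall>z. x < z \<longrightarrow> z < y \<longrightarrow> k z = c"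
    have "G y - G x = (1 - c) * (y - x)"
      by (rule step_antiderivD[OF G xy]) (use c in \<open>auto simp: k_def\<close>)
    then show "y - G y - (x - G x) = c * (y - x)" by (simp add: algebra_simps)
  qed
  show "lc_ae (ivl_set K) P" if "finite {x \<in> ivl_set K. \<not> P x}"
  proof -
    have "{z. lo K < z \<and> z < hi K \<and> k z \<noteq> 0} \<subseteq> {x \<in> ivl_set K. \<not> P x}"
      using open_subset_ivl_set[of K] by (auto simp: k_def S_def)
    from step_antideriv_null[OF stk H finite_subset[OF this that] K] show ?thesis
      by (simp add: ae)
  qed
  show "\<not> lc_ae (ivl_set K) P" if uv: "u < v" "{u<..<v} \<subseteq> ivl_set K" "\<And>x. u < x \<Longrightarrow> x < v \<Longrightarrow> \<not> P x"
  proof -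
    have "{u<..<v} \<subseteq> {lo K..hi K}" using uv(2) ivl_set_subset_closed[of K] by blast
    with uv(1) have b: "lo K \<le> u" "v \<le> hi K"
      by (auto simp: greaterThanLessThan_subseteq_atLeastAtMost_iff)
    have mono: "x - G x \<le> y - G y" if "lo K \<le> x" "x \<le> y" "y \<le> hi K" for x y
      by (rule step_antideriv_mono[OF stk H _ that]) (auto simp: k_def)
    have "v - G v - (u - G u) = 1 * (v - u)"
      by (rule step_antiderivD[OF H]) (use b uv in \<open>auto simp: k_def S_def\<close>)
    with uv(1) have "u - G u < v - G v" by (simp add: algebra_simps)
    moreover have "lo K - G (lo K) \<le> u - G u" "v - G v \<le> hi K - G (hi K)"
      using mono[of "lo K" u] mono[of v "hi K"] b uv(1) by auto
    ultimately show ?thesis unfolding ae by auto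
  qed
qed

text \<open>A smaller bound would fail on a whole open interval, hence on positive measure, and
  finitely many points have measure 0. So \<open>N\<close> is the least admissible bound, and the
  infimum exists although the field is not complete in the order sense.\<close>

lemma step_norm_inf:
  assumes K: "lo K \<le> hi K" and st: "lc_step B f"
    and uv: "u < v" "{u<..<v} \<subseteq> ivl_set K" "\<And>x. u < x \<Longrightarrow> x < v \<Longrightarrow> \<bar>f x\<bar> = N"
    and fin: "finite {x \<in> ivl_set K. N < \<bar>f x\<bar>}"
  shows "has_lc_norm \<infinity> (ivl_set K) f N"
proof -
  have st': "lc_step B (\<lambda>x. \<bar>f x\<bar> \<le> c)" for c by (rule lc_step_comp[OF st])
  have "N \<le> c" if "lc_ae (ivl_set K) (\<lambda>x. \<bar>f x\<bar> \<le> c)" for c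
    using step_not_ae[OF K st' uv(1,2), of c] uv(3) that by (metis not_le)
  moreover have "lc_ae (ivl_set K) (\<lambda>x. \<bar>f x\<bar> \<le> N)"
    using fin by (intro step_ae_finite_exceptions[OF K st']) (simp add: not_le)
  ultimately have "isGlb UNIV {c. lc_ae (ivl_set K) (\<lambda>x. \<bar>f x\<bar> \<le> c)} N"
    by (auto simp: isGlb_def greatestP_def isLb_def setle_def setge_def)
  then show ?thesis
    using step_measurable_fun[OF K st] by (auto simp: has_lc_norm_def lc_Lp_def)
qed

text \<open>Weak norm convergence demands that every member has a norm, including early ones for
  which no formula is at hand. Here the norm is the largest of the finitely many values taken on
  open intervals.\<close>

lemma step_norm_inf_exists:
  assumes K: "lo K < hi K" and st: "lc_step B f"
  shows "\<exists>N. has_lc_norm \<infinity> (ivl_set K) f N"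
proof -
  define V where "V = {c. \<exists>u v. u < v \<and> {u<..<v} \<subseteq> ivl_set K \<and> (\<forall>x. u < x \<longrightarrow> x < v \<longrightarrow> \<bar>f x\<bar> = c)}"
  have "V \<subseteq> abs ` range f"
  proof
    fix c assume "c \<in> V"
    then obtain u v where uv: "u < v" "\<forall>x. u < x \<longrightarrow> x < v \<longrightarrow> \<bar>f x\<bar> = c" by (auto simp: V_def)
    then obtain x where "u < x" "x < v" using dense by blast
    with uv show "c \<in> abs ` range f" by force
  qed
  then have finV: "finite V"
    using finite_range_lc_step[OF st] finite_subset by blast
  have finB: "finite B" using st by (simp add: lc_step_def)
  have inV: "\<bar>f x\<bar> \<in> V" if x: "lo K < x" "x < hi K" "x \<notin> B" for x
  proof -
    define u where "u = Max (insert (lo K) {b \<in> B. b < x})"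
    define v where "v = Min (insert (hi K) {b \<in> B. x < b})"
    have u: "u < x" "lo K \<le> u" "\<And>b. b \<in> B \<Longrightarrow> b < x \<Longrightarrow> b \<le> u"
      using finB x by (auto simp: u_def)
    have v: "x < v" "v \<le> hi K" "\<And>b. b \<in> B \<Longrightarrow> x < b \<Longrightarrow> v \<le> b"
      using finB x by (auto simp: v_def)
    have "b \<notin> {u<..<v}" if "b \<in> B" for b
      using u(3)[OF that] v(3)[OF that] x(3) that by (cases b x rule: linorder_cases) auto
    then have "{u<..<v} \<inter> B = {}" by blast
    then obtain c where c: "\<And>z. u < z \<Longrightarrow> z < v \<Longrightarrow> f z = c"
      using lc_step_gap[OF st] by metis
    have "{u<..<v} \<subseteq> ivl_set K"
      using u(2) v(2) by (intro subset_trans[OF _ open_subset_ivl_set[of K]]) auto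
    moreover have "\<forall>z. u < z \<longrightarrow> z < v \<longrightarrow> \<bar>f z\<bar> = \<bar>f x\<bar>"
      using c u v by auto
    ultimately show ?thesis
      unfolding V_def mem_Collect_eq using less_trans[OF u(1) v(1)] by (intro exI[of _ u] exI[of _ v]) blast
  qed
  have "infinite ({lo K<..<hi K} - B)"
    using infinite_Ioo[OF K] finB by (rule Diff_infinite_finite[rotated])
  then obtain x where "x \<in> {lo K<..<hi K} - B" using infinite_imp_nonempty by blast
  then have "V \<noteq> {}" using inV by auto
  then have "Max V \<in> V" using finV by simp
  then obtain u v where uv: "u < v" "{u<..<v} \<subseteq> ivl_set K" "\<forall>x. u < x \<longrightarrow> x < v \<longrightarrow> \<bar>f x\<bar> = Max V"
    by (auto simp: V_def)
  have "{x \<in> ivl_set K. Max V < \<bar>f x\<bar>} \<subseteq> B \<union> {lo K, hi K}"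
  proof
    fix x assume x: "x \<in> {x \<in> ivl_set K. Max V < \<bar>f x\<bar>}"
    then have "\<bar>f x\<bar> \<notin> V" using Max_ge[OF finV] by (auto simp: not_le[symmetric])
    moreover have "lo K \<le> x" "x \<le> hi K" using x ivl_set_subset_closed[of K] by auto
    ultimately show "x \<in> B \<union> {lo K, hi K}" using inV[of x] by (auto simp: le_less)
  qed
  then have "finite {x \<in> ivl_set K. Max V < \<bar>f x\<bar>}" using finB finite_subset by blast
  then show ?thesis
    using step_norm_inf[OF _ st uv(1,2)] uv(3) K by (metis less_imp_le)
qed

section \<open>Integrals of step functions\<close>

lemma has_simple_integral_const:
  assumes J: "lo J \<le> hi J" and c: "\<And>z. z \<in> ivl_set J \<Longrightarrow> f z = of_real c"
  shows "has_simple_integral f J (of_real c * (hi J - lo J))"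
proof (cases "lo J = hi J")
  case False
  define a :: "nat \<Rightarrow> levi_civita" where "a k = (if k = 0 then of_real c else 0)" for k
  have lim: "lc_lim_within (\<lambda>x. of_real c * x) (ivl_set J) b (of_real c * b)" for b
    unfolding lc_lim_within_def
  proof (intro allI impI)
    fix e :: levi_civita assume e: "0 < e"
    \<comment> \<open>The added 1 keeps the divisor positive when \<open>c = 0\<close>.\<close>
    define \<delta> where "\<delta> = of_real (inverse (\<bar>c\<bar> + 1)) * e"
    have \<delta>: "0 < \<delta>"
      unfolding \<delta>_def using e of_real_less_lc_iff[of 0 "inverse (\<bar>c\<bar> + 1)"]
      by (intro mult_pos_pos) auto
    have "0 < \<bar>c\<bar> + 1" by linarith
    then have p: "0 < (of_real (\<bar>c\<bar> + 1) :: levi_civita)"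
      by (simp only: of_real_pos_lc_iff)
    have "\<bar>of_real c * x - of_real c * b\<bar> < e" if "\<bar>x - b\<bar> < \<delta>" for x
    proof -
      have "\<bar>of_real c * x - of_real c * b\<bar> = of_real \<bar>c\<bar> * \<bar>x - b\<bar>"
        by (simp only: abs_mult abs_of_real_lc flip: right_diff_distrib)
      also have "\<dots> \<le> of_real (\<bar>c\<bar> + 1) * \<bar>x - b\<bar>"
        by (intro mult_right_mono) (simp_all del: of_real_add)
      also have "\<dots> < of_real (\<bar>c\<bar> + 1) * \<delta>"
        using that p by (rule mult_strict_left_mono)
      also have "\<dots> = of_real ((\<bar>c\<bar> + 1) * inverse (\<bar>c\<bar> + 1)) * e"
        unfolding \<delta>_def of_real_mult by (simp only: mult.assoc)
      also have "(\<bar>c\<bar> + 1) * inverse (\<bar>c\<bar> + 1) = 1"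
        by (intro right_inverse) linarith
      finally show ?thesis by simp
    qed
    with \<delta> show "\<exists>\<delta>>0. \<forall>x\<in>ivl_set J. x \<noteq> b \<and> \<bar>x - b\<bar> < \<delta> \<longrightarrow> \<bar>of_real c * x - of_real c * b\<bar> < e"
      by blast
  qed
  have "weak_sums (\<lambda>k. (a k /\<^sub>R real (Suc k)) * (x - 0) ^ Suc k) (of_real c * x)" for x
    using weak_sums_single[of 0 "\<lambda>k. (a k /\<^sub>R real (Suc k)) * (x - 0) ^ Suc k"] by (simp add: a_def)
  moreover have "lc_power_series_on (ivl_set J) 0 a f"
    unfolding a_def by (rule power_series_const) (rule c)
  ultimately have "\<exists>x0 a F u w. lc_power_series_on (ivl_set J) x0 a f \<and>
        (\<forall>x\<in>ivl_set J. weak_sums (\<lambda>k. (a k /\<^sub>R real (Suc k)) * (x - x0) ^ Suc k) (F x)) \<and>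
        lc_lim_within F (ivl_set J) (lo J) u \<and> lc_lim_within F (ivl_set J) (hi J) w \<and>
        of_real c * (hi J - lo J) = w - u"
    using lim by (intro exI[of _ 0] exI[of _ a] exI[of _ "\<lambda>x. of_real c * x"]
      exI[of _ "of_real c * lo J"] exI[of _ "of_real c * hi J"]) (auto simp: right_diff_distrib)
  with False show ?thesis unfolding has_simple_integral_def by simp
qed (simp add: has_simple_integral_def)

text \<open>With \<open>C'\<close> bounding the absolute values of \<open>f\<close>, both
  \<open>C' x + G x\<close> and \<open>C' x - G x\<close> are monotone. Summing their increments
  over any admissible family bounds the error of the integral by \<open>C'\<close> times the missing
  length, whatever the sign of \<open>f\<close>.\<close>

lemma step_has_integral:
  assumes K: "lo K \<le> hi K" and st: "lc_step B f" and r: "\<And>x. f x = of_real (\<psi> x)"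
    and G: "step_antideriv f (lo K) (hi K) G"
  shows "has_lc_integral (ivl_set K) f (G (hi K) - G (lo K))"
  unfolding has_lc_integral_def
proof (intro allI impI)
  fix e :: levi_civita assume e: "0 < e"
  have "finite (range \<psi>)"
    using finite_range_lc_step[OF lc_step_comp[OF st, of "\<lambda>z. coef z 0"]] by (simp add: r)
  then obtain C where C: "\<And>x. \<bar>\<psi> x\<bar> \<le> C"
    by (metis bounded_iff finite_imp_bounded rangeI real_norm_def)
  define C' where "C' = C + 1"
  have "0 \<le> C" using C[of 0] abs_ge_zero[of "\<psi> 0"] by linarith
  then have C': "0 < C'" "\<And>x. \<bar>\<psi> x\<bar> \<le> C'" using C by (auto simp: C'_def add_increasing2)
  define \<delta> where "\<delta> = of_real (inverse C') * e"
  have \<delta>: "0 < \<delta>"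
    unfolding \<delta>_def using e C' of_real_less_lc_iff[of 0 "inverse C'"] by (intro mult_pos_pos) auto
  have C\<delta>: "of_real C' * \<delta> = e"
    using C'(1) unfolding \<delta>_def by (simp add: mult.assoc[symmetric] flip: of_real_mult)
  have lin: "step_antideriv (\<lambda>x. of_real C' + of_real \<sigma> * f x) (lo K) (hi K) (\<lambda>x. of_real C' * x + of_real \<sigma> * G x)"
    if \<sigma>: "\<sigma> * \<sigma> = 1" for \<sigma> :: real
    unfolding step_antideriv_def
  proof (intro allI impI)
    fix x y c assume xy: "lo K \<le> x" "x \<le> y" "y \<le> hi K"
      and c: "\<forall>z. x < z \<longrightarrow> z < y \<longrightarrow> of_real C' + of_real \<sigma> * f z = c"
    have ss: "of_real \<sigma> * (of_real \<sigma> * z) = z" for z :: levi_civita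
      using \<sigma> by (simp add: mult.assoc[symmetric] flip: of_real_mult)
    have "f z = of_real \<sigma> * (c - of_real C')" if "x < z" "z < y" for z
      using c that by (metis ss add_diff_cancel_left')
    then have "G y - G x = of_real \<sigma> * (c - of_real C') * (y - x)"
      by (intro step_antiderivD[OF G xy]) auto
    then have "of_real \<sigma> * (G y - G x) = (c - of_real C') * (y - x)"
      by (simp add: ss mult.assoc)
    then show "of_real C' * y + of_real \<sigma> * G y - (of_real C' * x + of_real \<sigma> * G x) = c * (y - x)"
      by (simp add: algebra_simps)
  qed
  have pos: "0 \<le> of_real C' + of_real \<sigma> * f x" if "\<sigma> = 1 \<or> \<sigma> = - 1" for \<sigma> x
  proof -
    have "0 \<le> C' + \<sigma> * \<psi> x" using C'(2)[of x] that by auto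
    then show ?thesis using of_real_le_lc_iff[of 0 "C' + \<sigma> * \<psi> x"] by (simp add: r)
  qed
  show "\<exists>\<delta>>0. \<forall>I s. inner_ivls (ivl_set K) I s \<and> (\<forall>n. lc_simple f (I n)) \<and> lc_measure (ivl_set K) - s < \<delta> \<longrightarrow>
        (\<exists>v S. (\<forall>n. has_simple_integral f (I n) (v n)) \<and> strong_sums v S \<and> \<bar>S - (G (hi K) - G (lo K))\<bar> < e)"
  proof (rule exI[of _ \<delta>], intro conjI allI impI \<delta>)
    fix I s assume "inner_ivls (ivl_set K) I s \<and> (\<forall>n. lc_simple f (I n)) \<and> lc_measure (ivl_set K) - s < \<delta>"
    then have dj: "disjoint_ivls I" and sub: "\<And>n. ivl_set (I n) \<subseteq> ivl_set K"
      and sums: "strong_sums (\<lambda>n. ivl_length (I n)) s" and si: "\<And>n. lc_simple f (I n)"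
      and s: "hi K - lo K - s < \<delta>"
      using ivl_measure[OF K] by (auto simp: inner_ivls_def)
    have sub': "ivl_set (I n) \<subseteq> {lo K..hi K}" for n
      using sub ivl_set_subset_closed by blast
    have le: "lo (I n) \<le> hi (I n)" for n using dj by (auto simp: disjoint_ivls_def)
    define v where "v n = G (hi (I n)) - G (lo (I n))" for n
    \<comment> \<open>The absence of jumps enters here: on every interval where \<open>f\<close> is
      simple it has a single real value.\<close>
    have *: "\<exists>c. \<bar>c\<bar> \<le> C' \<and> (\<forall>z\<in>ivl_set (I n). f z = of_real c) \<and> v n = of_real c * ivl_length (I n)" for n
    proof (cases "lo (I n) = hi (I n)")
      case True
      obtain c where c: "\<And>x. x \<in> ivl_set (I n) \<Longrightarrow> f x = c" using step_simple_const[OF st si] by blast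
      show ?thesis
      proof (cases "ivl_set (I n) = {}")
        case False
        then obtain x where "x \<in> ivl_set (I n)" by auto
        with c[OF this] c C' True show ?thesis
          by (intro exI[of _ "\<psi> x"]) (auto simp: r v_def ivl_length_def)
      qed (use C' True in \<open>auto simp: v_def ivl_length_def intro!: exI[of _ 0]\<close>)
    next
      case False
      with le[of n] have lt: "lo (I n) < hi (I n)" by simp
      then obtain x where x: "lo (I n) < x" "x < hi (I n)" using dense by blast
      obtain c where c: "\<And>x. x \<in> ivl_set (I n) \<Longrightarrow> f x = c" using step_simple_const[OF st si] by blast
      have op: "z \<in> ivl_set (I n)" if "lo (I n) < z" "z < hi (I n)" for z
        using that open_subset_ivl_set[of "I n"] by auto
      have c': "c = of_real (\<psi> x)" using c[OF op[OF x]] by (simp add: r)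
      have "v n = c * (hi (I n) - lo (I n))"
        unfolding v_def using ivl_subset_bounds[OF sub' lt] lt c op
        by (intro step_antiderivD[OF G]) auto
      then show ?thesis
        using c c' C' by (intro exI[of _ "\<psi> x"]) (auto simp: ivl_length_def)
    qed
    then obtain c where c: "\<And>n. \<bar>c n\<bar> \<le> C'" "\<And>n z. z \<in> ivl_set (I n) \<Longrightarrow> f z = of_real (c n)"
      "\<And>n. v n = of_real (c n) * ivl_length (I n)"
      by metis
    have int: "has_simple_integral f (I n) (v n)" for n
      using has_simple_integral_const[OF le c(2)] by (simp add: c(3) ivl_length_def)
    \<comment> \<open>Real factors do not move exponents, so the integrals tend to 0 along with the
      lengths, which suffices for convergence of their series.\<close>
    have "\<forall>\<^sub>F n in sequentially. vanish_upto Q (v n)" for Q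
      using strong_sums_terms[OF sums, of Q]
      by (rule eventually_mono) (auto simp: c(3) vanish_upto_def)
    then obtain S where S: "strong_sums v S" using strong_sums_null_terms by blast
    have key: "of_real \<sigma> * (S - (G (hi K) - G (lo K))) < e" if \<sigma>: "\<sigma> = 1 \<or> \<sigma> = - 1" for \<sigma> :: real
    proof -
      have \<sigma>\<sigma>: "\<sigma> * \<sigma> = 1" using \<sigma> by auto
      define H where "H x = of_real C' * x + of_real \<sigma> * G x" for x
      have stH: "lc_step B (\<lambda>x. of_real C' + of_real \<sigma> * f x)" by (rule lc_step_comp[OF st])
      have "H x \<le> H y" if "lo K \<le> x" "x \<le> y" "y \<le> hi K" for x y
        unfolding H_def using step_antideriv_mono[OF stH lin[OF \<sigma>\<sigma>] _ that] pos[OF \<sigma>] by blast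
      then have le: "(\<Sum>n<N. H (hi (I n)) - H (lo (I n))) \<le> H (hi K) - H (lo K)" for N
        by (rule sum_disjoint_ivls_le[OF dj sub' K])
      have "(\<lambda>n. H (hi (I n)) - H (lo (I n))) = (\<lambda>n. of_real C' * ivl_length (I n) + of_real \<sigma> * v n)"
        by (simp add: fun_eq_iff H_def v_def ivl_length_def algebra_simps)
      moreover have "strong_sums (\<lambda>n. of_real C' * ivl_length (I n) + of_real \<sigma> * v n) (of_real C' * s + of_real \<sigma> * S)"
        by (intro strong_sums_add strong_sums_of_real_mult sums S)
      ultimately have "strong_sums (\<lambda>n. H (hi (I n)) - H (lo (I n))) (of_real C' * s + of_real \<sigma> * S)"
        by (simp only:)
      then have "of_real C' * s + of_real \<sigma> * S \<le> H (hi K) - H (lo K)"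
        by (rule strong_sums_le) (rule le)
      then have "of_real \<sigma> * (S - (G (hi K) - G (lo K))) \<le> of_real C' * (hi K - lo K - s)"
        by (simp add: H_def algebra_simps)
      also have "\<dots> < of_real C' * \<delta>"
        using s C'(1) of_real_less_lc_iff[of 0 C'] by (intro mult_strict_left_mono) auto
      finally show ?thesis by (simp add: C\<delta>)
    qed
    define D where "D = S - (G (hi K) - G (lo K))"
    have "D < e" "- D < e"
      using key[of 1] key[of "- 1"] unfolding D_def[symmetric] by simp_all
    then have "\<bar>S - (G (hi K) - G (lo K))\<bar> < e"
      by (simp only: abs_less_iff D_def[symmetric] minus_less_iff)
    with int S show "\<exists>v S. (\<forall>n. has_simple_integral f (I n) (v n)) \<and> strong_sums v S \<and>
        \<bar>S - (G (hi K) - G (lo K))\<bar> < e"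
      by blast
  qed
qed

section \<open>Lifting real step functions\<close>

text \<open>Every element of the field has the same position relative to a finite set of real breakpoints as
  some real number, at which the lift of a step function takes its value.\<close>

definition same_pos :: "real set \<Rightarrow> real \<Rightarrow> levi_civita \<Rightarrow> bool" where
  "same_pos B r x \<longleftrightarrow> (\<forall>b\<in>B. (b < r \<longleftrightarrow> of_real b < x) \<and> (b = r \<longleftrightarrow> of_real b = x))"

definition lc_lift :: "real set \<Rightarrow> (real \<Rightarrow> real) \<Rightarrow> (levi_civita \<Rightarrow> levi_civita) \<Rightarrow> bool" where
  "lc_lift B \<phi> s \<longleftrightarrow> finite B \<and> (\<forall>r x. same_pos B r x \<longrightarrow> s x = of_real (\<phi> r))"

lemma of_real_eq_lc_iff: "(of_real x :: levi_civita) = of_real y \<longleftrightarrow> x = y"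
  by (metis less_irrefl neqE of_real_less_lc_iff)

lemma same_pos_of_real: "same_pos B r (of_real r)"
  by (simp add: same_pos_def)

text \<open>If \<open>x\<close> is not a breakpoint, any real number strictly between the
  breakpoints below and those above \<open>x\<close> will do, also for infinite
  \<open>x\<close>.\<close>

lemma same_pos_exists:
  assumes "finite B"
  obtains r where "same_pos B r x"
proof (cases "\<exists>b\<in>B. x = of_real b")
  case True
  then show thesis using same_pos_of_real that by auto
next
  case False
  define L where "L = {b \<in> B. of_real b < x}"
  define U where "U = {b \<in> B. x < of_real b}"
  have fin: "finite L" "finite U" using assms by (auto simp: L_def U_def)
  have LU: "b < c" if "b \<in> L" "c \<in> U" for b c
    using that less_trans[of "of_real b" x "of_real c"] by (auto simp: L_def U_def)
  obtain l where l: "\<forall>b\<in>L. b \<le> l" "\<forall>c\<in>U. l < c"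
  proof (cases "L = {}")
    case True
    \<comment> \<open>With nothing below \<open>x\<close>, any real below all of \<open>U\<close>
      serves; the inserted 0 is the default for empty \<open>U\<close>.\<close>
    have "Min (insert 0 U) - 1 < c" if "c \<in> U" for c
    proof -
      have "Min (insert 0 U) \<le> c" using fin that by (intro Min_le) auto
      then show ?thesis by linarith
    qed
    with True show thesis by (intro that[of "Min (insert 0 U) - 1"]) auto
  next
    case False
    then show thesis using fin LU Max_in[of L] by (intro that[of "Max L"]) auto
  qed
  define u where "u = Min (insert (l + 1) U)"
  have "l < u" using fin l by (auto simp: u_def)
  then obtain r where r: "l < r" "r < u" using dense by blast
  have "same_pos B r x"
    unfolding same_pos_def
  proof
    fix b assume b: "b \<in> B"
    show "(b < r) = (of_real b < x) \<and> (b = r) = (of_real b = x)"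
    proof (cases "of_real b < x")
      case True
      then have "b \<le> l" using l b by (auto simp: L_def)
      with r True show ?thesis by auto
    next
      case f: False
      with False b have "b \<in> U" by (auto simp: U_def not_less le_less)
      then have "u \<le> b" using fin by (auto simp: u_def)
      with r f False b show ?thesis by auto
    qed
  qed
  then show thesis by (rule that)
qed

lemma lc_lift_value:
  assumes "lc_lift B \<phi> s"
  shows "\<exists>r. s x = of_real (\<phi> r)"
proof -
  obtain r where "same_pos B r x"
    using same_pos_exists[of B x] assms by (auto simp: lc_lift_def)
  with assms show ?thesis by (auto simp: lc_lift_def)
qed

lemma lc_lift_of_real: "lc_lift B \<phi> s \<Longrightarrow> s (of_real r) = of_real (\<phi> r)"
  using same_pos_of_real by (auto simp: lc_lift_def)

text \<open>Two reals in the same position as \<open>x\<close> have no breakpoint between them, so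
  the value does not depend on the chosen real.\<close>

lemma lc_lift_exists:
  assumes "lc_step B \<phi>"
  obtains s where "lc_lift B \<phi> s"
proof -
  have less: "\<phi> r = \<phi> r'" if "same_pos B r x" "same_pos B r' x" "r < r'" for r r' x
  proof -
    have "b \<notin> {r..r'}" if "b \<in> B" for b
      using that \<open>same_pos B r x\<close> \<open>same_pos B r' x\<close> \<open>r < r'\<close> unfolding same_pos_def
      by (metis atLeastAtMost_iff le_less leD)
    then have "{r..r'} \<inter> B = {}" by blast
    with assms \<open>r < r'\<close> show ?thesis by (auto simp: lc_step_def)
  qed
  then have eq: "\<phi> r = \<phi> r'" if "same_pos B r x" "same_pos B r' x" for r r' x
    using that by (metis neqE)
  have "lc_lift B \<phi> (\<lambda>x. of_real (\<phi> (SOME r. same_pos B r x)))"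
    unfolding lc_lift_def
  proof (intro conjI allI impI)
    show "finite B" using assms by (simp add: lc_step_def)
    fix r x assume "same_pos B r x"
    then have "\<phi> (SOME r. same_pos B r x) = \<phi> r" by (intro eq[OF someI])
    then show "of_real (\<phi> (SOME r. same_pos B r x)) = (of_real (\<phi> r) :: levi_civita)" by simp
  qed
  then show thesis by (rule that)
qed

lemma lc_lift_step:
  assumes "lc_lift B \<phi> s"
  shows "lc_step (of_real ` B) s"
  unfolding lc_step_def
proof (intro conjI allI impI)
  show "finite (of_real ` B :: levi_civita set)" using assms by (simp add: lc_lift_def)
  fix x y :: levi_civita assume xy: "x < y" "{x..y} \<inter> of_real ` B = {}"
  obtain r where r: "same_pos B r x"
    using same_pos_exists[of B x] assms by (auto simp: lc_lift_def)
  have "same_pos B r y"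
    unfolding same_pos_def
  proof
    fix b assume b: "b \<in> B"
    have rb: "(b < r) = (of_real b < x)" "(b = r) = (of_real b = x)"
      using r b by (auto simp: same_pos_def)
    have "of_real b \<notin> {x..y}" using xy(2) b by blast
    then consider "of_real b < x" | "y < of_real b" by (auto simp: not_le)
    then show "(b < r) = (of_real b < y) \<and> (b = r) = (of_real b = y)"
    proof cases
      case 1
      with rb less_trans[OF 1 xy(1)] show ?thesis by auto
    next
      case 2
      with rb less_trans[OF xy(1) 2] show ?thesis by auto
    qed
  qed
  with r show "s x = s y" using assms by (simp add: lc_lift_def)
qed

lemma lc_lift_real_step:
  assumes "lc_lift B \<phi> s"
  shows "lc_step B \<phi>"
  unfolding lc_step_def
proof (intro conjI allI impI)
  show "finite B" using assms by (simp add: lc_lift_def)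
  fix r r' :: real assume r: "r < r'" "{r..r'} \<inter> B = {}"
  have "same_pos B r' (of_real r)"
    unfolding same_pos_def
  proof
    fix b assume b: "b \<in> B"
    have "b \<notin> {r..r'}" using r(2) b by blast
    then show "(b < r') = (of_real b < (of_real r :: levi_civita)) \<and> (b = r') = (of_real b = (of_real r :: levi_civita))"
      using r(1) by (auto simp: of_real_eq_lc_iff)
  qed
  then have "s (of_real r) = of_real (\<phi> r')" using assms by (simp add: lc_lift_def)
  then show "\<phi> r = \<phi> r'" using lc_lift_of_real[OF assms, of r] by (simp add: of_real_eq_lc_iff)
qed

lemma lc_lift_mono: "lc_lift B \<phi> s \<Longrightarrow> B \<subseteq> B' \<Longrightarrow> finite B' \<Longrightarrow> lc_lift B' \<phi> s"
  unfolding lc_lift_def same_pos_def by blast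

lemma lc_lift_combine:
  assumes "lc_lift B \<phi> s" "lc_lift B' \<psi> t" "\<And>a b. h' (of_real a) (of_real b) = of_real (h a b)"
  shows "lc_lift (B \<union> B') (\<lambda>r. h (\<phi> r) (\<psi> r)) (\<lambda>x. h' (s x) (t x))"
  using lc_lift_mono[OF assms(1), of "B \<union> B'"] lc_lift_mono[OF assms(2), of "B \<union> B'"] assms
  by (auto simp: lc_lift_def)

lemma lc_lift_comp:
  "lc_lift B \<phi> s \<Longrightarrow> (\<And>a. h' (of_real a) = of_real (h a)) \<Longrightarrow> lc_lift B (\<lambda>r. h (\<phi> r)) (\<lambda>x. h' (s x))"
  by (auto simp: lc_lift_def)

lemma lc_lift_indicator: "lc_lift {lo J, hi J} (indicator (ivl_set J)) (indicator (lc_ivl J))"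
  unfolding lc_lift_def
proof (intro conjI allI impI)
  fix r x assume sp: "same_pos {lo J, hi J} r x"
  have e: "(b < r) = (of_real b < x)" "(b \<le> r) = (of_real b \<le> x)" if "b \<in> {lo J, hi J}" for b
    using sp that unfolding same_pos_def le_less by blast+
  have e': "(r < b) = (x < of_real b)" "(r \<le> b) = (x \<le> of_real b)" if "b \<in> {lo J, hi J}" for b
    using e[OF that] by (metis not_le, metis not_less)
  have "r \<in> ivl_set J \<longleftrightarrow> x \<in> lc_ivl J"
    unfolding lc_ivl_def using e e' by (cases J) simp_all
  then show "indicator (lc_ivl J) x = (of_real (indicator (ivl_set J) r) :: levi_civita)"
    by (simp add: indicator_def)
qed simp

section \<open>Integrals and norms of lifted step functions\<close>

lemma lo_hi_map_ivl [simp]: "lo (map_ivl g I) = g (lo I)" "hi (map_ivl g I) = g (hi I)"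
  by (cases I; simp)+

text \<open>Both integrals are additive over adjacent intervals and equal value times length on a
  gap. The real one is the gauge integral, which ignores the two end values.\<close>

lemma lift_has_integral:
  assumes lift: "lc_lift B \<phi> s" and G: "step_antideriv s (of_real a) (of_real b) G" and ab: "a \<le> b"
  shows "\<exists>L. (\<phi> has_integral L) {a..b} \<and> G (of_real b) - G (of_real a) = of_real L"
proof -
  have "finite B" using lift by (simp add: lc_lift_def)
  then have "a \<le> x \<longrightarrow> y \<le> b \<longrightarrow>
      (\<exists>L. (\<phi> has_integral L) {x..y} \<and> G (of_real y) - G (of_real x) = of_real L)" if "x \<le> y" for x y
    using that
  proof (induction rule: split_at_breakpoints)
    case (gap x y)
    show ?case
    proof (intro impI)
      assume xy: "a \<le> x" "y \<le> b"
      obtain c where c: "\<And>z. x < z \<Longrightarrow> z < y \<Longrightarrow> \<phi> z = c"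
        using lc_step_gap[OF lc_lift_real_step[OF lift] gap(2)] by blast
      have "{of_real x<..<of_real y} \<inter> of_real ` B = ({} :: levi_civita set)"
        using gap(2) by auto
      then obtain c' where c': "\<And>z. of_real x < z \<Longrightarrow> z < of_real y \<Longrightarrow> s z = c'"
        using lc_step_gap[OF lc_lift_step[OF lift]] by metis
      have "(\<phi> has_integral (y - x) * c) {x..y}"
      proof (rule has_integral_spike_finite[of "{x, y}"])
        show "((\<lambda>_. c) has_integral (y - x) * c) {x..y}"
          using has_integral_const_real[of c x y] gap(1) by simp
        show "\<phi> z = c" if "z \<in> {x..y} - {x, y}" for z using that c by auto
      qed simp
      moreover have "G (of_real y) - G (of_real x) = c' * (of_real y - of_real x)"
        by (rule step_antiderivD[OF G]) (use gap xy c' in auto)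
      moreover have "c' = of_real c" if "x \<noteq> y"
      proof -
        have "x < y" using gap(1) that by simp
        then obtain z where "x < z" "z < y" using dense by blast
        with c[of z] c'[of "of_real z"] lc_lift_of_real[OF lift, of z] show ?thesis by simp
      qed
      ultimately show "\<exists>L. (\<phi> has_integral L) {x..y} \<and> G (of_real y) - G (of_real x) = of_real L"
        by (intro exI[of _ "(y - x) * c"]) (cases "x = y"; simp add: mult.commute)
    qed
  next
    case (join x m y)
    show ?case
    proof (intro impI)
      assume "a \<le> x" "y \<le> b"
      with join obtain L1 L2 where
        "(\<phi> has_integral L1) {x..m}" "G (of_real m) - G (of_real x) = of_real L1"
        "(\<phi> has_integral L2) {m..y}" "G (of_real y) - G (of_real m) = of_real L2"
        by (meson order_trans)
      with join(1,2) show "\<exists>L. (\<phi> has_integral L) {x..y} \<and> G (of_real y) - G (of_real x) = of_real L"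
        by (intro exI[of _ "L1 + L2"]) (auto intro: has_integral_combine simp: algebra_simps)
    qed
  qed
  with ab show ?thesis by simp
qed

lemma ivl_set_lebesgue [measurable]: "ivl_set I \<in> sets lebesgue" for I :: "real ivl"
  by (cases I) auto

lemma ivl_set_lmeasurable: "ivl_set I \<in> lmeasurable" for I :: "real ivl"
  by (rule bounded_set_imp_lmeasurable[OF bounded_subset[OF bounded_closed_interval ivl_set_subset_closed]])
    (rule ivl_set_lebesgue)

lemma lift_nonneg_integral:
  assumes lift: "lc_lift B \<phi> s" and nn: "\<And>r. 0 \<le> \<phi> r" and I: "lo I \<le> hi I"
  shows "integrable (lebesgue_on (ivl_set I)) \<phi>"
    and "has_lc_integral (lc_ivl I) s (of_real (\<integral>x. \<phi> x \<partial>lebesgue_on (ivl_set I)))"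
proof -
  let ?K = "map_ivl of_real I :: levi_civita ivl"
  have K: "lo ?K \<le> hi ?K" using I by simp
  obtain G where G: "step_antideriv s (of_real (lo I)) (of_real (hi I)) G"
    using step_antideriv_exists[OF lc_lift_step[OF lift]] I by (metis of_real_le_lc_iff)
  obtain L where L: "(\<phi> has_integral L) {lo I..hi I}" "G (of_real (hi I)) - G (of_real (lo I)) = of_real L"
    using lift_has_integral[OF lift G I] by blast
  have sub: "ivl_set I - {lo I..hi I} = {}" "{lo I..hi I} - ivl_set I \<subseteq> {lo I, hi I}"
    by (cases I; auto)+
  have "(\<phi> has_integral L) (ivl_set I)"
  proof (subst has_integral_spike_set_eq)
    show "negligible {x \<in> ivl_set I - {lo I..hi I}. \<phi> x \<noteq> 0}" unfolding sub(1) by simp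
    show "negligible {x \<in> {lo I..hi I} - ivl_set I. \<phi> x \<noteq> 0}"
      by (rule negligible_subset[of "{lo I, hi I}"]) (use sub in auto)
  qed (rule L)
  moreover from this have "\<phi> absolutely_integrable_on ivl_set I"
    by (intro nonnegative_absolutely_integrable_1 nn) (rule has_integral_integrable)
  then show int: "integrable (lebesgue_on (ivl_set I)) \<phi>"
    by (rule absolutely_integrable_imp_integrable) (rule ivl_set_lebesgue)
  ultimately have "(\<integral>x. \<phi> x \<partial>lebesgue_on (ivl_set I)) = L"
    by (simp add: lebesgue_integral_eq_integral integral_unique ivl_set_lebesgue)
  moreover obtain \<rho> where \<rho>: "\<And>x. s x = of_real (\<phi> (\<rho> x))"
    using lc_lift_value[OF lift] by metis
  have "has_lc_integral (ivl_set ?K) s (G (hi ?K) - G (lo ?K))"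
    by (rule step_has_integral[OF K lc_lift_step[OF lift], of "\<lambda>x. \<phi> (\<rho> x)"]) (simp_all add: \<rho> G)
  ultimately show "has_lc_integral (lc_ivl I) s (of_real (\<integral>x. \<phi> x \<partial>lebesgue_on (ivl_set I)))"
    by (simp add: lc_ivl_def L(2))
qed

section \<open>Powers of real elements and the norms of lifts\<close>

lemma gbinomial_series_at_0: "strong_sums (\<lambda>k. of_real (p gchoose k) * 0 ^ k) 1"
  unfolding strong_sums_def
proof (rule strong_lim_eventually_const[of 1])
  fix n :: nat assume "n \<ge> 1"
  then have "(\<Sum>k<n. of_real (p gchoose k) * 0 ^ k) = (\<Sum>k\<in>{0}. of_real (p gchoose k) * 0 ^ k :: levi_civita)"
    by (intro sum.mono_neutral_right) (auto simp: power_0_left)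
  then show "(\<Sum>k<n. of_real (p gchoose k) * 0 ^ k) = (1 :: levi_civita)" by simp
qed

lemma has_lc_powr_of_real:
  assumes "0 \<le> c"
  shows "has_lc_powr (of_real c) p (of_real (c powr p))"
proof (cases "c = 0")
  case False
  with assms have "0 < c" by simp
  then show ?thesis
    unfolding has_lc_powr_def using gbinomial_series_at_0[of p]
    by (intro disjI2 exI[of _ c] exI[of _ 0] exI[of _ 0] exI[of _ 0] exI[of _ 1]) simp
qed (simp add: has_lc_powr_def)

text \<open>\<open>lc_powr\<close> is a definite description and needs uniqueness. Comparing
  coefficients shows that a positive real has only the decomposition with r = c, l = 0 and u =
  0.\<close>

lemma has_lc_powr_of_real_unique:
  assumes "has_lc_powr (of_real c) p y"
  shows "y = of_real (c powr p)"
proof (cases "c = 0")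
  case True
  \<comment> \<open>The coefficient at \<open>l\<close> of such a product is \<open>r\<close>, so
    the second form of the definition never represents 0.\<close>
  have "of_real r * lc_d l * (1 + u) \<noteq> 0" if "0 < r" "\<forall>q\<le>0. coef u q = 0" for r l u
  proof -
    have "coef (lc_d l * (of_real r * (1 + u))) l = r" using that by (simp add: coef_lc_d_mult del: mult.left_commute)
    then show ?thesis using that by (auto simp: mult_ac)
  qed
  with assms True show ?thesis by (auto simp: has_lc_powr_def)
next
  case False
  then have "of_real c \<noteq> (0 :: levi_civita)" using of_real_eq_lc_iff[of c 0] by simp
  with assms obtain r l s u z where r: "r > 0" and u: "\<forall>q\<le>0. coef u q = 0"
    and x: "of_real c = of_real r * lc_d l * (1 + u)" and s: "of_rat s = p * of_rat l"
    and z: "strong_sums (\<lambda>k. of_real (p gchoose k) * u ^ k) z" and y: "y = of_real (r powr p) * lc_d s * z"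
    unfolding has_lc_powr_def by blast
  have co: "(if q = 0 then c else 0) = r * coef (1 + u) (q - l)" for q
    using arg_cong[OF x, of "\<lambda>w. coef w q"] by (simp only: mult.assoc coef_of_real coef_of_real_mult coef_lc_d_mult)
  have l: "l = 0" using co[of l] u r by (auto split: if_splits)
  with co[of 0] u have c: "c = r" by simp
  have "u = 0"
  proof (rule levi_civita_eqI)
    fix q show "coef u q = coef 0 q"
      using co[of q] l r u by (cases "q = 0") auto
  qed
  with z have "z = 1" using strong_sums_unique gbinomial_series_at_0 by blast
  moreover have "s = 0" using s l by simp
  ultimately show ?thesis using y c by simp
qed

lemma lc_powr_of_real: "0 \<le> c \<Longrightarrow> lc_powr (of_real c) p = of_real (c powr p)"
  unfolding lc_powr_def
  by (rule the_equality) (auto intro: has_lc_powr_of_real has_lc_powr_of_real_unique)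

text \<open>Absolute values of a lift are nonnegative reals, so their powers exist for irrational
  \<open>p\<close> too and form the lift of the real powers; the integral and its root are then real
  as well.\<close>

lemma lift_norm:
  assumes lift: "lc_lift B \<phi> s" and I: "lo I \<le> hi I"
  shows "has_lc_norm (ereal p) (lc_ivl I) s (of_real (real_Lp_norm (ereal p) (ivl_set I) \<phi>))"
proof -
  let ?K = "map_ivl of_real I :: levi_civita ivl"
  have K: "lo ?K \<le> hi ?K" using I by simp
  have lift': "lc_lift B (\<lambda>r. \<bar>\<phi> r\<bar> powr p) (\<lambda>x. lc_powr \<bar>s x\<bar> p)"
    by (rule lc_lift_comp[OF lift]) (simp add: lc_powr_of_real)
  have ae: "lc_ae (lc_ivl I) (\<lambda>x. \<exists>y. has_lc_powr \<bar>s x\<bar> p y)"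
  proof -
    have "has_lc_powr \<bar>s x\<bar> p (lc_powr \<bar>s x\<bar> p)" for x
    proof -
      obtain r where "s x = of_real (\<phi> r)" using lc_lift_value[OF lift] by blast
      then show ?thesis by (simp add: lc_powr_of_real has_lc_powr_of_real)
    qed
    then have "(\<lambda>x. \<exists>y. has_lc_powr \<bar>s x\<bar> p y) = (\<lambda>x. True)" by blast
    moreover have "lc_ae (ivl_set ?K) (\<lambda>x. True)"
      by (rule step_ae_finite_exceptions[OF K lc_step_const]) simp
    ultimately show ?thesis by (simp only: lc_ivl_def)
  qed
  have int: "has_lc_integral (lc_ivl I) (\<lambda>x. lc_powr \<bar>s x\<bar> p)
      (of_real (\<integral>x. \<bar>\<phi> x\<bar> powr p \<partial>lebesgue_on (ivl_set I)))"
    by (rule lift_nonneg_integral(2)[OF lift' _ I]) simp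
  have "has_lc_powr (of_real (\<integral>x. \<bar>\<phi> x\<bar> powr p \<partial>lebesgue_on (ivl_set I))) (1 / p)
      (of_real (real_Lp_norm (ereal p) (ivl_set I) \<phi>))"
    by (simp add: real_Lp_norm_def has_lc_powr_of_real)
  then show ?thesis
    unfolding has_lc_norm_def lc_Lp_def
    using ae int step_measurable_fun[OF K lc_lift_step[OF lift]] step_measurable_fun[OF K lc_lift_step[OF lift']]
    by (auto simp: lc_ivl_def)
qed

section \<open>Approximation by real step functions\<close>

lemma lc_step_measurable:
  fixes \<phi> :: "real \<Rightarrow> real"
  assumes "lc_step B \<phi>"
  shows "\<phi> \<in> borel_measurable borel"
proof (rule borel_measurable_continuous_countable_exceptions)
  have fin: "finite B" using assms by (simp add: lc_step_def)
  then show "countable B" by (rule countable_finite)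
  have op: "open (- B)" using finite_imp_closed[OF fin] by (simp add: open_Compl)
  have "isCont \<phi> x" if x: "x \<in> - B" for x
  proof -
    obtain e where e: "e > 0" "ball x e \<subseteq> - B" using op x by (meson openE)
    have "\<phi> y = \<phi> x" if y: "y \<in> ball x e" for y
    proof -
      have "z \<notin> B" if "min x y \<le> z" "z \<le> max x y" for z
      proof -
        have "z \<in> ball x e" using that y by (auto simp: dist_real_def)
        with e show ?thesis by auto
      qed
      then have "{min x y..max x y} \<inter> B = {}" by auto
      with assms show ?thesis
        unfolding lc_step_def by (cases x y rule: linorder_cases) (auto simp: min_def max_def)
    qed
    moreover have "\<forall>\<^sub>F y in at x. y \<in> ball x e"
      using e(1) by (intro eventually_at_in_open') auto
    ultimately have "\<forall>\<^sub>F y in at x. \<phi> y = \<phi> x" by (auto elim: eventually_mono)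
    then show ?thesis unfolding isCont_def by (rule tendsto_eventually)
  qed
  then show "continuous_on (- B) \<phi>" by (auto simp: continuous_on_eq_continuous_at op)
qed

lemma continuous_step_approx:
  fixes g :: "real \<Rightarrow> real"
  assumes g: "continuous_on UNIV g" and e: "0 < e" and ab: "a \<le> b"
  shows "\<exists>B \<psi>. lc_step B \<psi> \<and> (\<forall>x\<in>{a..b}. \<bar>\<psi> x - g x\<bar> < e)"
  using ab
proof (induction rule: Bolzano)
  case (trans a b c)
  then obtain B \<psi> B' \<psi>' where *: "lc_step B \<psi>" "\<forall>x\<in>{a..b}. \<bar>\<psi> x - g x\<bar> < e"
    "lc_step B' \<psi>'" "\<forall>x\<in>{b..c}. \<bar>\<psi>' x - g x\<bar> < e"
    by blast
  have "lc_step {b} (\<lambda>x. x \<le> b)" by (auto simp: lc_step_def)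
  from lc_step_combine[OF lc_step_combine[OF *(1,3), of Pair] this, of "\<lambda>p l. if l then fst p else snd p"]
  have "lc_step (B \<union> B' \<union> {b}) (\<lambda>x. if x \<le> b then \<psi> x else \<psi>' x)" by (simp cong: if_cong)
  with * show ?case
    by (intro exI[of _ "B \<union> B' \<union> {b}"] exI[of _ "\<lambda>x. if x \<le> b then \<psi> x else \<psi>' x"]) auto
next
  case (local x)
  have "isCont g x" using g by (simp add: continuous_on_eq_continuous_at)
  then obtain d where d: "0 < d" "\<And>y. \<bar>y - x\<bar> < d \<Longrightarrow> \<bar>g y - g x\<bar> < e"
    using e unfolding isCont_def LIM_def by (metis dist_real_def abs_zero diff_self)
  show ?case
  proof (intro exI[of _ d] conjI allI impI)
    fix a b assume ab: "a \<le> x \<and> x \<le> b \<and> b - a < d"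
    have "\<forall>y\<in>{a..b}. \<bar>g x - g y\<bar> < e"
    proof
      fix y assume "y \<in> {a..b}"
      with ab have "\<bar>y - x\<bar> < d" by auto
      from d(2)[OF this] show "\<bar>g x - g y\<bar> < e" by (simp add: abs_minus_commute)
    qed
    then show "\<exists>B \<psi>. lc_step B \<psi> \<and> (\<forall>x\<in>{a..b}. \<bar>\<psi> x - g x\<bar> < e)"
      by (intro exI[of _ "{}"] exI[of _ "\<lambda>_. g x"] conjI lc_step_const)
  qed (use d in auto)
qed

lemma AE_lebesgue_on_iff:
  "S \<in> sets lebesgue \<Longrightarrow> (AE x in lebesgue_on S. P x) \<longleftrightarrow> (AE x in lebesgue. x \<in> S \<longrightarrow> P x)"
  by (subst AE_restrict_space_iff) auto

text \<open>A Lebesgue measurable function is an almost everywhere limit of continuous ones; the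
  n-th of these is replaced by a step function within 1/(n+1) on the closed interval.\<close>

lemma step_ae_approx:
  assumes f: "f \<in> borel_measurable (lebesgue_on (ivl_set I))" and I: "lo I \<le> hi I"
  obtains C :: "nat \<Rightarrow> real set" and \<psi> :: "nat \<Rightarrow> real \<Rightarrow> real"
  where "\<And>n. lc_step (C n) (\<psi> n)" "AE x in lebesgue_on (ivl_set I). (\<lambda>n. \<psi> n x) \<longlonglongrightarrow> f x"
proof -
  have "f measurable_on ivl_set I"
    using f by (simp add: measurable_on_iff_borel_measurable ivl_set_lebesgue)
  then obtain N g where N: "negligible N" and g: "\<And>n. continuous_on UNIV (g n)"
    and lim: "\<And>x. x \<notin> N \<Longrightarrow> (\<lambda>n. g n x) \<longlonglongrightarrow> (if x \<in> ivl_set I then f x else 0)"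
    by (auto simp: measurable_on_def)
  have "\<exists>B \<psi>. lc_step B \<psi> \<and> (\<forall>x\<in>{lo I..hi I}. \<bar>\<psi> x - g n x\<bar> < inverse (real (Suc n)))" for n
    by (rule continuous_step_approx[OF g _ I]) simp
  then obtain C \<psi> where \<psi>: "\<And>n. lc_step (C n) (\<psi> n)"
    "\<And>n x. x \<in> {lo I..hi I} \<Longrightarrow> \<bar>\<psi> n x - g n x\<bar> < inverse (real (Suc n))"
    by metis
  have "AE x in lebesgue_on (ivl_set I). (\<lambda>n. \<psi> n x) \<longlonglongrightarrow> f x"
    unfolding AE_lebesgue_on_iff[OF ivl_set_lebesgue]
  proof (rule AE_I'[of N])
    show "N \<in> null_sets lebesgue" using N by (simp add: negligible_iff_null_sets)
    show "{x \<in> space lebesgue. \<not> (x \<in> ivl_set I \<longrightarrow> (\<lambda>n. \<psi> n x) \<longlonglongrightarrow> f x)} \<subseteq> N"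
    proof
      fix x assume "x \<in> {x \<in> space lebesgue. \<not> (x \<in> ivl_set I \<longrightarrow> (\<lambda>n. \<psi> n x) \<longlonglongrightarrow> f x)}"
      then have x: "x \<in> ivl_set I" "\<not> (\<lambda>n. \<psi> n x) \<longlonglongrightarrow> f x" by auto
      show "x \<in> N"
      proof (rule ccontr)
        assume "x \<notin> N"
        with lim[of x] x have 1: "(\<lambda>n. g n x) \<longlonglongrightarrow> f x" by simp
        have "x \<in> {lo I..hi I}" using x ivl_set_subset_closed by blast
        then have "norm (\<psi> n x - g n x) \<le> inverse (real (Suc n))" for n
          using \<psi>(2)[of x n] by simp
        then have "(\<lambda>n. \<psi> n x - g n x) \<longlonglongrightarrow> 0"
          by (intro tendsto_0_le[OF LIMSEQ_inverse_real_of_nat, of _ 1]) (auto intro!: always_eventually)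
        from tendsto_add[OF this 1] x(2) show False by simp
      qed
    qed
  qed
  with \<psi>(1) show thesis by (rule that)
qed

text \<open>From \<open>\<bar>a + b\<bar> \<le> 2 max \<bar>a\<bar> \<bar>b\<bar>\<close>; the crude
  constant is enough because only smallness of errors is required.\<close>

lemma powr_abs_add_le:
  fixes a b p :: real
  assumes "0 \<le> p"
  shows "\<bar>a + b\<bar> powr p \<le> 2 powr p * (\<bar>a\<bar> powr p + \<bar>b\<bar> powr p)"
proof -
  have "\<bar>a + b\<bar> powr p \<le> (2 * max \<bar>a\<bar> \<bar>b\<bar>) powr p"
    using assms by (intro powr_mono2) auto
  also have "\<dots> = 2 powr p * max \<bar>a\<bar> \<bar>b\<bar> powr p"
    by (simp add: powr_mult)
  also have "\<dots> \<le> 2 powr p * (\<bar>a\<bar> powr p + \<bar>b\<bar> powr p)"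
    by (intro mult_left_mono) (auto simp: max_def)
  finally show ?thesis .
qed

text \<open>Almost everywhere convergent step functions need not converge in the mean. Truncating
  \<open>f\<close> at a large level costs little, and step functions truncated at the same level
  converge boundedly.\<close>

lemma step_Lp_approx:
  assumes f: "f \<in> real_Lp (ereal p) (ivl_set I)" and I: "lo I \<le> hi I" and p: "1 \<le> p" and e: "0 < e"
  shows "\<exists>B \<phi>. lc_step B \<phi> \<and> integrable (lebesgue_on (ivl_set I)) (\<lambda>x. \<bar>\<phi> x - f x\<bar> powr p) \<and>
    (\<integral>x. \<bar>\<phi> x - f x\<bar> powr p \<partial>lebesgue_on (ivl_set I)) < e"
proof -
  let ?M = "lebesgue_on (ivl_set I)"
  interpret finite_measure ?M by (rule finite_measure_lebesgue_on) (rule ivl_set_lmeasurable)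
  have f1 [measurable]: "f \<in> borel_measurable ?M" and f2: "integrable ?M (\<lambda>x. \<bar>f x\<bar> powr p)"
    using f by (auto simp: real_Lp_def)
  obtain C \<psi> where \<psi>: "\<And>n. lc_step (C n) (\<psi> n)" and lim: "AE x in ?M. (\<lambda>n. \<psi> n x) \<longlonglongrightarrow> f x"
    using step_ae_approx[OF f1 I] by blast
  have step_meas: "\<phi> \<in> borel_measurable ?M" if "lc_step B \<phi>" for B and \<phi> :: "real \<Rightarrow> real"
    using lc_step_measurable[OF that] by (simp add: measurable_restrict_space1 measurable_completion)
  note [measurable] = step_meas[OF \<psi>]
  define cl where "cl k y = max (- real k) (min (real k) y)" for k y
  have clm: "cl k \<in> borel_measurable borel" for k
    unfolding cl_def by measurable
  note [measurable] = clm
  have cl_abs: "\<bar>cl k y\<bar> \<le> real k" for k y by (auto simp: cl_def)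
  \<comment> \<open>Two errors of size \<open>e'\<close>, each multiplied by the constant of
    \<open>powr_abs_add_le\<close>, make up \<open>e\<close>.\<close>
  define e' where "e' = e / (2 powr p * 2)"
  have e': "0 < e'" using e by (simp add: e'_def)
  have "(\<lambda>k. \<integral>x. \<bar>cl k (f x) - f x\<bar> powr p \<partial>?M) \<longlonglongrightarrow> (\<integral>x. 0 \<partial>?M)"
  proof (rule integral_dominated_convergence[OF _ _ f2])
    show "AE x in ?M. (\<lambda>k. \<bar>cl k (f x) - f x\<bar> powr p) \<longlonglongrightarrow> 0"
    proof (rule AE_I2)
      fix x
      obtain K :: nat where "\<bar>f x\<bar> \<le> real K" using real_arch_simple by blast
      then have "\<bar>cl k (f x) - f x\<bar> powr p = 0" if "k \<ge> K" for k
        using that p by (auto simp: cl_def)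
      then show "(\<lambda>k. \<bar>cl k (f x) - f x\<bar> powr p) \<longlonglongrightarrow> 0"
        by (intro tendsto_eventually) (auto simp: eventually_sequentially)
    qed
    show "AE x in ?M. norm (\<bar>cl k (f x) - f x\<bar> powr p) \<le> \<bar>f x\<bar> powr p" for k
      using p by (intro AE_I2) (auto simp: cl_def intro!: powr_mono2)
  qed measurable
  then have "\<forall>\<^sub>F k in sequentially. (\<integral>x. \<bar>cl k (f x) - f x\<bar> powr p \<partial>?M) < e'"
    using e' by (intro order_tendstoD(2)) auto
  then obtain k where k: "(\<integral>x. \<bar>cl k (f x) - f x\<bar> powr p \<partial>?M) < e'"
    using eventually_happens trivial_limit_sequentially by blast
  have int1: "integrable ?M (\<lambda>x. \<bar>cl k (f x) - f x\<bar> powr p)"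
    using p by (intro Bochner_Integration.integrable_bound[OF f2] AE_I2)
      (auto simp: cl_def intro!: powr_mono2)
  have bd: "\<bar>cl k y - cl k z\<bar> powr p \<le> (2 * real k) powr p" for y z
    using p cl_abs[of k y] cl_abs[of k z] by (intro powr_mono2) auto
  have int2: "integrable ?M (\<lambda>x. \<bar>cl k (\<psi> n x) - cl k (f x)\<bar> powr p)" for n
    by (rule integrable_const_bound[of _ "(2 * real k) powr p"]) (use bd in auto)
  have "(\<lambda>n. \<integral>x. \<bar>cl k (\<psi> n x) - cl k (f x)\<bar> powr p \<partial>?M) \<longlonglongrightarrow> (\<integral>x. 0 \<partial>?M)"
  proof (rule integral_dominated_convergence[where w = "\<lambda>_. (2 * real k) powr p"])
    show "AE x in ?M. (\<lambda>n. \<bar>cl k (\<psi> n x) - cl k (f x)\<bar> powr p) \<longlonglongrightarrow> 0"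
      using lim
    proof eventually_elim
      case (elim x)
      have "(\<lambda>n. \<bar>cl k (\<psi> n x) - cl k (f x)\<bar> powr p) \<longlonglongrightarrow> \<bar>cl k (f x) - cl k (f x)\<bar> powr p"
        using p unfolding cl_def by (intro tendsto_intros elim) auto
      then show ?case by simp
    qed
  qed (use bd in auto)
  then have "\<forall>\<^sub>F n in sequentially. (\<integral>x. \<bar>cl k (\<psi> n x) - cl k (f x)\<bar> powr p \<partial>?M) < e'"
    using e' by (intro order_tendstoD(2)) auto
  then obtain n where n: "(\<integral>x. \<bar>cl k (\<psi> n x) - cl k (f x)\<bar> powr p \<partial>?M) < e'"
    using eventually_happens trivial_limit_sequentially by blast
  let ?w = "\<lambda>x. 2 powr p * (\<bar>cl k (\<psi> n x) - cl k (f x)\<bar> powr p + \<bar>cl k (f x) - f x\<bar> powr p)"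
  have le: "\<bar>cl k (\<psi> n x) - f x\<bar> powr p \<le> ?w x" for x
    using powr_abs_add_le[of p "cl k (\<psi> n x) - cl k (f x)" "cl k (f x) - f x"] p by simp
  have w: "integrable ?M ?w" using int1 int2 by simp
  have int: "integrable ?M (\<lambda>x. \<bar>cl k (\<psi> n x) - f x\<bar> powr p)"
    by (rule Bochner_Integration.integrable_bound[OF w]) (use le in \<open>auto intro!: AE_I2 intro: order_trans\<close>)
  have "(\<integral>x. \<bar>cl k (\<psi> n x) - f x\<bar> powr p \<partial>?M) \<le> (\<integral>x. ?w x \<partial>?M)"
    by (rule integral_mono[OF int w]) (rule le)
  also have "\<dots> = 2 powr p * ((\<integral>x. \<bar>cl k (\<psi> n x) - cl k (f x)\<bar> powr p \<partial>?M) + (\<integral>x. \<bar>cl k (f x) - f x\<bar> powr p \<partial>?M))"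
    using int1 int2 by simp
  also have "\<dots> < 2 powr p * (e' + e')"
    using k n by (intro mult_strict_left_mono add_strict_mono) auto
  also have "\<dots> = e" by (simp add: e'_def field_simps)
  finally show ?thesis
    using int lc_step_comp[OF \<psi>[of n], of "cl k"] by blast
qed

text \<open>The errors are summable, so a single integrable function dominates the whole sequence. Dominated
  convergence then replaces Minkowski's inequality.\<close>

lemma step_Lp_sequence:
  assumes f: "f \<in> real_Lp (ereal p) (ivl_set I)" and I: "lo I \<le> hi I" and p: "1 \<le> p"
  obtains B \<phi> h where "\<And>n. lc_step (B n) (\<phi> n)"
    "\<And>n. integrable (lebesgue_on (ivl_set I)) (\<lambda>x. \<bar>\<phi> n x - f x\<bar> powr p)"
    "\<And>n. (\<integral>x. \<bar>\<phi> n x - f x\<bar> powr p \<partial>lebesgue_on (ivl_set I)) < (1 / 2) ^ n"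
    "AE x in lebesgue_on (ivl_set I). (\<lambda>n. \<phi> n x) \<longlonglongrightarrow> f x"
    "integrable (lebesgue_on (ivl_set I)) h"
    "AE x in lebesgue_on (ivl_set I). \<forall>n. \<bar>\<phi> n x\<bar> powr p \<le> h x"
proof -
  let ?M = "lebesgue_on (ivl_set I)"
  have f1 [measurable]: "f \<in> borel_measurable ?M" and f2: "integrable ?M (\<lambda>x. \<bar>f x\<bar> powr p)"
    using f by (auto simp: real_Lp_def)
  define P where "P n B \<phi> \<longleftrightarrow> lc_step B \<phi> \<and> integrable ?M (\<lambda>x. \<bar>\<phi> x - f x\<bar> powr p) \<and>
    (\<integral>x. \<bar>\<phi> x - f x\<bar> powr p \<partial>?M) < (1 / 2) ^ n" for n :: nat and B and \<phi> :: "real \<Rightarrow> real"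
  have "\<exists>B \<phi>. P n B \<phi>" for n
    unfolding P_def by (rule step_Lp_approx[OF f I p]) simp
  then obtain B \<phi> where "\<And>n. P n (B n) (\<phi> n)"
    by metis
  then have \<phi>: "\<And>n. lc_step (B n) (\<phi> n)"
    and int: "\<And>n. integrable ?M (\<lambda>x. \<bar>\<phi> n x - f x\<bar> powr p)"
    and less: "\<And>n. (\<integral>x. \<bar>\<phi> n x - f x\<bar> powr p \<partial>?M) < (1 / 2) ^ n"
    unfolding P_def by blast+
  define u where "u n x = \<bar>\<phi> n x - f x\<bar> powr p" for n x
  have u: "integrable ?M (u n)" "\<And>x. 0 \<le> u n x" "(\<integral>x. u n x \<partial>?M) < (1 / 2) ^ n" for n
    using int less by (auto simp: u_def [abs_def])
  have sum_int: "summable (\<lambda>n. \<integral>x. u n x \<partial>?M)"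
    using u by (intro summable_comparison_test'[OF summable_geometric[of "1/2::real"], of 0])
      (auto simp: less_imp_le)
  \<comment> \<open>The integrals of the errors lie below a geometric series, so the sum of the
    errors is finite almost everywhere. Its terms then tend to 0, which gives pointwise convergence
    of the whole sequence.\<close>
  have "(\<integral>\<^sup>+ x. (\<Sum>n. ennreal (u n x)) \<partial>?M) = (\<Sum>n. \<integral>\<^sup>+ x. ennreal (u n x) \<partial>?M)"
    using u(1) by (intro nn_integral_suminf) auto
  also have "\<dots> = (\<Sum>n. ennreal (\<integral>x. u n x \<partial>?M))"
    using u by (intro suminf_cong nn_integral_eq_integral) auto
  also have "\<dots> \<noteq> \<infinity>"
    using sum_int u by (simp add: suminf_ennreal2)
  finally have "AE x in ?M. (\<Sum>n. ennreal (u n x)) \<noteq> \<infinity>"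
    using u(1) by (intro nn_integral_noteq_infinite) auto
  then have summ: "AE x in ?M. summable (\<lambda>n. u n x)"
    by (rule eventually_mono) (auto intro: summable_suminf_not_top u)
  have intsum: "integrable ?M (\<lambda>x. \<Sum>n. u n x)"
    using summ sum_int u by (intro integrable_suminf) auto
  have lim: "AE x in ?M. (\<lambda>n. \<phi> n x) \<longlonglongrightarrow> f x"
    using summ
  proof eventually_elim
    case (elim x)
    have "(\<lambda>n. u n x) \<longlonglongrightarrow> 0" by (rule summable_LIMSEQ_zero[OF elim])
    then have "(\<lambda>n. u n x powr (1 / p)) \<longlonglongrightarrow> 0 powr (1 / p)"
      using p u(2) by (intro tendsto_powr' tendsto_const) auto
    moreover have "u n x powr (1 / p) = \<bar>\<phi> n x - f x\<bar>" for n
      using p by (simp add: u_def powr_powr)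
    ultimately show ?case by (simp add: LIM_zero_iff tendsto_rabs_zero_iff)
  qed
  let ?h = "\<lambda>x. 2 powr p * ((\<Sum>n. u n x) + \<bar>f x\<bar> powr p)"
  have "AE x in ?M. \<forall>n. \<bar>\<phi> n x\<bar> powr p \<le> ?h x"
    using summ
  proof eventually_elim
    case (elim x)
    show ?case
    proof
      fix n
      have "\<bar>\<phi> n x\<bar> powr p \<le> 2 powr p * (u n x + \<bar>f x\<bar> powr p)"
        using powr_abs_add_le[of p "\<phi> n x - f x" "f x"] p by (simp add: u_def)
      also have "u n x \<le> (\<Sum>n. u n x)"
        using sum_le_suminf[OF elim, of "{n}"] u(2) by simp
      finally show "\<bar>\<phi> n x\<bar> powr p \<le> ?h x" by simp
    qed
  qed
  moreover have "integrable ?M ?h" using intsum f2 by simp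
  ultimately show thesis
    using that \<phi> int less lim by blast
qed

section \<open>Finite exponents\<close>

definition approximates ::
    "ereal \<Rightarrow> real ivl \<Rightarrow> (real \<Rightarrow> real) \<Rightarrow> (nat \<Rightarrow> levi_civita \<Rightarrow> levi_civita) \<Rightarrow> bool" where
  "approximates p I f s \<longleftrightarrow> 
    (\<forall>n. lc_measurable_fun (lc_ivl I) (s n)) \<and>
    weakly_Cauchy p (lc_ivl I) s \<and>
    weak_lim_norm p (lc_ivl I) s (of_real (real_Lp_norm p (ivl_set I) f)) \<and>
    (\<forall>J :: real ivl. lo J \<le> hi J \<and> ivl_set J \<subseteq> ivl_set I \<longrightarrow>
      weak_lim_norm p (lc_ivl I) (\<lambda>n x. s n x * indicator (lc_ivl J) x)
        (of_real (real_Lp_norm p (ivl_set I) (\<lambda>x. f x * indicator (ivl_set J) x)))) \<and>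
    (AE x in lebesgue_on (ivl_set I). \<exists>r :: nat \<Rightarrow> nat. strict_mono r \<and>
      weak_lim (\<lambda>k. s (r k) (of_real x)) (of_real (f x)))"

lemma weakly_small_0 [simp]: "0 < \<epsilon> \<Longrightarrow> weakly_small \<epsilon> 0"
  by (simp add: weakly_small_def)

lemma approximation_finite:
  assumes f: "f \<in> real_Lp (ereal p) (ivl_set I)" and I: "lo I \<le> hi I" and p: "1 \<le> p"
  shows "\<exists>s. approximates (ereal p) I f s"
proof -
  let ?M = "lebesgue_on (ivl_set I)"
  have f1 [measurable]: "f \<in> borel_measurable ?M"
    using f by (auto simp: real_Lp_def)
  obtain B \<phi> h where \<phi>: "\<And>n. lc_step (B n) (\<phi> n)"
    and int: "\<And>n. integrable ?M (\<lambda>x. \<bar>\<phi> n x - f x\<bar> powr p)"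
    and less: "\<And>n. (\<integral>x. \<bar>\<phi> n x - f x\<bar> powr p \<partial>?M) < (1 / 2) ^ n"
    and lim: "AE x in ?M. (\<lambda>n. \<phi> n x) \<longlonglongrightarrow> f x"
    and h: "integrable ?M h" "AE x in ?M. \<forall>n. \<bar>\<phi> n x\<bar> powr p \<le> h x"
    using step_Lp_sequence[OF f I p] by blast
  have "\<forall>n. \<exists>s. lc_lift (B n) (\<phi> n) s" using lc_lift_exists[OF \<phi>] by metis
  then obtain s where s: "\<And>n. lc_lift (B n) (\<phi> n) (s n)" by metis
  have [measurable]: "\<phi> n \<in> borel_measurable ?M" for n
    using lc_step_measurable[OF \<phi>] by (simp add: measurable_restrict_space1 measurable_completion)
  \<comment> \<open>The factor is kept general so that the constant 1 and the indicator of
    \<open>J\<close> are both instances; a factor bounded by 1 preserves the domination by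
    \<open>h\<close>.\<close>
  have norms: "weak_lim_norm (ereal p) (lc_ivl I) (\<lambda>n x. s n x * t x)
      (of_real (real_Lp_norm (ereal p) (ivl_set I) (\<lambda>x. f x * \<kappa> x)))"
    if t: "lc_lift T \<kappa> t" and \<kappa>: "\<And>x. \<bar>\<kappa> x\<bar> \<le> 1" for T \<kappa> t
  proof -
    have [measurable]: "\<kappa> \<in> borel_measurable ?M"
      using lc_step_measurable[OF lc_lift_real_step[OF t]] by (simp add: measurable_restrict_space1 measurable_completion)
    have "(\<lambda>n. \<integral>x. \<bar>\<phi> n x * \<kappa> x\<bar> powr p \<partial>?M) \<longlonglongrightarrow> (\<integral>x. \<bar>f x * \<kappa> x\<bar> powr p \<partial>?M)"
    proof (rule integral_dominated_convergence[OF _ _ h(1)])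
      show "AE x in ?M. (\<lambda>n. \<bar>\<phi> n x * \<kappa> x\<bar> powr p) \<longlonglongrightarrow> \<bar>f x * \<kappa> x\<bar> powr p"
        using lim
      proof eventually_elim
        case (elim x)
        then show ?case using p by (intro tendsto_intros) auto
      qed
      show "AE x in ?M. norm (\<bar>\<phi> n x * \<kappa> x\<bar> powr p) \<le> h x" for n
        using h(2)
      proof eventually_elim
        case (elim x)
        have "\<bar>\<phi> n x * \<kappa> x\<bar> powr p \<le> \<bar>\<phi> n x\<bar> powr p"
          using p \<kappa>[of x] by (intro powr_mono2) (auto simp: abs_mult mult_left_le)
        with elim show ?case by (auto intro: order_trans)
      qed
    qed measurable
    then have "(\<lambda>n. (\<integral>x. \<bar>\<phi> n x * \<kappa> x\<bar> powr p \<partial>?M) powr (1 / p)) \<longlonglongrightarrow> (\<integral>x. \<bar>f x * \<kappa> x\<bar> powr p \<partial>?M) powr (1 / p)"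
      using p by (intro tendsto_powr' tendsto_const) (auto intro!: always_eventually integral_nonneg_AE)
    then have "weak_lim (\<lambda>n. of_real (real_Lp_norm (ereal p) (ivl_set I) (\<lambda>x. \<phi> n x * \<kappa> x)))
        (of_real (real_Lp_norm (ereal p) (ivl_set I) (\<lambda>x. f x * \<kappa> x)))"
      by (intro weak_lim_of_real) (simp add: real_Lp_norm_def)
    moreover have "lc_lift (B n \<union> T) (\<lambda>x. \<phi> n x * \<kappa> x) (\<lambda>x. s n x * t x)" for n
      by (rule lc_lift_combine[OF s t]) simp
    then have "has_lc_norm (ereal p) (lc_ivl I) (\<lambda>x. s n x * t x)
        (of_real (real_Lp_norm (ereal p) (ivl_set I) (\<lambda>x. \<phi> n x * \<kappa> x)))" for n
      using I by (rule lift_norm)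
    ultimately show ?thesis
      unfolding weak_lim_norm_def
      by (intro exI[of _ "\<lambda>n. of_real (real_Lp_norm (ereal p) (ivl_set I) (\<lambda>x. \<phi> n x * \<kappa> x))"] conjI allI)
  qed
  have one: "lc_lift {} (\<lambda>_. 1) (\<lambda>_. 1)" by (simp add: lc_lift_def)
  have diff: "has_lc_norm (ereal p) (lc_ivl I) (\<lambda>x. s n x - s m x)
      (of_real (real_Lp_norm (ereal p) (ivl_set I) (\<lambda>x. \<phi> n x - \<phi> m x)))" for n m
    by (rule lift_norm[OF lc_lift_combine[OF s s] I]) simp
  have diff_le: "(\<integral>x. \<bar>\<phi> n x - \<phi> m x\<bar> powr p \<partial>?M) \<le> 2 powr p * ((1 / 2) ^ n + (1 / 2) ^ m)" for n m
  proof -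
    let ?w = "\<lambda>x. 2 powr p * (\<bar>\<phi> n x - f x\<bar> powr p + \<bar>\<phi> m x - f x\<bar> powr p)"
    have w: "integrable ?M ?w" using int by simp
    have le: "\<bar>\<phi> n x - \<phi> m x\<bar> powr p \<le> ?w x" for x
      using powr_abs_add_le[of p "\<phi> n x - f x" "f x - \<phi> m x"] p by (simp add: abs_minus_commute)
    have "(\<integral>x. \<bar>\<phi> n x - \<phi> m x\<bar> powr p \<partial>?M) \<le> (\<integral>x. ?w x \<partial>?M)"
    proof (rule integral_mono[OF _ w le])
      show "integrable ?M (\<lambda>x. \<bar>\<phi> n x - \<phi> m x\<bar> powr p)"
        by (rule Bochner_Integration.integrable_bound[OF w]) (use le in \<open>auto intro!: AE_I2 intro: order_trans\<close>)
    qed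
    also have "\<dots> = 2 powr p * ((\<integral>x. \<bar>\<phi> n x - f x\<bar> powr p \<partial>?M) + (\<integral>x. \<bar>\<phi> m x - f x\<bar> powr p \<partial>?M))"
      using int by simp
    also have "\<dots> \<le> 2 powr p * ((1 / 2) ^ n + (1 / 2) ^ m)"
      using less by (intro mult_left_mono add_mono) (auto simp: less_imp_le)
    finally show ?thesis .
  qed
  have "weakly_Cauchy (ereal p) (lc_ivl I) s"
    unfolding weakly_Cauchy_def
  proof (intro conjI allI impI)
    show "s n \<in> lc_Lp (ereal p) (lc_ivl I)" for n
      using lift_norm[OF s I, of p n] by (simp add: has_lc_norm_def)
    fix \<epsilon> :: real assume \<epsilon>: "0 < \<epsilon>"
    have "(\<lambda>n. 2 powr p * ((1 / 2) ^ n + (1 / 2) ^ n) :: real) \<longlonglongrightarrow> 2 powr p * (0 + 0)"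
      by (intro tendsto_intros LIMSEQ_power_zero) auto
    then have "\<forall>\<^sub>F n in sequentially. 2 powr p * ((1 / 2) ^ n + (1 / 2) ^ n) < \<epsilon> powr p"
      by (rule order_tendstoD(2)) (use \<epsilon> in simp)
    then obtain n0 where n0: "2 powr p * ((1 / 2) ^ n0 + (1 / 2) ^ n0) < \<epsilon> powr p"
      using eventually_happens trivial_limit_sequentially by blast
    show "\<exists>n0. \<forall>m>n0. \<forall>n>n0. \<exists>N. has_lc_norm (ereal p) (lc_ivl I) (\<lambda>x. s n x - s m x) N \<and> weakly_small \<epsilon> N"
    proof (intro exI[of _ n0] allI impI)
      fix m n assume mn: "n0 < m" "n0 < n"
      have "(\<integral>x. \<bar>\<phi> n x - \<phi> m x\<bar> powr p \<partial>?M) \<le> 2 powr p * ((1 / 2) ^ n + (1 / 2) ^ m)"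
        by (rule diff_le)
      also have "\<dots> \<le> 2 powr p * ((1 / 2) ^ n0 + (1 / 2) ^ n0)"
        using mn by (intro mult_left_mono add_mono power_decreasing) auto
      also note n0
      finally have "(\<integral>x. \<bar>\<phi> n x - \<phi> m x\<bar> powr p \<partial>?M) powr (1 / p) < (\<epsilon> powr p) powr (1 / p)"
        using p by (intro powr_less_mono2) (auto intro!: integral_nonneg_AE)
      also have "(\<epsilon> powr p) powr (1 / p) = \<epsilon>" using p \<epsilon> by (simp add: powr_powr)
      finally have "\<bar>real_Lp_norm (ereal p) (ivl_set I) (\<lambda>x. \<phi> n x - \<phi> m x)\<bar> < \<epsilon>"
        by (simp add: real_Lp_norm_def)
      from diff[of n m] weakly_small_of_real[OF this]
      show "\<exists>N. has_lc_norm (ereal p) (lc_ivl I) (\<lambda>x. s n x - s m x) N \<and> weakly_small \<epsilon> N"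
        by blast
    qed
  qed
  moreover have "lc_measurable_fun (lc_ivl I) (s n)" for n
    using lift_norm[OF s I, of p n] by (simp add: has_lc_norm_def lc_Lp_def)
  moreover have "weak_lim_norm (ereal p) (lc_ivl I) s (of_real (real_Lp_norm (ereal p) (ivl_set I) f))"
    using norms[OF one] by simp
  moreover have "weak_lim_norm (ereal p) (lc_ivl I) (\<lambda>n x. s n x * indicator (lc_ivl J) x)
        (of_real (real_Lp_norm (ereal p) (ivl_set I) (\<lambda>x. f x * indicator (ivl_set J) x)))" for J
    by (rule norms[OF lc_lift_indicator]) (simp add: indicator_def)
  moreover have "AE x in ?M. \<exists>r :: nat \<Rightarrow> nat. strict_mono r \<and>
      weak_lim (\<lambda>k. s (r k) (of_real x)) (of_real (f x))"
    using lim
  proof eventually_elim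
    case (elim x)
    then show ?case
      by (intro exI[of _ id]) (simp add: strict_mono_id lc_lift_of_real[OF s] weak_lim_of_real)
  qed
  ultimately show ?thesis unfolding approximates_def by blast
qed

section \<open>Essential suprema\<close>

lemma not_AE_interval: "u < v \<Longrightarrow> \<not> (AE x in lebesgue. \<not> (u < x \<and> x < v))" for u v :: real
proof
  assume uv: "u < v" and ae: "AE x in lebesgue. \<not> (u < x \<and> x < v)"
  have "{u<..<v} \<in> null_sets lebesgue"
    using ae by (subst AE_iff_null_sets) auto
  then have "emeasure lebesgue {u<..<v} = 0" by (rule null_setsD1)
  with uv show False by simp
qed

lemma real_Lp_norm_inf:
  assumes g [measurable]: "g \<in> borel_measurable (lebesgue_on (ivl_set I))" and I: "lo I < hi I"
    and fin: "esssup (lebesgue_on (ivl_set I)) (\<lambda>x. ereal \<bar>g x\<bar>) < \<infinity>"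
  shows real_Lp_norm_inf_AE: "AE x in lebesgue_on (ivl_set I). \<bar>g x\<bar> \<le> real_Lp_norm \<infinity> (ivl_set I) g"
    and real_Lp_norm_inf_least:
      "\<And>r. AE x in lebesgue_on (ivl_set I). \<bar>g x\<bar> \<le> r \<Longrightarrow> real_Lp_norm \<infinity> (ivl_set I) g \<le> r"
    and real_Lp_norm_inf_nonneg: "0 \<le> real_Lp_norm \<infinity> (ivl_set I) g"
proof -
  let ?M = "lebesgue_on (ivl_set I)"
  define E where "E = esssup ?M (\<lambda>x. ereal \<bar>g x\<bar>)"
  \<comment> \<open>Positive measure of the interval keeps the essential supremum from being
    -\<infinity>, so it is the real number read off by \<open>real_of_ereal\<close>.\<close>
  have nAE: "\<not> (AE x in ?M. False)"
  proof
    assume "AE x in ?M. False"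
    then have "AE x in lebesgue. x \<notin> ivl_set I"
      by (simp add: AE_lebesgue_on_iff ivl_set_lebesgue)
    then have "AE x in lebesgue. \<not> (lo I < x \<and> x < hi I)"
      by (rule eventually_mono) (use open_subset_ivl_set[of I] in auto)
    with not_AE_interval[OF I] show False by simp
  qed
  have ae: "AE x in ?M. ereal \<bar>g x\<bar> \<le> E" unfolding E_def by (rule esssup_AE)
  have "0 \<le> E"
  proof (rule ccontr)
    assume n: "\<not> 0 \<le> E"
    have "AE x in ?M. False"
      using ae
    proof eventually_elim
      case (elim x)
      have "0 \<le> ereal \<bar>g x\<bar>" by simp
      with elim n show ?case by (meson order_trans)
    qed
    with nAE show False by simp
  qed
  with fin obtain N where N: "E = ereal N" "0 \<le> N"
    by (cases E) (auto simp: E_def)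
  have eq: "real_Lp_norm \<infinity> (ivl_set I) g = N"
    using N by (simp add: real_Lp_norm_def E_def)
  show "0 \<le> real_Lp_norm \<infinity> (ivl_set I) g" using N eq by simp
  show "AE x in ?M. \<bar>g x\<bar> \<le> real_Lp_norm \<infinity> (ivl_set I) g"
    using ae unfolding eq N by simp
  fix r assume "AE x in ?M. \<bar>g x\<bar> \<le> r"
  then have "E \<le> ereal r" unfolding E_def by (intro esssup_I) auto
  then show "real_Lp_norm \<infinity> (ivl_set I) g \<le> r" using eq N by simp
qed

text \<open>The essential supremum of \<open>\<bar>f\<bar>\<close> over the open interval is greater
  than \<open>r\<close>, expressed without forming it. It fails on empty intervals and holds on
  nonempty ones for every negative \<open>r\<close>.\<close>

definition exceeds :: "(real \<Rightarrow> real) \<Rightarrow> real \<Rightarrow> real \<Rightarrow> real \<Rightarrow> bool" where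
  "exceeds f u v r \<longleftrightarrow> \<not> (AE x in lebesgue. u < x \<and> x < v \<longrightarrow> \<bar>f x\<bar> \<le> r)"

lemma exceeds_mono: "exceeds f u v r \<Longrightarrow> u' \<le> u \<Longrightarrow> v \<le> v' \<Longrightarrow> r' \<le> r \<Longrightarrow> exceeds f u' v' r'"
  unfolding exceeds_def by (erule contrapos_nn, erule eventually_mono) auto

lemma exceeds_negative: "u < v \<Longrightarrow> r < 0 \<Longrightarrow> exceeds f u v r"
  using not_AE_interval[of u v] unfolding exceeds_def
  by (auto elim!: eventually_mono contrapos_nn)


text \<open>The open interval is a countable union of smaller ones with rational ends; if none of
  them exceeded \<open>r\<close>, the exceptional set would be a countable union of null
  sets.\<close>

lemma exceeds_rational:
  assumes "exceeds f u v r"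
  obtains \<alpha> \<beta> :: rat where "u < of_rat \<alpha>" "of_rat \<beta> < v" "exceeds f (of_rat \<alpha>) (of_rat \<beta>) r"
proof (rule ccontr)
  assume "\<not> thesis"
  with that have "AE x in lebesgue. u < of_rat \<alpha> \<longrightarrow> of_rat \<beta> < v \<longrightarrow> of_rat \<alpha> < x \<and> x < of_rat \<beta> \<longrightarrow> \<bar>f x\<bar> \<le> r"
    for \<alpha> \<beta> :: rat
    by (cases "u < of_rat \<alpha> \<and> of_rat \<beta> < v") (auto simp: exceeds_def)
  then have "AE x in lebesgue. \<forall>\<alpha> \<beta> :: rat. u < of_rat \<alpha> \<longrightarrow> of_rat \<beta> < v \<longrightarrow> of_rat \<alpha> < x \<and> x < of_rat \<beta> \<longrightarrow> \<bar>f x\<bar> \<le> r"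
    by (simp add: AE_all_countable)
  then have "AE x in lebesgue. u < x \<and> x < v \<longrightarrow> \<bar>f x\<bar> \<le> r"
  proof eventually_elim
    case (elim x)
    show ?case
    proof
      assume x: "u < x \<and> x < v"
      obtain \<alpha> \<beta> where "u < of_rat \<alpha>" "of_rat \<alpha> < x" "x < of_rat \<beta>" "of_rat \<beta> < v"
        using x of_rat_dense[of u x] of_rat_dense[of x v] by blast
      with elim show "\<bar>f x\<bar> \<le> r" by blast
    qed
  qed
  with assms show False by (simp add: exceeds_def)
qed

text \<open>Move right from \<open>u\<close> until the level is first exceeded: the supremum of the
  ends x with no excess on (u, x) has an excess in each of its right neighbourhoods.\<close>

lemma exceeds_right_limit:
  assumes ex: "exceeds f u v r"
  obtains t where "u \<le> t" "t < v" "\<And>w. t < w \<Longrightarrow> exceeds f t w r"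
proof -
  have uv: "u < v"
  proof (rule ccontr)
    assume "\<not> u < v"
    then have "\<not> (u < x \<and> x < v)" for x by auto
    with ex show False by (simp add: exceeds_def)
  qed
  define S where "S = {x. u \<le> x \<and> x \<le> v \<and> \<not> exceeds f u x r}"
  have "\<not> exceeds f u u r" by (simp add: exceeds_def)
  then have uS: "u \<in> S" using uv by (simp add: S_def)
  have bdd: "bdd_above S" by (rule bdd_aboveI[of _ v]) (simp add: S_def)
  define c where "c = Sup S"
  have c: "u \<le> c" "c \<le> v"
    unfolding c_def using uS bdd by (auto intro!: cSup_upper cSup_least simp: S_def)
  have below: "\<not> exceeds f u x r" if xc: "x < c" for x
  proof -
    obtain y where "y \<in> S" "x < y"
      using less_cSupE[of x S] uS xc unfolding c_def by blast
    then show ?thesis using exceeds_mono[of f u x r u y r] by (auto simp: S_def)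
  qed
  have nc: "\<not> exceeds f u c r"
  proof
    assume "exceeds f u c r"
    then obtain \<alpha> \<beta> where "u < of_rat \<alpha>" "of_rat \<beta> < c" "exceeds f (of_rat \<alpha>) (of_rat \<beta>) r"
      by (rule exceeds_rational)
    with below[of "of_rat \<beta>"] show False by (meson exceeds_mono less_imp_le order_refl)
  qed
  with ex c have "c < v" by (cases "c = v") auto
  moreover have "exceeds f c w r" if "c < w" for w
  proof (rule ccontr)
    assume n: "\<not> exceeds f c w r"
    define w' where "w' = min w v"
    have w': "c < w'" "w' \<le> v" "w' \<le> w" using that \<open>c < v\<close> by (auto simp: w'_def)
    have "AE x in lebesgue. x \<notin> {c}"
      by (rule AE_not_in) (simp add: negligible_iff_null_sets [symmetric])
    moreover have "AE x in lebesgue. u < x \<and> x < c \<longrightarrow> \<bar>f x\<bar> \<le> r" using nc by (simp add: exceeds_def)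
    moreover have "AE x in lebesgue. c < x \<and> x < w \<longrightarrow> \<bar>f x\<bar> \<le> r" using n by (simp add: exceeds_def)
    ultimately have "AE x in lebesgue. u < x \<and> x < w' \<longrightarrow> \<bar>f x\<bar> \<le> r"
      by eventually_elim (use w' in auto)
    then have "w' \<in> S" using w' c by (simp add: S_def exceeds_def)
    then have "w' \<le> c" unfolding c_def using bdd by (rule cSup_upper)
    with w' show False by simp
  qed
  ultimately show thesis using that c(1) by blast
qed

section \<open>The exponent infinity\<close>

text \<open>Comparisons are lexicographic in \<open>a\<close>, \<open>b\<close>, \<open>c\<close>,
  but weak smallness treats the three alike: a tiny positive \<open>a\<close> dominates the order
  and disappears in the weak limit.\<close>

definition tri :: "real \<Rightarrow> real \<Rightarrow> real \<Rightarrow> levi_civita" where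
  "tri a b c = of_real a * lc_d (- 2) + of_real b * lc_d (- 1) + of_real c"

lemma coef_tri: "coef (tri a b c) q = (if q = - 2 then a else if q = - 1 then b else if q = 0 then c else 0)"
  by (simp add: tri_def)

lemma tri_diff: "tri a b c - tri a' b' c' = tri (a - a') (b - b') (c - c')"
  by (rule levi_civita_eqI) (simp add: coef_tri)

lemma tri_uminus: "- tri a b c = tri (- a) (- b) (- c)"
  by (rule levi_civita_eqI) (simp add: coef_tri)

lemma tri_real: "tri 0 0 c = of_real c"
  by (simp add: tri_def)

lemma tri_less:
  assumes "a < a' \<or> a = a' \<and> (b < b' \<or> b = b' \<and> c < c')"
  shows "tri a b c < tri a' b' c'"
proof -
  consider "a < a'" | "a = a'" "b < b'" | "a = a'" "b = b'" "c < c'" using assms by blast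
  then show ?thesis
  proof cases
    case 1
    then show ?thesis unfolding less_coef_iff by (intro exI[of _ "- 2"]) (simp add: coef_tri)
  next
    case 2
    then show ?thesis unfolding less_coef_iff by (intro exI[of _ "- 1"]) (simp add: coef_tri)
  next
    case 3
    then show ?thesis unfolding less_coef_iff by (intro exI[of _ 0]) (simp add: coef_tri)
  qed
qed

lemma tri_le:
  assumes "a < a' \<or> a = a' \<and> (b < b' \<or> b = b' \<and> c \<le> c')"
  shows "tri a b c \<le> tri a' b' c'"
  using assms tri_less[of a a' b b' c c'] by (cases "a = a' \<and> b = b' \<and> c = c'") force+

lemma abs_tri_le:
  assumes "\<bar>a\<bar> < a' \<or> \<bar>a\<bar> \<le> a' \<and> b = 0 \<and> c = 0"
  shows "\<bar>tri a b c\<bar> \<le> tri a' 0 0"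
  unfolding abs_le_iff tri_uminus using assms by (intro conjI tri_le) auto

lemma weakly_small_tri: "\<bar>a\<bar> < \<epsilon> \<Longrightarrow> \<bar>b\<bar> < \<epsilon> \<Longrightarrow> \<bar>c\<bar> < \<epsilon> \<Longrightarrow> weakly_small \<epsilon> (tri a b c)"
  by (auto simp: weakly_small_def coef_tri)

section \<open>Infinitesimal slots\<close>

lemma infinitesimal_less: "0 < e \<Longrightarrow> of_real c * lc_d 1 < of_real e"
  unfolding less_coef_iff by (rule exI[of _ 0]) auto

text \<open>Slots lie infinitely close to the right of real points. Hence a real interval, transferred to the
  field, either contains a given slot or is disjoint from it.\<close>

definition slot :: "(nat \<Rightarrow> real) \<Rightarrow> nat \<Rightarrow> levi_civita set" where
  "slot \<sigma> j = {of_real (\<sigma> j) + of_real (real j) * lc_d 1 <..< of_real (\<sigma> j) + of_real (real (Suc j)) * lc_d 1}"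

lemma slot_nonempty: "of_real (\<sigma> j) + of_real (real j) * lc_d 1 < of_real (\<sigma> j) + of_real (real (Suc j)) * lc_d 1"
  by (intro add_strict_left_mono mult_strict_right_mono) auto

lemma slot_bounds:
  assumes "x \<in> slot \<sigma> j"
  shows "of_real (\<sigma> j) < x" and "\<sigma> j < v \<Longrightarrow> x < of_real v"
proof -
  have "0 \<le> of_real (real j) * lc_d 1"
    by (intro mult_nonneg_nonneg less_imp_le[OF lc_d_pos]) simp
  then have "of_real (\<sigma> j) \<le> of_real (\<sigma> j) + of_real (real j) * lc_d 1" by simp
  also have "\<dots> < x" using assms by (simp add: slot_def)
  finally show "of_real (\<sigma> j) < x" .
  assume "\<sigma> j < v"
  then have "of_real (real (Suc j)) * lc_d 1 < of_real (v - \<sigma> j)"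
    by (intro infinitesimal_less) simp
  then have "of_real (\<sigma> j) + of_real (real (Suc j)) * lc_d 1 < of_real v"
    by (simp add: less_diff_eq add.commute del: of_nat_Suc)
  moreover have "x < of_real (\<sigma> j) + of_real (real (Suc j)) * lc_d 1"
    using assms by (simp add: slot_def)
  ultimately show "x < of_real v" by (rule less_trans[rotated])
qed

text \<open>Slots at different real points have the larger of these points between them; slots at
  the same point are consecutive multiples of d away from it.\<close>

lemma slot_disjoint:
  assumes x: "x \<in> slot \<sigma> i" "x \<in> slot \<sigma> j"
  shows "i = j"
proof -
  have "\<not> \<sigma> i < \<sigma> j" "\<not> \<sigma> j < \<sigma> i"
    using slot_bounds[OF x(1)] slot_bounds[OF x(2)] less_asym by blast+
  then have eq: "\<sigma> i = \<sigma> j" by simp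
  have "\<not> i < j" if "x \<in> slot \<sigma> i" "x \<in> slot \<sigma> j" "\<sigma> i = \<sigma> j" for i j
  proof
    assume "i < j"
    then have "of_real (real (Suc i)) * lc_d 1 \<le> of_real (real j) * lc_d 1"
      by (intro mult_right_mono less_imp_le[OF lc_d_pos]) (simp del: of_nat_Suc)
    then have "of_real (\<sigma> i) + of_real (real (Suc i)) * lc_d 1 \<le> of_real (\<sigma> j) + of_real (real j) * lc_d 1"
      using that(3) by simp
    moreover have "x < of_real (\<sigma> i) + of_real (real (Suc i)) * lc_d 1"
      "of_real (\<sigma> j) + of_real (real j) * lc_d 1 < x"
      using that by (auto simp: slot_def)
    ultimately show False by (meson less_asym less_le_trans)
  qed
  with x eq show ?thesis by (metis neqE)
qed

lemma of_real_notin_slot: "of_real r \<notin> slot \<sigma> j"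
proof
  assume r: "of_real r \<in> slot \<sigma> j"
  with slot_bounds(1)[OF r] slot_bounds(2)[OF r, of r] show False by simp
qed

text \<open>Together with \<open>slot_subset_ivl\<close>: whether a slot belongs to \<open>J\<close>
  is decided by a half-open condition on its real point, whatever the type of
  \<open>J\<close>.\<close>

lemma slot_meets_ivl:
  assumes "x \<in> slot \<sigma> j" "x \<in> lc_ivl J"
  shows "lo J \<le> \<sigma> j" "\<sigma> j < hi J"
proof -
  have J: "of_real (lo J) \<le> x" "x \<le> of_real (hi J)"
    using assms(2) ivl_set_subset_closed[of "map_ivl of_real J :: levi_civita ivl"] by (auto simp: lc_ivl_def)
  show "lo J \<le> \<sigma> j" using slot_bounds(2)[OF assms(1), of "lo J"] J(1) by (metis not_le)
  have "of_real (\<sigma> j) < (of_real (hi J) :: levi_civita)"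
    using slot_bounds(1)[OF assms(1)] J(2) by (rule less_le_trans)
  then show "\<sigma> j < hi J" by simp
qed

lemma slot_subset_ivl:
  assumes "lo J \<le> \<sigma> j" "\<sigma> j < hi J"
  shows "slot \<sigma> j \<subseteq> lc_ivl J"
proof
  fix x assume x: "x \<in> slot \<sigma> j"
  have "of_real (lo J) < x" 
    using slot_bounds(1)[OF x] assms(1) by (metis le_less_trans of_real_le_lc_iff)
  moreover have "x < of_real (hi J)" using slot_bounds(2)[OF x assms(2)] .
  ultimately show "x \<in> lc_ivl J"
    using open_subset_ivl_set[of "map_ivl of_real J :: levi_civita ivl"] by (auto simp: lc_ivl_def)
qed

lemma lc_step_slots:
  "\<exists>B. lc_step B (\<lambda>x. {j. j < m \<and> x \<in> slot \<sigma> j})"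
proof (induction m)
  case 0
  show ?case using lc_step_const[of "{}"] by auto
next
  case (Suc m)
  then obtain B where B: "lc_step B (\<lambda>x. {j. j < m \<and> x \<in> slot \<sigma> j})" by blast
  obtain K where K: "slot \<sigma> m = ivl_set K"
    unfolding slot_def by (metis ivl_set.simps(1))
  have "lc_step {lo K, hi K} (\<lambda>x. x \<in> slot \<sigma> m)" unfolding K by (rule lc_step_ivl)
  from lc_step_combine[OF B this, of "\<lambda>A b. if b then insert m A else A"]
  have "lc_step (B \<union> {lo K, hi K}) (\<lambda>x. if x \<in> slot \<sigma> m then insert m {j. j < m \<and> x \<in> slot \<sigma> j} else {j. j < m \<and> x \<in> slot \<sigma> j})" .
  moreover have "(if x \<in> slot \<sigma> m then insert m {j. j < m \<and> x \<in> slot \<sigma> j} else {j. j < m \<and> x \<in> slot \<sigma> j}) =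
      {j. j < Suc m \<and> x \<in> slot \<sigma> j}" for x
    by (auto simp: less_Suc_eq)
  ultimately show ?case by auto
qed

text \<open>The first half makes each \<open>\<rho> i\<close> a lower bound for the essential
  supremum immediately to the right of \<open>\<tau> i\<close>; the second makes the samples in
  \<open>[u, v)\<close> approach the essential supremum on \<open>(u, v)\<close>, matching the
  half-open rule for slots. Levels down to -1 leave room for functions vanishing on an interval,
  where only negative levels are exceeded.\<close>

definition samples_sup :: "(real \<Rightarrow> real) \<Rightarrow> real ivl \<Rightarrow> (nat \<Rightarrow> real) \<Rightarrow> (nat \<Rightarrow> real) \<Rightarrow> bool" where
  "samples_sup f I \<tau> \<rho> \<longleftrightarrow>
    (\<forall>i. lo I \<le> \<tau> i \<and> \<tau> i < hi I \<and> - 1 \<le> \<rho> i \<and> (\<forall>w>\<tau> i. exceeds f (\<tau> i) w (\<rho> i))) \<and>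
    (\<forall>u v r e. lo I \<le> u \<longrightarrow> v \<le> hi I \<longrightarrow> exceeds f u v r \<longrightarrow> - 1 < r \<longrightarrow> e < r \<longrightarrow>
      (\<exists>i. u \<le> \<tau> i \<and> \<tau> i < v \<and> e < \<rho> i))"

lemma sampling_points:
  assumes I: "lo I < hi I"
  shows "\<exists>\<tau> \<rho>. samples_sup f I \<tau> \<rho>"
proof -
  \<comment> \<open>Countably many candidates suffice: every excess already shows on a rational
    interval, at a rational level arbitrarily close below the given one.\<close>
  define Q :: "(rat \<times> rat \<times> rat) set" where "Q = {(\<alpha>, \<beta>, q). lo I \<le> of_rat \<alpha> \<and> of_rat \<beta> \<le> hi I \<and> - 1 \<le> q \<and>
      exceeds f (of_rat \<alpha>) (of_rat \<beta>) (of_rat q)}"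
  have sample: "\<exists>\<alpha> \<beta> q. (\<alpha>, \<beta>, q) \<in> Q \<and> u < of_rat \<alpha> \<and> of_rat \<beta> < v \<and> e < of_rat q"
    if uv: "lo I \<le> u" "v \<le> hi I" "exceeds f u v r" "- 1 < r" "e < r" for u v r e :: real
  proof -
    obtain q where q: "max e (- 1) < of_rat q" "of_rat q < r"
      using of_rat_dense[of "max e (- 1)" r] uv by auto
    have "exceeds f u v (of_rat q)" using uv(3) by (rule exceeds_mono) (use q in auto)
    then obtain \<alpha> \<beta> where ab: "u < of_rat \<alpha>" "of_rat \<beta> < v" "exceeds f (of_rat \<alpha>) (of_rat \<beta>) (of_rat q)"
      by (rule exceeds_rational)
    have "of_rat (- 1) < (of_rat q :: real)" using q by simp
    then have "- 1 \<le> q" unfolding of_rat_less by simp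
    with ab q uv have "(\<alpha>, \<beta>, q) \<in> Q" by (simp add: Q_def)
    with ab q show ?thesis by (intro exI[of _ \<alpha>] exI[of _ \<beta>] exI[of _ q]) auto
  qed
  have ne: "Q \<noteq> {}"
  proof -
    have "exceeds f (lo I) (hi I) (- (1 / 2))" using I by (rule exceeds_negative) simp
    from sample[OF _ _ this, of "- 1"] show ?thesis by auto
  qed
  define R where "R x t \<longleftrightarrow> (x \<in> Q \<longrightarrow> of_rat (fst x) \<le> t \<and> t < of_rat (fst (snd x)) \<and>
      (\<forall>w>t. exceeds f t w (of_rat (snd (snd x)))))" for x and t :: real
  have "\<exists>t. R x t" for x
  proof (cases "x \<in> Q")
    case True
    then have "exceeds f (of_rat (fst x)) (of_rat (fst (snd x))) (of_rat (snd (snd x)))"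
      by (auto simp: Q_def)
    then show ?thesis using exceeds_right_limit unfolding R_def by blast
  qed (simp add: R_def)
  then obtain t where "\<And>x. R x (t x)" by metis
  then have t: "of_rat \<alpha> \<le> t (\<alpha>, \<beta>, q)" "t (\<alpha>, \<beta>, q) < of_rat \<beta>"
    "\<And>w. t (\<alpha>, \<beta>, q) < w \<Longrightarrow> exceeds f (t (\<alpha>, \<beta>, q)) w (of_rat q)"
    if "(\<alpha>, \<beta>, q) \<in> Q" for \<alpha> \<beta> q
    using that unfolding R_def by fastforce+
  define E where "E = from_nat_into Q"
  have E: "E i \<in> Q" for i unfolding E_def by (rule from_nat_into[OF ne])
  have surj: "\<exists>i. E i = x" if "x \<in> Q" for x
    using that range_from_nat_into[OF ne countableI_type] unfolding E_def by (metis rangeE)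
  define \<tau> where "\<tau> i = t (E i)" for i
  define \<rho> :: "nat \<Rightarrow> real" where "\<rho> i = of_rat (snd (snd (E i)))" for i
  have i: "lo I \<le> \<tau> i \<and> \<tau> i < hi I \<and> - 1 \<le> \<rho> i \<and> (\<forall>w>\<tau> i. exceeds f (\<tau> i) w (\<rho> i))" for i
  proof (cases "E i")
    case (fields \<alpha> \<beta> q)
    then have Q: "(\<alpha>, \<beta>, q) \<in> Q" using E[of i] by simp
    then have q: "lo I \<le> of_rat \<alpha>" "of_rat \<beta> \<le> hi I" "- 1 \<le> q" by (auto simp: Q_def)
    have "of_rat (- 1) \<le> (of_rat q :: real)" unfolding of_rat_less_eq by (rule q)
    with t[OF Q] q fields show ?thesis by (fastforce simp: \<tau>_def \<rho>_def)
  qed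
  have "samples_sup f I \<tau> \<rho>"
    unfolding samples_sup_def
  proof (rule conjI, rule allI, rule i, intro allI impI)
    fix u v r e :: real
    assume "lo I \<le> u" "v \<le> hi I" "exceeds f u v r" "- 1 < r" "e < r"
    then obtain \<alpha> \<beta> q where q: "(\<alpha>, \<beta>, q) \<in> Q" "u < of_rat \<alpha>" "of_rat \<beta> < v" "e < of_rat q"
      using sample by blast
    obtain i where "E i = (\<alpha>, \<beta>, q)" using surj[OF q(1)] by blast
    then show "\<exists>i. u \<le> \<tau> i \<and> \<tau> i < v \<and> e < \<rho> i"
      using t(1,2)[OF q(1)] q by (intro exI[of _ i]) (auto simp: \<tau>_def \<rho>_def)
  qed
  then show ?thesis by blast
qed

text \<open>Endpoints of \<open>J\<close> are null, so only its interior counts. Values 0 of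
  \<open>g\<close> outside \<open>J\<close> never exceed a nonnegative level, and negative levels
  are exceeded on any nonempty interval.\<close>

lemma sup_norm_local:
  assumes g: "g \<in> borel_measurable (lebesgue_on (ivl_set I))"
      "esssup (lebesgue_on (ivl_set I)) (\<lambda>x. ereal \<bar>g x\<bar>) < \<infinity>"
    and gf: "\<And>x. x \<in> ivl_set I \<Longrightarrow> g x = f x * indicator (ivl_set J) x"
    and J: "lo I \<le> lo J" "lo J < hi J" "hi J \<le> hi I"
  shows sup_norm_upper: "\<And>t r. lo J \<le> t \<Longrightarrow> t < hi J \<Longrightarrow> (\<And>w. t < w \<Longrightarrow> exceeds f t w r) \<Longrightarrow>
      r \<le> real_Lp_norm \<infinity> (ivl_set I) g"
    and sup_norm_lower: "\<And>r. r < real_Lp_norm \<infinity> (ivl_set I) g \<Longrightarrow> exceeds f (lo J) (hi J) r"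
proof -
  let ?N = "real_Lp_norm \<infinity> (ivl_set I) g"
  have I: "lo I < hi I" using J by simp
  have inI: "x \<in> ivl_set I" "x \<in> ivl_set J" if "lo J < x" "x < hi J" for x
    using that J open_subset_ivl_set[of I] open_subset_ivl_set[of J] by auto
  show "r \<le> ?N" if t: "lo J \<le> t" "t < hi J" "\<And>w. t < w \<Longrightarrow> exceeds f t w r" for t r
  proof (rule ccontr)
    assume n: "\<not> r \<le> ?N"
    have "AE x in lebesgue. x \<in> ivl_set I \<longrightarrow> \<bar>g x\<bar> \<le> ?N"
      using real_Lp_norm_inf_AE[OF g(1) I g(2)] by (simp add: AE_lebesgue_on_iff ivl_set_lebesgue)
    then have "AE x in lebesgue. t < x \<and> x < hi J \<longrightarrow> \<bar>f x\<bar> \<le> r"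
    proof eventually_elim
      case (elim x)
      show ?case
      proof
        assume "t < x \<and> x < hi J"
        with t have x: "lo J < x" "x < hi J" by auto
        from elim inI[OF x] gf[OF inI(1)[OF x]] n show "\<bar>f x\<bar> \<le> r" by simp
      qed
    qed
    with t(3)[OF t(2)] show False by (simp add: exceeds_def)
  qed
  show "exceeds f (lo J) (hi J) r" if r: "r < ?N" for r
  proof (cases "r < 0")
    case True
    with J(2) show ?thesis by (rule exceeds_negative)
  next
    case False
    show ?thesis
    proof (rule ccontr)
      assume "\<not> exceeds f (lo J) (hi J) r"
      then have 1: "AE x in lebesgue. lo J < x \<and> x < hi J \<longrightarrow> \<bar>f x\<bar> \<le> r" by (simp add: exceeds_def)
      have 2: "AE x in lebesgue. x \<notin> {lo J, hi J}"
        by (rule AE_not_in) (simp add: negligible_iff_null_sets [symmetric])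
      from 1 2 have "AE x in lebesgue. x \<in> ivl_set I \<longrightarrow> \<bar>g x\<bar> \<le> r"
      proof eventually_elim
        case (elim x)
        show ?case
        proof
          assume x: "x \<in> ivl_set I"
          show "\<bar>g x\<bar> \<le> r"
          proof (cases "x \<in> ivl_set J")
            case True
            then have "lo J \<le> x" "x \<le> hi J" using ivl_set_subset_closed[of J] by auto
            with elim True gf[OF x] show ?thesis by auto
          qed (use gf[OF x] False in auto)
        qed
      qed
      then have "?N \<le> r"
        by (intro real_Lp_norm_inf_least[OF g(1) I g(2)]) (simp add: AE_lebesgue_on_iff ivl_set_lebesgue)
      with r show False by simp
    qed
  qed
qed

text \<open>The even slots carry the sampled values of \<open>f\<close>; the factor \<open>\<rho> + 2\<close> is positive since all samples
  are at least \<open>-1\<close>. Among the odd slots, the slot \<open>2 n + 1\<close> has opposite signs in the members \<open>n\<close> and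
  \<open>m > n\<close> of the sequence.\<close>

definition slot_value :: "nat \<Rightarrow> (nat \<Rightarrow> real) \<Rightarrow> nat \<Rightarrow> levi_civita" where
  "slot_value n \<rho> j = (let c = inverse (real (Suc n)) in
     if even j then tri c (c * (\<rho> (j div 2) + 2)) (\<rho> (j div 2))
     else if j div 2 = n then tri c 0 0 else tri (- c) 0 0)"

text \<open>The bound admits the even and odd slots with halves 0 to n, thus including slot 2 n + 1.
  Slots are disjoint, so \<open>K\<close> has at most one element.\<close>

definition decorate ::
    "nat \<Rightarrow> (nat \<Rightarrow> real) \<Rightarrow> (nat \<Rightarrow> real) \<Rightarrow> (levi_civita \<Rightarrow> levi_civita) \<Rightarrow> levi_civita \<Rightarrow> levi_civita" where
  "decorate n \<sigma> \<rho> t x = (let K = {j. j < 2 * n + 2 \<and> x \<in> slot \<sigma> j} in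
     if K = {} then t x else slot_value n \<rho> (the_elem K))"

lemma decorate_slot:
  assumes "x \<in> slot \<sigma> j" "j < 2 * n + 2"
  shows "decorate n \<sigma> \<rho> t x = slot_value n \<rho> j"
proof -
  have "{j. j < 2 * n + 2 \<and> x \<in> slot \<sigma> j} = {j}"
    using assms slot_disjoint by blast
  then show ?thesis unfolding decorate_def by simp
qed

lemma decorate_off_slots:
  assumes "\<And>j. j < 2 * n + 2 \<Longrightarrow> x \<notin> slot \<sigma> j"
  shows "decorate n \<sigma> \<rho> t x = t x"
  using assms unfolding decorate_def by auto

lemma decorate_step:
  assumes "lc_step B t"
  shows "\<exists>B. lc_step B (decorate n \<sigma> \<rho> t)"
proof -
  obtain B' where B': "lc_step B' (\<lambda>x. {j. j < 2 * n + 2 \<and> x \<in> slot \<sigma> j})"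
    using lc_step_slots by blast
  from lc_step_combine[OF B' assms, of "\<lambda>K y. if K = {} then y else slot_value n \<rho> (the_elem K)"]
  show ?thesis unfolding decorate_def Let_def by blast
qed

lemma decorate_cases:
  fixes n :: nat
  defines "c \<equiv> inverse (real (Suc n))"
  assumes real: "\<And>x. \<exists>y. t x = of_real y"
  obtains i where "i \<le> n" "x \<in> slot \<sigma> (2 * i)" "decorate n \<sigma> \<rho> t x = tri c (c * (\<rho> i + 2)) (\<rho> i)"
  | k where "x \<in> slot \<sigma> (2 * k + 1)" "decorate n \<sigma> \<rho> t x = tri c 0 0 \<or> decorate n \<sigma> \<rho> t x = tri (- c) 0 0"
  | y where "decorate n \<sigma> \<rho> t x = tri 0 0 y"
proof (cases "\<exists>j<2 * n + 2. x \<in> slot \<sigma> j")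
  case True
  then obtain j where j: "j < 2 * n + 2" "x \<in> slot \<sigma> j" by blast
  note d = decorate_slot[OF j(2,1), of \<rho> t]
  show thesis
  proof (cases "even j")
    case True
    then obtain i where "j = 2 * i" by blast
    with j d show thesis by (intro that(1)[of i]) (auto simp: slot_value_def c_def Let_def)
  next
    case False
    then obtain k where "j = 2 * k + 1" by (rule oddE)
    with j d show thesis by (intro that(2)[of k]) (auto simp: slot_value_def c_def Let_def)
  qed
next
  case False
  then have "decorate n \<sigma> \<rho> t x = t x" by (intro decorate_off_slots) blast
  with real[of x] that(3) show thesis by (metis tri_real)
qed

text \<open>Even slots carry positive leading coefficients in both members, so these partly cancel;
  where only one member is infinite, its coefficient alone is below the sum. The full sum can occur
  only on odd slots, where the lower terms vanish.\<close>

lemma decorate_diff_le: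
  fixes n m :: nat
  assumes t: "\<And>x. \<exists>y. t x = of_real y" and t': "\<And>x. \<exists>y. t' x = of_real y"
  shows "\<bar>decorate n \<sigma> \<rho> t x - decorate m \<sigma> \<rho> t' x\<bar> \<le>
    tri (inverse (real (Suc n)) + inverse (real (Suc m))) 0 0"
proof -
  define a b where "a = inverse (real (Suc n))" and "b = inverse (real (Suc m))"
  have pos: "0 < a" "0 < b" by (auto simp: a_def b_def)
  have par: "\<not> (x \<in> slot \<sigma> (2 * i) \<and> x \<in> slot \<sigma> (2 * k + 1))" for i k
  proof
    assume "x \<in> slot \<sigma> (2 * i) \<and> x \<in> slot \<sigma> (2 * k + 1)"
    then have "2 * i = 2 * k + 1" using slot_disjoint by blast
    then show False by presburger
  qed
  show ?thesis
    unfolding a_def[symmetric] b_def[symmetric]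
  proof (cases rule: decorate_cases[where t = t, OF t, where x = x and \<sigma> = \<sigma> and n = n and \<rho> = \<rho>, folded a_def])
    case n: (1 i)
    show "\<bar>decorate n \<sigma> \<rho> t x - decorate m \<sigma> \<rho> t' x\<bar> \<le> tri (a + b) 0 0"
    proof (cases rule: decorate_cases[where t = t', OF t', where x = x and \<sigma> = \<sigma> and n = m and \<rho> = \<rho>, folded b_def])
      case (1 i')
      then show ?thesis unfolding n(3) 1(3) tri_diff using pos by (intro abs_tri_le) auto
    next
      case (2 k)
      then show ?thesis using par n by blast
    next
      case (3 y)
      show ?thesis unfolding n(3) 3 tri_diff using pos by (intro abs_tri_le) auto
    qed
  next
    case n: (2 k)
    then obtain a' where a': "decorate n \<sigma> \<rho> t x = tri a' 0 0" "\<bar>a'\<bar> \<le> a"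
      using pos by (metis abs_minus_cancel abs_of_pos order_refl)
    show "\<bar>decorate n \<sigma> \<rho> t x - decorate m \<sigma> \<rho> t' x\<bar> \<le> tri (a + b) 0 0"
    proof (cases rule: decorate_cases[where t = t', OF t', where x = x and \<sigma> = \<sigma> and n = m and \<rho> = \<rho>, folded b_def])
      case (1 i')
      then show ?thesis using par n by blast
    next
      case (2 k')
      then obtain b' where "decorate m \<sigma> \<rho> t' x = tri b' 0 0" "\<bar>b'\<bar> \<le> b"
        using pos by (metis abs_minus_cancel abs_of_pos order_refl)
      then show ?thesis unfolding a'(1) using a'(2) by (auto simp: tri_diff intro!: abs_tri_le)
    next
      case (3 y)
      show ?thesis unfolding a'(1) 3 tri_diff using a'(2) pos by (intro abs_tri_le) auto
    qed
  next
    case n: (3 y)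
    show "\<bar>decorate n \<sigma> \<rho> t x - decorate m \<sigma> \<rho> t' x\<bar> \<le> tri (a + b) 0 0"
    proof (cases rule: decorate_cases[where t = t', OF t', where x = x and \<sigma> = \<sigma> and n = m and \<rho> = \<rho>, folded b_def])
      case (1 i')
      show ?thesis unfolding n 1(3) tri_diff using pos by (intro abs_tri_le) auto
    next
      case (2 k')
      then obtain b' where "decorate m \<sigma> \<rho> t' x = tri b' 0 0" "\<bar>b'\<bar> \<le> b"
        using pos by (metis abs_minus_cancel abs_of_pos order_refl)
      then show ?thesis unfolding n using pos by (auto simp: tri_diff intro!: abs_tri_le)
    next
      case (3 y')
      show ?thesis unfolding n 3 tri_diff using pos by (intro abs_tri_le) auto
    qed
  qed
qed

lemma decorate_diff_attained:
  assumes "n \<noteq> m" "x \<in> slot \<sigma> (2 * min n m + 1)"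
  shows "\<bar>decorate n \<sigma> \<rho> t x - decorate m \<sigma> \<rho> t' x\<bar> =
    tri (inverse (real (Suc n)) + inverse (real (Suc m))) 0 0"
proof -
  define a b where "a = inverse (real (Suc n))" and "b = inverse (real (Suc m))"
  have pos: "0 < a" "0 < b" by (auto simp: a_def b_def)
  have p: "0 < tri (a + b) 0 0" using tri_less[of 0 "a + b" 0 0 0 0] pos by (simp add: tri_real)
  have d: "decorate n \<sigma> \<rho> t x = (if n < m then tri a 0 0 else tri (- a) 0 0)"
    "decorate m \<sigma> \<rho> t' x = (if n < m then tri (- b) 0 0 else tri b 0 0)"
    using assms(1) decorate_slot[OF assms(2), of n \<rho> t] decorate_slot[OF assms(2), of m \<rho> t']
    by (auto simp: slot_value_def a_def b_def Let_def min_def split: if_splits)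
  have "decorate n \<sigma> \<rho> t x - decorate m \<sigma> \<rho> t' x = tri (a + b) 0 0 \<or>
    decorate n \<sigma> \<rho> t x - decorate m \<sigma> \<rho> t' x = - tri (a + b) 0 0"
    unfolding d by (auto simp: tri_diff tri_uminus)
  with p show ?thesis unfolding a_def[symmetric] b_def[symmetric] by auto
qed

lemma approximation_infinite:
  assumes f: "f \<in> real_Lp \<infinity> (ivl_set I)" and I: "lo I < hi I"
  shows "\<exists>s. approximates \<infinity> I f s"
proof -
  let ?M = "lebesgue_on (ivl_set I)" and ?K = "map_ivl of_real I :: levi_civita ivl"
  have f1 [measurable]: "f \<in> borel_measurable ?M" and f2: "esssup ?M (\<lambda>x. ereal \<bar>f x\<bar>) < \<infinity>"
    using f by (auto simp: real_Lp_def)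
  have K: "lo ?K < hi ?K" "lo ?K \<le> hi ?K" "ivl_set ?K = lc_ivl I" using I by (simp_all add: lc_ivl_def)
  obtain C \<psi> where \<psi>: "\<And>n. lc_step (C n) (\<psi> n)" and lim: "AE x in ?M. (\<lambda>n. \<psi> n x) \<longlonglongrightarrow> f x"
    using step_ae_approx[OF f1] I by (metis less_imp_le)
  have "\<forall>n. \<exists>t. lc_lift (C n) (\<psi> n) t" using lc_lift_exists[OF \<psi>] by metis
  then obtain t where t: "\<And>n. lc_lift (C n) (\<psi> n) (t n)" by metis
  have treal: "\<exists>y. t n x = of_real y" for n x using lc_lift_value[OF t] by blast
  obtain \<tau> \<rho> where "samples_sup f I \<tau> \<rho>"
    using sampling_points[OF I] by blast
  note * = this[unfolded samples_sup_def]
  have \<tau>: "\<And>i. lo I \<le> \<tau> i" "\<And>i. \<tau> i < hi I" and \<rho>: "\<And>i. - 1 \<le> \<rho> i"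
    and ex: "\<And>i w. \<tau> i < w \<Longrightarrow> exceeds f (\<tau> i) w (\<rho> i)"
    and samp: "\<And>u v r e. lo I \<le> u \<Longrightarrow> v \<le> hi I \<Longrightarrow> exceeds f u v r \<Longrightarrow> - 1 < r \<Longrightarrow> e < r \<Longrightarrow>
      \<exists>i. u \<le> \<tau> i \<and> \<tau> i < v \<and> e < \<rho> i"
    using * by simp_all
  \<comment> \<open>Each sampling point gets two adjacent slots, an even one for the sample and an
    odd one for the sign.\<close>
  define \<sigma> where "\<sigma> j = \<tau> (j div 2)" for j :: nat
  define s where "s n = decorate n \<sigma> \<rho> (t n)" for n
  have \<sigma>: "lo I \<le> \<sigma> j" "\<sigma> j < hi I" for j using \<tau> by (auto simp: \<sigma>_def)
  have slotI: "slot \<sigma> j \<subseteq> ivl_set ?K" for j unfolding K by (rule slot_subset_ivl[OF \<sigma>])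
  have step: "\<exists>B. lc_step B (s n)" for n
    unfolding s_def by (rule decorate_step[OF lc_lift_step[OF t]])
  have norm_ex: "\<exists>N. has_lc_norm \<infinity> (lc_ivl I) g N" if "lc_step B g" for B g
    using step_norm_inf_exists[OF K(1) that] by (simp add: K)
  have norm_slot: "has_lc_norm \<infinity> (lc_ivl I) g N"
    if "lc_step B g" "\<And>x. x \<in> slot \<sigma> j \<Longrightarrow> \<bar>g x\<bar> = N" "finite {x \<in> lc_ivl I. N < \<bar>g x\<bar>}" for B g N j
    unfolding K(3)[symmetric]
  proof (rule step_norm_inf[OF K(2) that(1) slot_nonempty[of \<sigma> j]])
    show "{of_real (\<sigma> j) + of_real (real j) * lc_d 1<..<of_real (\<sigma> j) + of_real (real (Suc j)) * lc_d 1} \<subseteq> ivl_set ?K"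
      using slotI[of j] unfolding slot_def .
    show "\<bar>g x\<bar> = N" if "of_real (\<sigma> j) + of_real (real j) * lc_d 1 < x"
      "x < of_real (\<sigma> j) + of_real (real (Suc j)) * lc_d 1" for x
      by (rule \<open>\<And>x. x \<in> slot \<sigma> j \<Longrightarrow> \<bar>g x\<bar> = N\<close>) (use that in \<open>simp only: slot_def greaterThanLessThan_iff simp_thms\<close>)
    show "finite {x \<in> ivl_set ?K. N < \<bar>g x\<bar>}" using that(3) unfolding K(3) .
  qed
  have cauchy: "weakly_Cauchy \<infinity> (lc_ivl I) s"
    unfolding weakly_Cauchy_def
  proof (intro conjI allI impI)
    show "s n \<in> lc_Lp \<infinity> (lc_ivl I)" for n
      using step norm_ex unfolding has_lc_norm_def by blast
    fix \<epsilon> :: real assume \<epsilon>: "0 < \<epsilon>"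
    then obtain n0 where n0: "inverse (real (Suc n0)) < \<epsilon> / 2"
      using reals_Archimedean[of "\<epsilon> / 2"] by auto
    show "\<exists>n0. \<forall>m>n0. \<forall>n>n0. \<exists>N. has_lc_norm \<infinity> (lc_ivl I) (\<lambda>x. s n x - s m x) N \<and> weakly_small \<epsilon> N"
    proof (intro exI[of _ n0] allI impI)
      fix m n assume mn: "n0 < m" "n0 < n"
      obtain B B' where "lc_step B (s n)" "lc_step B' (s m)" using step by metis
      then have st: "lc_step (B \<union> B') (\<lambda>x. s n x - s m x)" by (rule lc_step_combine)
      show "\<exists>N. has_lc_norm \<infinity> (lc_ivl I) (\<lambda>x. s n x - s m x) N \<and> weakly_small \<epsilon> N"
      proof (cases "n = m")
        case True
        then have "has_lc_norm \<infinity> (lc_ivl I) (\<lambda>x. s n x - s m x) 0"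
          by (intro norm_slot[OF st, of 0]) auto
        with \<epsilon> show ?thesis by auto
      next
        case False
        let ?N = "tri (inverse (real (Suc n)) + inverse (real (Suc m))) 0 0"
        have "\<bar>s n x - s m x\<bar> \<le> ?N" for x
          unfolding s_def by (rule decorate_diff_le) (rule treal)+
        then have fin: "{x \<in> lc_ivl I. ?N < \<bar>s n x - s m x\<bar>} = {}" by (auto simp: not_less)
        have "has_lc_norm \<infinity> (lc_ivl I) (\<lambda>x. s n x - s m x) ?N"
        proof (rule norm_slot[OF st, of "2 * min n m + 1"])
          show "\<bar>s n x - s m x\<bar> = ?N" if "x \<in> slot \<sigma> (2 * min n m + 1)" for x
            unfolding s_def by (rule decorate_diff_attained[OF False that])
          show "finite {x \<in> lc_ivl I. ?N < \<bar>s n x - s m x\<bar>}" unfolding fin by simp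
        qed
        moreover have "inverse (real (Suc n)) \<le> inverse (real (Suc n0))" "inverse (real (Suc m)) \<le> inverse (real (Suc n0))"
          "0 < inverse (real (Suc n))" "0 < inverse (real (Suc m))"
          using mn by (auto intro!: le_imp_inverse_le)
        then have "\<bar>inverse (real (Suc n)) + inverse (real (Suc m))\<bar> < \<epsilon>"
          using n0 by linarith
        then have "weakly_small \<epsilon> ?N" using \<epsilon> by (intro weakly_small_tri) auto
        ultimately show ?thesis by blast
      qed
    qed
  qed
  \<comment> \<open>The factor need agree with the indicator only on the interval itself, so the
    constant 1 with \<open>J = I\<close> yields the norms of the sequence.\<close>
  have main: "weak_lim_norm \<infinity> (lc_ivl I) (\<lambda>n x. s n x * \<kappa> x) (of_real (real_Lp_norm \<infinity> (ivl_set I) g))"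
    if J: "lo I \<le> lo J" "lo J < hi J" "hi J \<le> hi I" and st\<kappa>: "lc_step B\<kappa> \<kappa>"
      and \<kappa>: "\<And>x. x \<in> lc_ivl I \<Longrightarrow> \<kappa> x = indicator (lc_ivl J) x"
      and g: "g \<in> borel_measurable ?M" "esssup ?M (\<lambda>x. ereal \<bar>g x\<bar>) < \<infinity>"
      and gf: "\<And>x. x \<in> ivl_set I \<Longrightarrow> g x = f x * indicator (ivl_set J) x"
    for J B\<kappa> \<kappa> g
  proof -
    let ?N = "real_Lp_norm \<infinity> (ivl_set I) g"
    have N0: "0 \<le> ?N" by (rule real_Lp_norm_inf_nonneg[OF g(1) I g(2)])
    define T where "T n = {i. i \<le> n \<and> lo J \<le> \<tau> i \<and> \<tau> i < hi J}" for n
    have finT: "finite (T n)" for n by (simp add: T_def)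
    define R where "R n = Max (\<rho> ` T n)" for n
    have upper: "\<rho> i \<le> ?N" if "i \<in> T n" for i n
      using sup_norm_upper[OF g gf J] that ex by (auto simp: T_def)
    have lower: "\<exists>i. i \<in> T i \<and> e < \<rho> i" if e: "e < ?N" for e
    proof -
      \<comment> \<open>A level strictly between \<open>e\<close> and \<open>?N\<close>; the lower
        bound -1/2 keeps it above -1, where samples are available, and stays below \<open>?N\<close>
        because \<open>?N\<close> is nonnegative.\<close>
      define r where "r = max ((e + ?N) / 2) (- 1 / 2)"
      have r: "e < r" "r < ?N" "- 1 < r" using e N0 by (auto simp: r_def max_def)
      have "exceeds f (lo J) (hi J) r" by (rule sup_norm_lower[OF g gf J r(2)])
      from samp[OF J(1) J(3) this r(3,1)] show ?thesis by (auto simp: T_def)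
    qed
    obtain n1 where n1: "n1 \<in> T n1" using lower[of "?N - 1"] by auto
    then have neT: "T n \<noteq> {}" if "n \<ge> n1" for n using that by (auto simp: T_def)
    have R: "- 1 \<le> R n" "R n \<le> ?N" "\<And>i. i \<in> T n \<Longrightarrow> \<rho> i \<le> R n" if "n \<ge> n1" for n
      using finT neT[OF that] upper \<rho> unfolding R_def by (auto simp: Max_ge_iff)
    have stp: "\<exists>B. lc_step B (\<lambda>x. s n x * \<kappa> x)" for n
      using step[of n] lc_step_combine[OF _ st\<kappa>] by blast
    define c where "c n = inverse (real (Suc n))" for n
    have c: "0 < c n" for n by (simp add: c_def)
    have norm: "has_lc_norm \<infinity> (lc_ivl I) (\<lambda>x. s n x * \<kappa> x) (tri (c n) (c n * (R n + 2)) (R n))" if n: "n \<ge> n1" for n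
    proof -
      \<comment> \<open>The value on the even slot with the largest visible sample. Its positive
        coefficient at the exponent -1 also lifts it above the odd slots.\<close>
      let ?W = "tri (c n) (c n * (R n + 2)) (R n)"
      have "R n \<in> \<rho> ` T n" unfolding R_def using finT neT[OF n] by (intro Max_in) auto
      then obtain i where i: "i \<in> T n" "R n = \<rho> i" by auto
      have cR: "0 < c n * (R n + 2)" using c R(1)[OF n] by (intro mult_pos_pos) auto
      have W0: "tri (c n) 0 0 \<le> ?W" "tri 0 0 y \<le> ?W" for y
        using c[of n] cR by (auto intro!: tri_le)
      then have Wpos: "0 \<le> ?W" using W0(2)[of 0] by (simp add: tri_real)
      obtain B where B: "lc_step B (\<lambda>x. s n x * \<kappa> x)" using stp by blast
      have W: "0 < ?W" using tri_less[of 0 "c n" 0 "c n * (R n + 2)" 0 "R n"] c[of n] by (simp add: tri_real)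
      show ?thesis
      proof (rule norm_slot[OF B, of "2 * i"])
        fix x assume x: "x \<in> slot \<sigma> (2 * i)"
        have "x \<in> lc_ivl J" using slot_subset_ivl[of J \<sigma> "2 * i"] i x by (auto simp: T_def \<sigma>_def)
        moreover have "s n x = ?W"
          using decorate_slot[OF x, of n] i by (simp add: s_def slot_value_def T_def c_def Let_def)
        ultimately show "\<bar>s n x * \<kappa> x\<bar> = ?W"
          using W \<kappa>[of x] slotI[of "2 * i"] x K(3) by auto
      next
        have "\<bar>s n x * \<kappa> x\<bar> \<le> ?W" if x: "x \<in> lc_ivl I" for x
        proof (cases "x \<in> lc_ivl J")
          case False
          then show ?thesis using \<kappa>[OF x] Wpos by simp
        next
          case True
          then have "\<kappa> x = 1" using \<kappa>[OF x] by simp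
          moreover have "\<bar>s n x\<bar> \<le> ?W"
            unfolding s_def
          proof (cases rule: decorate_cases[where t = "t n", OF treal, where x = x and \<sigma> = \<sigma> and n = n and \<rho> = \<rho>, folded c_def])
            case (1 k)
            have "k \<in> T n" using slot_meets_ivl[OF 1(2) True] 1(1) by (simp add: T_def \<sigma>_def)
            then have k: "\<rho> k \<le> R n" by (rule R(3)[OF n])
            have "0 < c n * (\<rho> k + 2)" using c \<rho>[of k] by (intro mult_pos_pos) auto
            then have "0 \<le> tri (c n) (c n * (\<rho> k + 2)) (\<rho> k)"
              using tri_less[of 0 "c n" 0 "c n * (\<rho> k + 2)" 0 "\<rho> k"] c[of n] by (simp add: tri_real)
            moreover have "tri (c n) (c n * (\<rho> k + 2)) (\<rho> k) \<le> ?W"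
              using k c[of n] by (intro tri_le) auto
            ultimately show "\<bar>decorate n \<sigma> \<rho> (t n) x\<bar> \<le> ?W" unfolding 1(3) by simp
          next
            case (2 k)
            then have "\<bar>decorate n \<sigma> \<rho> (t n) x\<bar> \<le> tri (c n) 0 0"
              using abs_tri_le[of "c n" "c n" 0 0] abs_tri_le[of "- c n" "c n" 0 0] c[of n] by auto
            then show "\<bar>decorate n \<sigma> \<rho> (t n) x\<bar> \<le> ?W" using W0(1) by (rule order_trans)
          next
            case (3 y)
            show "\<bar>decorate n \<sigma> \<rho> (t n) x\<bar> \<le> ?W"
              unfolding 3 tri_real abs_of_real_lc using W0(2)[of "\<bar>y\<bar>"] by (simp add: tri_real)
          qed
          ultimately show ?thesis by simp
        qed
        then have "{x \<in> lc_ivl I. ?W < \<bar>s n x * \<kappa> x\<bar>} = {}" by (auto simp: not_less)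
        then show "finite {x \<in> lc_ivl I. ?W < \<bar>s n x * \<kappa> x\<bar>}" by (simp only: finite.emptyI)
      qed
    qed
    \<comment> \<open>Before \<open>n1\<close> there may be no sample inside \<open>J\<close>; the
      norm still exists, and its value does not affect the limit.\<close>
    define Nn where "Nn n = (if n \<ge> n1 then tri (c n) (c n * (R n + 2)) (R n)
        else SOME N. has_lc_norm \<infinity> (lc_ivl I) (\<lambda>x. s n x * \<kappa> x) N)" for n
    have Nn: "has_lc_norm \<infinity> (lc_ivl I) (\<lambda>x. s n x * \<kappa> x) (Nn n)" for n
    proof (cases "n \<ge> n1")
      case False
      have "\<exists>N. has_lc_norm \<infinity> (lc_ivl I) (\<lambda>x. s n x * \<kappa> x) N"
        using stp[of n] norm_ex by blast
      with False show ?thesis unfolding Nn_def by (simp add: someI_ex)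
    qed (simp add: Nn_def norm)
    have "weak_lim Nn (of_real ?N)"
      unfolding weak_lim_def
    proof (intro allI impI)
      fix \<epsilon> :: real assume \<epsilon>: "0 < \<epsilon>"
      obtain i where i: "i \<in> T i" "?N - \<epsilon> < \<rho> i" using lower[of "?N - \<epsilon>"] \<epsilon> by auto
      have "c \<longlonglongrightarrow> 0" unfolding c_def by (rule LIMSEQ_inverse_real_of_nat)
      then have "(\<lambda>n. c n * (?N + 2)) \<longlonglongrightarrow> 0 * (?N + 2)" by (intro tendsto_intros)
      then have "\<forall>\<^sub>F n in sequentially. c n * (?N + 2) < \<epsilon>"
        by (rule order_tendstoD(2)) (use \<epsilon> in simp)
      then show "\<forall>\<^sub>F n in sequentially. weakly_small \<epsilon> (Nn n - of_real ?N)"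
        using eventually_ge_at_top[of "max n1 i"]
      proof eventually_elim
        case (elim n)
        then have n: "n1 \<le> n" "i \<le> n" by auto
        have "i \<in> T n" using i n by (auto simp: T_def)
        then have Ri: "?N - \<epsilon> < R n" using R(3)[OF n(1)] i(2) by force
        have "0 \<le> c n * (R n + 2)" "c n * (R n + 2) \<le> c n * (?N + 2)"
          using R[OF n(1)] c[of n] by (auto intro!: mult_nonneg_nonneg mult_left_mono)
        then have "\<bar>c n * (R n + 2)\<bar> < \<epsilon>" using elim(1) by linarith
        \<comment> \<open>Since \<open>?N + 2\<close> is at least 1, the one eventual bound controls
          the leading coefficient as well.\<close>
        moreover have "c n * 1 \<le> c n * (?N + 2)"
          using N0 c[of n] by (intro mult_left_mono) auto
        then have "\<bar>c n\<bar> < \<epsilon>" using elim(1) c[of n] by linarith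
        moreover have "\<bar>R n - ?N\<bar> < \<epsilon>" using Ri R(2)[OF n(1)] by linarith
        moreover have "Nn n - of_real ?N = tri (c n) (c n * (R n + 2)) (R n - ?N)"
          using n(1) tri_diff[of "c n" "c n * (R n + 2)" "R n" 0 0 ?N] by (simp add: Nn_def tri_real)
        ultimately show ?case
          by (simp only: weakly_small_tri)
      qed
    qed
    with Nn show ?thesis unfolding weak_lim_norm_def by blast
  qed
  have "weak_lim_norm \<infinity> (lc_ivl I) s (of_real (real_Lp_norm \<infinity> (ivl_set I) f))"
    using main[of I "{}" "\<lambda>_. 1" f] I f1 f2 by (simp add: lc_step_const)
  moreover have "weak_lim_norm \<infinity> (lc_ivl I) (\<lambda>n x. s n x * indicator (lc_ivl J) x)
        (of_real (real_Lp_norm \<infinity> (ivl_set I) (\<lambda>x. f x * indicator (ivl_set J) x)))"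
    if J: "lo J \<le> hi J" "ivl_set J \<subseteq> ivl_set I" for J
  proof -
    have stJ: "lc_step (of_real ` {lo J, hi J}) (indicator (lc_ivl J) :: levi_civita \<Rightarrow> levi_civita)"
      by (rule lc_lift_step[OF lc_lift_indicator])
    have g1: "(\<lambda>x. f x * indicator (ivl_set J) x) \<in> borel_measurable ?M"
      using lc_step_measurable[OF lc_lift_real_step[OF lc_lift_indicator[of J]]]
      by (intro borel_measurable_times f1) (simp add: measurable_restrict_space1 measurable_completion)
    have "esssup ?M (\<lambda>x. ereal \<bar>f x * indicator (ivl_set J) x\<bar>) \<le> esssup ?M (\<lambda>x. ereal \<bar>f x\<bar>)"
      using g1 by (intro esssup_mono) (auto simp: indicator_def)
    also note f2
    finally have g2: "esssup ?M (\<lambda>x. ereal \<bar>f x * indicator (ivl_set J) x\<bar>) < \<infinity>" .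
    show ?thesis
    proof (cases "lo J = hi J")
      case False
      with J(1) have lt: "lo J < hi J" by simp
      have "ivl_set J \<subseteq> {lo I..hi I}" using J(2) ivl_set_subset_closed by blast
      from main[OF ivl_subset_bounds(1)[OF this lt] lt ivl_subset_bounds(2)[OF this lt] stJ _ g1 g2]
      show ?thesis by simp
    next
      \<comment> \<open>A degenerate \<open>J\<close> contains at most one real point and no slot,
        so each product vanishes on slot 0 and off that point, and all norms are 0.\<close>
      case True
      have "lc_ivl J \<subseteq> {of_real (lo J)}" "ivl_set J \<subseteq> {lo J}"
        using True ivl_set_subset_closed[of J] ivl_set_subset_closed[of "map_ivl of_real J :: levi_civita ivl"]
        by (auto simp: lc_ivl_def)
      note sub = this
      have "has_lc_norm \<infinity> (lc_ivl I) (\<lambda>x. s n x * indicator (lc_ivl J) x) 0" for n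
      proof -
        obtain B where "lc_step B (s n)" using step by blast
        from lc_step_combine[OF this stJ]
        have st: "lc_step (B \<union> of_real ` {lo J, hi J}) (\<lambda>x. s n x * indicator (lc_ivl J) x)" .
        show ?thesis
        proof (rule norm_slot[OF st, of 0])
          show "\<bar>s n x * indicator (lc_ivl J) x\<bar> = 0" if "x \<in> slot \<sigma> 0" for x
            using that sub(1) of_real_notin_slot[of "lo J" \<sigma> 0] by (auto simp: indicator_def)
          have "{x \<in> lc_ivl I. 0 < \<bar>s n x * indicator (lc_ivl J) x\<bar>} \<subseteq> {of_real (lo J)}"
            using sub(1) by (auto simp: indicator_def split: if_splits)
          then show "finite {x \<in> lc_ivl I. 0 < \<bar>s n x * indicator (lc_ivl J) x\<bar>}"
            by (rule finite_subset) simp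
        qed
      qed
      moreover have "real_Lp_norm \<infinity> (ivl_set I) (\<lambda>x. f x * indicator (ivl_set J) x) = 0"
      proof (rule antisym)
        have "AE x in lebesgue. x \<notin> {lo J}"
          by (rule AE_not_in) (simp add: negligible_iff_null_sets [symmetric])
        then have "AE x in lebesgue. x \<in> ivl_set I \<longrightarrow> \<bar>f x * indicator (ivl_set J) x\<bar> \<le> 0"
          by (rule eventually_mono) (use sub(2) in \<open>auto simp: indicator_def\<close>)
        then show "real_Lp_norm \<infinity> (ivl_set I) (\<lambda>x. f x * indicator (ivl_set J) x) \<le> 0"
          by (intro real_Lp_norm_inf_least[OF g1 I g2]) (simp add: AE_lebesgue_on_iff ivl_set_lebesgue)
      qed (rule real_Lp_norm_inf_nonneg[OF g1 I g2])
      ultimately show ?thesis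
        unfolding weak_lim_norm_def by (intro exI[of _ "\<lambda>_. 0"]) (simp add: weak_lim_def)
    qed
  qed
  moreover have "AE x in ?M. \<exists>r :: nat \<Rightarrow> nat. strict_mono r \<and>
      weak_lim (\<lambda>k. s (r k) (of_real x)) (of_real (f x))"
    using lim
  proof eventually_elim
    case (elim x)
    \<comment> \<open>Real points lie in no slot, so the modifications leave the pointwise limits
      intact.\<close>
    have "s n (of_real x) = of_real (\<psi> n x)" for n
      unfolding s_def lc_lift_of_real[OF t, symmetric]
      by (rule decorate_off_slots) (rule of_real_notin_slot)
    with elim show ?case
      by (intro exI[of _ id]) (simp add: strict_mono_id weak_lim_of_real)
  qed
  moreover have "lc_measurable_fun (lc_ivl I) (s n)" for n
    using step[of n] step_measurable_fun[OF K(2)] unfolding K(3) by blast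
  ultimately show ?thesis
    using cauchy unfolding approximates_def by blast
qed

theorem theorem5p1:
  fixes I :: "real ivl" and p :: ereal and f :: "real \<Rightarrow> real"
  assumes "lo I \<le> hi I"
    and "1 \<le> p"
    and "p = \<infinity> \<Longrightarrow> lo I < hi I"
    and "f \<in> real_Lp p (ivl_set I)"
  shows "\<exists>s :: nat \<Rightarrow> levi_civita \<Rightarrow> levi_civita.
    (\<forall>n. lc_measurable_fun (lc_ivl I) (s n)) \<and>
    weakly_Cauchy p (lc_ivl I) s \<and>
    weak_lim_norm p (lc_ivl I) s (of_real (real_Lp_norm p (ivl_set I) f)) \<and>
    (\<forall>J :: real ivl. lo J \<le> hi J \<and> ivl_set J \<subseteq> ivl_set I \<longrightarrow>
      weak_lim_norm p (lc_ivl I) (\<lambda>n x. s n x * indicator (lc_ivl J) x)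
        (of_real (real_Lp_norm p (ivl_set I) (\<lambda>x. f x * indicator (ivl_set J) x)))) \<and>
    (AE x in lebesgue_on (ivl_set I). \<exists>r :: nat \<Rightarrow> nat. strict_mono r \<and>
      weak_lim (\<lambda>k. s (r k) (of_real x)) (of_real (f x)))"
  using assms approximation_finite approximation_infinite
  unfolding approximates_def [symmetric]
  by (cases p) auto

end
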